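(* Consider invariant $f$-structures up to sign and invariant Riemannian metrics up to homothety on the flag manifold $M=SU(3)/T_{max}$. Call a nearly Kähler $f$-structure strict if it is not a Kähler $f$-structure. (1) The only invariant strictly nearly Kähler $f$-structure of rank $6$ on $M$ is $J_1=(1,1,1)$ with respect to the metric $g=(1,1,1)$. (2) The invariant strictly nearly Kähler $f$-structures of rank $4$ on $M$ and the corresponding invariant Riemannian metrics are exactly: $$ \begin{array}{lll} f_1=(1,1,0), & g_s=(1,1,s), & s>0;\\ f_2=(1,0,1), & g_t=(1,t,1), & t>0;\\ f_3=(0,1,1), & g_t=(1,t,t), & t>0. \end{array} $$ (3) The invariant $f$-structures of rank $2$, namely $f_7=(1,0,0)$, $f_8=(0,1,0)$, $f_9=(0,0,1)$, are strictly nearly Kähler $f$-structures with respect to all invariant Riemannian metrics $g=(1,t,s)$, $t,s>0$.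
   Context: Setting. $T_{max}\subset SU(3)$ is the subgroup of diagonal matrices. Let $\mathfrak g=\mathfrak{su}(3)=\mathfrak h\oplus\mathfrak m$, where $\mathfrak h$ consists of the diagonal matrices in $\mathfrak{su}(3)$ and $\mathfrak m$ consists of the matrices $$D(a,b,c)=\begin{pmatrix}0&a&\overline c\\-\overline a&0&b\\-c&-\overline b&0\end{pmatrix},\quad a,b,c\in\mathbb C.$$ Identify $\mathfrak m$ with the tangent space $T_o M$ of $M=SU(3)/T_{max}$ at $o=T_{max}$. Put $\mathfrak m_1=\{D(a,0,0)\}$, $\mathfrak m_2=\{D(0,b,0)\}$, $\mathfrak m_3=\{D(0,0,c)\}$, so $\mathfrak m=\mathfrak m_1\oplus\mathfrak m_2\oplus\mathfrak m_3$. Invariant metrics. Let $\langle X,Y\rangle_o=-\frac12\operatorname{Re}\operatorname{tr}(XY)$. For $\lambda_1,\lambda_2,\lambda_3>0$, $g=(\lambda_1,\lambda_2,\lambda_3)$ denotes the $SU(3)$-invariant Riemannian metric on $M$ whose value at $o$ makes the $\mathfrak m_j$ mutually orthogonal and equals $\lambda_j\langle\cdot,\cdot\rangle_o$ on $\mathfrak m_j$, $j=1,2,3$. Every $SU(3)$-invariant Riemannian metric on $M$ is of this form; up to homothety it can be written $g=(1,t,s)$ with $t,s>0$. The metric $(1,1,1)$ is naturally reductive with respect to $\mathfrak g=\mathfrak h\oplus\mathfrak m$. Invariant $f$-structures. An $f$-structure is a $(1,1)$-tensor field $f$ with $f^3+f=0$; its rank is $\dim \operatorname{Im} f$. For $\zeta_1,\zeta_2,\zeta_3\in\{-1,0,1\}$,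 $f=(\zeta_1,\zeta_2,\zeta_3)$ denotes the $SU(3)$-invariant $f$-structure on $M$ given at $o$ by $D(a,b,c)\mapsto D(\zeta_1 ia,\zeta_2 ib,\zeta_3 ic)$. Every $SU(3)$-invariant $f$-structure on $M$ is of this form, and each is a metric $f$-structure (i.e. $g(fX,Y)+g(X,fY)=0$) for every invariant Riemannian metric $g$. Classes. Let $\nabla$ be the Levi-Civita connection of $g$ and $\nabla_X(f)Y=\nabla_X(fY)-f\nabla_XY$. A metric $f$-structure $f$ on $(M,g)$ is a Kähler $f$-structure if $\nabla_X(f)Y=0$ for all vector fields $X,Y$; it is a nearly Kähler $f$-structure ($NKf$-structure) if $\nabla_{fX}(f)fX=0$ for all vector fields $X$. *)

theory Defs
  imports "HOL-Analysis.Analysis" "HOL-Library.Function_Algebras"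
begin

(* Tangent vectors are represented as functionals on functions, so the pointwise
   real vector space structure on function types is used throughout. *)
instantiation "fun" :: (type, real_vector) real_vector
begin

definition scaleR_fun :: "real \<Rightarrow> ('a \<Rightarrow> 'b) \<Rightarrow> 'a \<Rightarrow> 'b"
  where "scaleR_fun r f = (\<lambda>x. r *\<^sub>R f x)"

instance
  by standard (auto simp: scaleR_fun_def fun_eq_iff scaleR_add_right scaleR_add_left)

end


section \<open>Smooth functions\<close>

primrec Ck_on :: "nat \<Rightarrow> 'a::real_normed_vector set \<Rightarrow> ('a \<Rightarrow> 'b::real_normed_vector) \<Rightarrow> bool"
  where
    "Ck_on 0 U F \<longleftrightarrow> continuous_on U F"
  | "Ck_on (Suc k) U F \<longleftrightarrow>
       (\<forall>x\<in>U. F differentiable (at x)) \<and>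
       (\<forall>v. Ck_on k U (\<lambda>x. frechet_derivative F (at x) v))"

(* For an arbitrary subset S of a normed space: local extendability to C-infinity functions
   on open sets. On an embedded submanifold S this is smoothness for the
   submanifold structure, and on an open S it is ordinary smoothness. *)
definition smooth_on :: "'a::real_normed_vector set \<Rightarrow> ('a \<Rightarrow> 'b::real_normed_vector) \<Rightarrow> bool"
  where "smooth_on S f \<longleftrightarrow>
    (\<forall>x\<in>S. \<exists>U F. open U \<and> x \<in> U \<and> (\<forall>k. Ck_on k U F) \<and> (\<forall>y\<in>S \<inter> U. F y = f y))"


section \<open>The flag manifold\<close>

type_synonym cmat = "complex^3^3"

definition cadjoint :: "cmat \<Rightarrow> cmat"
  where "cadjoint A = (\<chi> i j. cnj (A $ j $ i))"

definition SU3 :: "cmat set"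
  where "SU3 = {A. cadjoint A ** A = mat 1 \<and> det A = 1}"

definition Tmax :: "cmat set"
  where "Tmax = {A \<in> SU3. \<forall>i j. i \<noteq> j \<longrightarrow> A $ i $ j = 0}"

type_synonym point = "cmat set"

definition coset :: "cmat \<Rightarrow> point"
  where "coset h = {h ** t | t. t \<in> Tmax}"

definition M :: "point set"
  where "M = coset ` SU3"

definition base_point :: point
  where "base_point = Tmax"

definition translate :: "cmat \<Rightarrow> point \<Rightarrow> point"
  where "translate h p = (\<lambda>x. h ** x) ` p"

(* Quotient smooth structure: the projection of SU(3) onto M is a surjective submersion. *)
definition smooth_M :: "(point \<Rightarrow> real) set"
  where "smooth_M = {\<phi>. smooth_on SU3 (\<lambda>h. \<phi> (coset h))}"


section \<open>Tangent vectors and vector fields\<close>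

type_synonym tangent = "(point \<Rightarrow> real) \<Rightarrow> real"
type_synonym vfield = "point \<Rightarrow> tangent"

definition smooth_curve_M :: "(real \<Rightarrow> point) \<Rightarrow> bool"
  where "smooth_curve_M \<gamma> \<longleftrightarrow>
    (\<forall>s. \<gamma> s \<in> M) \<and> (\<forall>\<phi>\<in>smooth_M. smooth_on UNIV (\<lambda>s. \<phi> (\<gamma> s)))"

(* The velocity at time 0, acting on smooth functions by differentiation along the curve.
   The value 0 on non-smooth functions is a convention. It makes equality of functionals
   equality of tangent vectors. *)
definition velocity :: "(real \<Rightarrow> point) \<Rightarrow> tangent"
  where "velocity \<gamma> = (\<lambda>\<phi>. if \<phi> \<in> smooth_M then deriv (\<lambda>s. \<phi> (\<gamma> s)) 0 else 0)"

definition tangent_space :: "point \<Rightarrow> tangent set"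
  where "tangent_space p = {velocity \<gamma> | \<gamma>. smooth_curve_M \<gamma> \<and> \<gamma> 0 = p}"

definition push :: "cmat \<Rightarrow> tangent \<Rightarrow> tangent"
  where "push h v = (\<lambda>\<phi>. v (\<lambda>p. \<phi> (translate h p)))"

(* Vector fields are set to 0 at arguments that are not points of M, so that equality of
   functions is equality of vector fields. *)
definition vector_fields :: "vfield set"
  where "vector_fields = {X. (\<forall>p\<in>M. X p \<in> tangent_space p) \<and> (\<forall>p. p \<notin> M \<longrightarrow> X p = 0) \<and>
    (\<forall>\<phi>\<in>smooth_M. (\<lambda>p. X p \<phi>) \<in> smooth_M)}"

definition lie_bracket :: "vfield \<Rightarrow> vfield \<Rightarrow> vfield"
  where "lie_bracket X Y = (\<lambda>p \<phi>. X p (\<lambda>q. Y q \<phi>) - Y p (\<lambda>q. X q \<phi>))"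


section \<open>Riemannian metrics and the Levi-Civita connection\<close>

type_synonym metric = "point \<Rightarrow> tangent \<Rightarrow> tangent \<Rightarrow> real"

definition riemannian_metric :: "metric \<Rightarrow> bool"
  where "riemannian_metric g \<longleftrightarrow>
    (\<forall>p\<in>M. \<forall>u\<in>tangent_space p. \<forall>v\<in>tangent_space p. \<forall>w\<in>tangent_space p. \<forall>a b.
       g p (a *\<^sub>R u + b *\<^sub>R v) w = a * g p u w + b * g p v w) \<and>
    (\<forall>p\<in>M. \<forall>u\<in>tangent_space p. \<forall>v\<in>tangent_space p. g p u v = g p v u) \<and>
    (\<forall>p\<in>M. \<forall>u\<in>tangent_space p. u \<noteq> 0 \<longrightarrow> g p u u > 0) \<and>
    (\<forall>X\<in>vector_fields. \<forall>Y\<in>vector_fields. (\<lambda>p. g p (X p) (Y p)) \<in> smooth_M)"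

definition invariant_metric :: "metric \<Rightarrow> bool"
  where "invariant_metric g \<longleftrightarrow> riemannian_metric g \<and>
    (\<forall>h\<in>SU3. \<forall>p\<in>M. \<forall>u\<in>tangent_space p. \<forall>v\<in>tangent_space p.
       g (translate h p) (push h u) (push h v) = g p u v)"

definition levi_civita :: "metric \<Rightarrow> (vfield \<Rightarrow> vfield \<Rightarrow> vfield) \<Rightarrow> bool"
  where "levi_civita g D \<longleftrightarrow>
    (\<forall>X\<in>vector_fields. \<forall>Y\<in>vector_fields. D X Y \<in> vector_fields) \<and>
    (\<forall>X\<in>vector_fields. \<forall>X'\<in>vector_fields. \<forall>Y\<in>vector_fields. D (X + X') Y = D X Y + D X' Y) \<and>
    (\<forall>\<psi>\<in>smooth_M. \<forall>X\<in>vector_fields. \<forall>Y\<in>vector_fields.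
       D (\<lambda>p. \<psi> p *\<^sub>R X p) Y = (\<lambda>p. \<psi> p *\<^sub>R D X Y p)) \<and>
    (\<forall>X\<in>vector_fields. \<forall>Y\<in>vector_fields. \<forall>Y'\<in>vector_fields. D X (Y + Y') = D X Y + D X Y') \<and>
    (\<forall>\<psi>\<in>smooth_M. \<forall>X\<in>vector_fields. \<forall>Y\<in>vector_fields.
       D X (\<lambda>p. \<psi> p *\<^sub>R Y p) = (\<lambda>p. X p \<psi> *\<^sub>R Y p + \<psi> p *\<^sub>R D X Y p)) \<and>
    (\<forall>X\<in>vector_fields. \<forall>Y\<in>vector_fields. D X Y - D Y X = lie_bracket X Y) \<and>
    (\<forall>X\<in>vector_fields. \<forall>Y\<in>vector_fields. \<forall>Z\<in>vector_fields. \<forall>p\<in>M.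
       X p (\<lambda>q. g q (Y q) (Z q)) = g p (D X Y p) (Z p) + g p (Y p) (D X Z p))"

(* Such an operator is unique on vector_fields; its values elsewhere are irrelevant. *)
definition nabla :: "metric \<Rightarrow> vfield \<Rightarrow> vfield \<Rightarrow> vfield"
  where "nabla g = (SOME D. levi_civita g D)"


section \<open>f-structures\<close>

type_synonym endo_field = "point \<Rightarrow> tangent \<Rightarrow> tangent"

definition app :: "endo_field \<Rightarrow> vfield \<Rightarrow> vfield"
  where "app f X = (\<lambda>p. if p \<in> M then f p (X p) else 0)"

definition tensor_field_11 :: "endo_field \<Rightarrow> bool"
  where "tensor_field_11 f \<longleftrightarrow>
    (\<forall>p\<in>M. \<forall>v\<in>tangent_space p. f p v \<in> tangent_space p) \<and>
    (\<forall>p\<in>M. \<forall>u\<in>tangent_space p. \<forall>v\<in>tangent_space p. \<forall>a b.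
       f p (a *\<^sub>R u + b *\<^sub>R v) = a *\<^sub>R f p u + b *\<^sub>R f p v) \<and>
    (\<forall>X\<in>vector_fields. app f X \<in> vector_fields)"

definition f_structure :: "endo_field \<Rightarrow> bool"
  where "f_structure f \<longleftrightarrow> tensor_field_11 f \<and>
    (\<forall>p\<in>M. \<forall>v\<in>tangent_space p. f p (f p (f p v)) + f p v = 0)"

definition has_rank :: "endo_field \<Rightarrow> nat \<Rightarrow> bool"
  where "has_rank f r \<longleftrightarrow> (\<forall>p\<in>M. dim (f p ` tangent_space p) = r)"

definition invariant_f_structure :: "endo_field \<Rightarrow> bool"
  where "invariant_f_structure f \<longleftrightarrow> f_structure f \<and>
    (\<forall>h\<in>SU3. \<forall>p\<in>M. \<forall>v\<in>tangent_space p. f (translate h p) (push h v) = push h (f p v))"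

definition metric_f_structure :: "metric \<Rightarrow> endo_field \<Rightarrow> bool"
  where "metric_f_structure g f \<longleftrightarrow> riemannian_metric g \<and> f_structure f \<and>
    (\<forall>p\<in>M. \<forall>u\<in>tangent_space p. \<forall>v\<in>tangent_space p. g p (f p u) v + g p u (f p v) = 0)"

definition nabla_f :: "metric \<Rightarrow> endo_field \<Rightarrow> vfield \<Rightarrow> vfield \<Rightarrow> vfield"
  where "nabla_f g f X Y = nabla g X (app f Y) - app f (nabla g X Y)"

definition kahler_f_structure :: "metric \<Rightarrow> endo_field \<Rightarrow> bool"
  where "kahler_f_structure g f \<longleftrightarrow> metric_f_structure g f \<and>
    (\<forall>X\<in>vector_fields. \<forall>Y\<in>vector_fields. nabla_f g f X Y = 0)"

definition nearly_kahler_f_structure :: "metric \<Rightarrow> endo_field \<Rightarrow> bool"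
  where "nearly_kahler_f_structure g f \<longleftrightarrow> metric_f_structure g f \<and>
    (\<forall>X\<in>vector_fields. nabla_f g f (app f X) (app f X) = 0)"

definition strictly_nearly_kahler :: "metric \<Rightarrow> endo_field \<Rightarrow> bool"
  where "strictly_nearly_kahler g f \<longleftrightarrow>
    nearly_kahler_f_structure g f \<and> \<not> kahler_f_structure g f"


section \<open>Invariant structures given at the base point\<close>

definition Dmat :: "complex \<Rightarrow> complex \<Rightarrow> complex \<Rightarrow> cmat"
  where "Dmat a b c = vector [vector [0, a, cnj c], vector [- cnj a, 0, b], vector [- c, - cnj b, 0]]"

definition \<mm> :: "cmat set"
  where "\<mm> = {Dmat a b c | a b c. True}"

(* The differential at the identity of the projection SU(3) \<rightarrow> M; restricted to \<mm> it is
   the identification of \<mm> with the tangent space at the base point. *)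
definition dproj :: "cmat \<Rightarrow> tangent"
  where "dproj X = (THE v. \<exists>c. smooth_on UNIV c \<and> (\<forall>s. c s \<in> SU3) \<and> c 0 = mat 1 \<and>
    (c has_vector_derivative X) (at 0) \<and> v = velocity (\<lambda>s. coset (c s)))"

definition to_m :: "tangent \<Rightarrow> cmat"
  where "to_m v = inv_into \<mm> dproj v"

definition ip :: "cmat \<Rightarrow> cmat \<Rightarrow> real"
  where "ip X Y = - (1/2) * Re (trace (X ** Y))"

(* The entries (1,2), (2,3) and -(3,1) of D(a,b,c) are a, b, c. *)
definition metric_m :: "real \<Rightarrow> real \<Rightarrow> real \<Rightarrow> cmat \<Rightarrow> cmat \<Rightarrow> real"
  where "metric_m l1 l2 l3 X Y =
    l1 * ip (Dmat (X $ 1 $ 2) 0 0) (Dmat (Y $ 1 $ 2) 0 0) +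
    l2 * ip (Dmat 0 (X $ 2 $ 3) 0) (Dmat 0 (Y $ 2 $ 3) 0) +
    l3 * ip (Dmat 0 0 (- X $ 3 $ 1)) (Dmat 0 0 (- Y $ 3 $ 1))"

definition f_m :: "int \<Rightarrow> int \<Rightarrow> int \<Rightarrow> cmat \<Rightarrow> cmat"
  where "f_m z1 z2 z3 X = Dmat (of_int z1 * \<i> * X $ 1 $ 2) (of_int z2 * \<i> * X $ 2 $ 3)
    (of_int z3 * \<i> * (- X $ 3 $ 1))"

(* A representative of the coset p. The two structures below do not depend on its choice,
   because metric_m and f_m are Ad(Tmax)-invariant. *)
definition repr :: "point \<Rightarrow> cmat"
  where "repr p = (SOME h. h \<in> SU3 \<and> coset h = p)"

definition inv_metric :: "real \<Rightarrow> real \<Rightarrow> real \<Rightarrow> metric"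
  where "inv_metric l1 l2 l3 p u v =
    metric_m l1 l2 l3 (to_m (push (matrix_inv (repr p)) u)) (to_m (push (matrix_inv (repr p)) v))"

definition inv_f :: "int \<Rightarrow> int \<Rightarrow> int \<Rightarrow> endo_field"
  where "inv_f z1 z2 z3 p v =
    push (repr p) (dproj (f_m z1 z2 z3 (to_m (push (matrix_inv (repr p)) v))))"

definition eq_up_to_sign :: "endo_field \<Rightarrow> endo_field \<Rightarrow> bool"
  where "eq_up_to_sign f f' \<longleftrightarrow>
    (\<forall>p\<in>M. \<forall>v\<in>tangent_space p. f p v = f' p v) \<or>
    (\<forall>p\<in>M. \<forall>v\<in>tangent_space p. f p v = - f' p v)"

definition homothetic :: "metric \<Rightarrow> metric \<Rightarrow> bool"
  where "homothetic g g' \<longleftrightarrow>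
    (\<exists>r>0. \<forall>p\<in>M. \<forall>u\<in>tangent_space p. \<forall>v\<in>tangent_space p. g p u v = r * g' p u v)"

end

theory Submission
  imports Defs
begin

text \<open>
  A function on \<open>M\<close> is a right-\<open>Tmax\<close>-invariant function on \<open>SU(3)\<close>, and Gram-Schmidt gives a smooth
  retraction of an open set of matrices onto \<open>SU(3)\<close> that is equivariant under the torus. Thus smooth functions on
  \<open>M\<close> become smooth functions on an open set of a vector space, and a vector field \<open>X\<close> becomes a smooth
  \<open>Tmax\<close>-equivariant map \<open>x\<close> from \<open>SU(3)\<close> to \<open>\<mm>\<close>. In this picture the Levi-Civita
  connection of \<open>(\<lambda>\<^sub>1, \<lambda>\<^sub>2, \<lambda>\<^sub>3)\<close> is the derivative of \<open>y\<close> along \<open>x\<close> plus a bilinear term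
  \<open>\<Lambda>(x, y)\<close>, and since \<open>f\<close> acts on \<open>\<mm>\<close> by a constant linear map, the covariant derivative of \<open>f\<close> only involves \<open>\<Lambda>\<close>.
  The conditions on \<open>f\<close> become equations between the \<open>\<lambda>\<^sub>i\<close> and \<open>\<zeta>\<^sub>i\<close>. Invariant metrics and \<open>f\<close>-structures are
  classified by Schur's lemma for the torus action on \<open>\<mm>\<close>.
\<close>

section \<open>Smooth functions on open sets\<close>

text \<open>The definitions give no charts: points are cosets, tangent vectors are functionals, and
  a curve in M comes without a lift to SU(3). The retraction supplies an open set on which
  derivatives are unambiguous; the entries of the three line projectors supply enough global
  functions to lift curves and to separate tangent vectors. Since \<open>nabla\<close> is a choice
  among operators satisfying the axioms, existence and uniqueness of the connection must both be
  proved before it can be computed. The tensor conditions become pointwise because every vector of m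
  is the value at the identity of a global vector field. The bracket of two different summands of m
  lies in the third one, so the bilinear term has only the six monomials \<open>x_i * y_j\<close>
  with i different from j. In the nearly Kaehler condition both arguments are images under f, so
  only pairs with both zetas nonzero contribute: no equation for rank 2, one for rank 4, three for
  rank 6. Strictness then removes the mixed-sign solutions of rank 6, where one metric coefficient
  is the sum of the other two.\<close>

lemma Ck_on_cong:
  assumes "open U" "\<And>x. x \<in> U \<Longrightarrow> F x = G x" "Ck_on k U F"
  shows "Ck_on k U G"
  using assms(2,3)
proof (induction k arbitrary: F G)
  case 0
  then show ?case by (simp cong: continuous_on_cong)
next
  case (Suc k)
  have hd: "(G has_derivative frechet_derivative F (at x)) (at x)" if "x \<in> U" for x
  proof -
    have "(F has_derivative frechet_derivative F (at x)) (at x)"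
      using Suc.prems that by (simp add: frechet_derivative_works)
    then show ?thesis
      by (rule has_derivative_transform_within_open[OF _ assms(1) that]) (use Suc.prems in auto)
  qed
  have "frechet_derivative G (at x) = frechet_derivative F (at x)" if "x \<in> U" for x
    using frechet_derivative_at[OF hd[OF that]] by simp
  then have "Ck_on k U (\<lambda>x. frechet_derivative G (at x) v)" for v
    using Suc.IH[of "\<lambda>x. frechet_derivative F (at x) v" "\<lambda>x. frechet_derivative G (at x) v"] Suc.prems
    by simp
  then show ?case using hd by (auto simp: differentiable_def)
qed

text \<open>On an open set a derivative is unique, so any hand-written \<open>F'\<close> may stand
  in for \<open>frechet_derivative\<close>. Most closure rules below raise the order through this
  rule.\<close>

lemma Ck_on_SucI:
  assumes "open U" "\<And>x. x \<in> U \<Longrightarrow> (F has_derivative F' x) (at x)"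
    "\<And>v. Ck_on k U (\<lambda>x. F' x v)"
  shows "Ck_on (Suc k) U F"
proof -
  have "Ck_on k U (\<lambda>x. frechet_derivative F (at x) v)" for v
    by (rule Ck_on_cong[OF assms(1) _ assms(3)[of v]])
      (simp add: frechet_derivative_at[OF assms(2), symmetric])
  then show ?thesis using assms(2) by (auto simp: differentiable_def)
qed

lemma Ck_on_has_derivative:
  "Ck_on (Suc k) U F \<Longrightarrow> x \<in> U \<Longrightarrow> (F has_derivative frechet_derivative F (at x)) (at x)"
  by (simp add: frechet_derivative_works)

text \<open>Continuity is demanded only at order 0; at higher orders it comes from
  differentiability. The product and chain rules need this descent, since a function there stands
  next to a derivative of lower order.\<close>

lemma Ck_on_SucD: "Ck_on (Suc k) U F \<Longrightarrow> Ck_on k U F"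
proof (induction k arbitrary: F)
  case 0
  then show ?case
    by (auto intro!: continuous_at_imp_continuous_on differentiable_imp_continuous_within)
next
  case (Suc k)
  then show ?case by (metis Ck_on.simps(2))
qed

lemma Ck_on_subset: "Ck_on k U F \<Longrightarrow> V \<subseteq> U \<Longrightarrow> Ck_on k V F"
  by (induction k arbitrary: F) (auto intro: continuous_on_subset)

lemma Ck_on_local:
  assumes "\<And>x. x \<in> U \<Longrightarrow> \<exists>V. open V \<and> x \<in> V \<and> Ck_on k V F"
  shows "Ck_on k U F"
  using assms
proof (induction k arbitrary: F)
  case 0
  then show ?case
    by (auto intro!: continuous_at_imp_continuous_on simp: continuous_on_eq_continuous_at) 
      (metis continuous_on_eq_continuous_at)
next
  case (Suc k)
  have "F differentiable (at x)" if "x \<in> U" for x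
    using Suc.prems[OF that] by auto
  moreover have "Ck_on k U (\<lambda>x. frechet_derivative F (at x) v)" for v
    by (rule Suc.IH) (use Suc.prems in fastforce)
  ultimately show ?case by simp
qed

lemma Ck_on_const [simp]: "Ck_on k U (\<lambda>x. c)"
proof (induction k arbitrary: c)
  case (Suc k)
  then show ?case by (simp add: frechet_derivative_const)
qed simp

lemma Ck_on_id:
  assumes "open U" shows "Ck_on k U (\<lambda>x. x)"
proof (cases k)
  case (Suc j)
  show ?thesis unfolding Suc by (rule Ck_on_SucI[OF assms has_derivative_ident]) simp
qed simp

lemma Ck_on_add:
  assumes "open U" "Ck_on k U F" "Ck_on k U G"
  shows "Ck_on k U (\<lambda>x. F x + G x)"
  using assms(2,3)
proof (induction k arbitrary: F G)
  case (Suc k)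
  show ?case
    by (rule Ck_on_SucI[OF assms(1) has_derivative_add[OF Ck_on_has_derivative[OF Suc.prems(1)]
            Ck_on_has_derivative[OF Suc.prems(2)]] Suc.IH]) (use Suc.prems in auto)
qed (auto intro: continuous_on_add)

lemma Ck_on_linear:
  assumes "open U" "bounded_linear L" "Ck_on k U F"
  shows "Ck_on k U (\<lambda>x. L (F x))"
  using assms(3)
proof (induction k arbitrary: F)
  case 0
  then show ?case using bounded_linear.continuous_on[OF assms(2)] by simp
next
  case (Suc k)
  show ?case
    by (rule Ck_on_SucI[OF assms(1) bounded_linear.has_derivative[OF assms(2)
          Ck_on_has_derivative[OF Suc.prems]] Suc.IH]) (use Suc.prems in auto)
qed

lemma Ck_on_bilinear:
  assumes "open U" "bounded_bilinear B" "Ck_on k U F" "Ck_on k U G"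
  shows "Ck_on k U (\<lambda>x. B (F x) (G x))"
  using assms(3,4)
proof (induction k arbitrary: F G)
  case 0
  then show ?case using bounded_bilinear.continuous_on[OF assms(2)] by simp
next
  case (Suc k)
  show ?case
    by (rule Ck_on_SucI[OF assms(1) bounded_bilinear.FDERIV[OF assms(2) Ck_on_has_derivative[OF Suc.prems(1)]
            Ck_on_has_derivative[OF Suc.prems(2)]]], assumption, assumption)
      (rule Ck_on_add[OF assms(1) Suc.IH Suc.IH]; use Suc.prems Ck_on_SucD in auto)
qed

lemma Ck_on_sum:
  assumes "open U" "\<And>i. i \<in> I \<Longrightarrow> Ck_on k U (F i)"
  shows "Ck_on k U (\<lambda>x. \<Sum>i\<in>I. F i x)"
  using assms(2) by (induction I rule: infinite_finite_induct) (auto intro: Ck_on_add[OF assms(1)])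

lemma frechet_derivative_expand:
  fixes F :: "'a::euclidean_space \<Rightarrow> 'b::real_normed_vector"
  assumes "F differentiable (at x)"
  shows "frechet_derivative F (at x) w = (\<Sum>b\<in>Basis. (w \<bullet> b) *\<^sub>R frechet_derivative F (at x) b)"
proof -
  have "linear (frechet_derivative F (at x))"
    using assms by (simp add: linear_frechet_derivative)
  then show ?thesis
    by (subst (1) euclidean_representation[of w, symmetric]) 
      (simp add: linear_sum linear_cmul)
qed

text \<open>\<open>Ck_on\<close> controls derivatives in fixed directions only. Expanding the moving
  direction \<open>V x\<close> in the finite basis leaves products of coefficients and fixed
  directional derivatives. The base point \<open>P x\<close> is kept separate from x so that the
  chain rule can evaluate the outer derivative at the inner function.\<close>

lemma Ck_on_frechet_derivative:
  fixes F :: "'b::euclidean_space \<Rightarrow> 'c::real_normed_vector"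
  assumes "open U" "\<And>x. x \<in> U \<Longrightarrow> F differentiable (at (P x))" "Ck_on k U V"
    "\<And>b. Ck_on k U (\<lambda>x. frechet_derivative F (at (P x)) b)"
  shows "Ck_on k U (\<lambda>x. frechet_derivative F (at (P x)) (V x))"
proof -
  have "Ck_on k U (\<lambda>x. \<Sum>b\<in>Basis. (V x \<bullet> b) *\<^sub>R frechet_derivative F (at (P x)) b)"
    by (rule Ck_on_sum[OF assms(1)], rule Ck_on_bilinear[OF assms(1) bounded_bilinear_scaleR],
        rule Ck_on_linear[OF assms(1) bounded_linear_inner_left assms(3)], rule assms(4))
  then show ?thesis
    by (rule Ck_on_cong[OF assms(1), rotated])
      (use frechet_derivative_expand[OF assms(2)] in auto)
qed

text \<open>The induction changes only the outer function: the derivative of the composite is that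
  of G at \<open>F x\<close> in a moving direction, and the induction hypothesis is applied to the
  directional derivatives of G with the same F.\<close>

lemma Ck_on_compose:
  fixes F :: "'a::real_normed_vector \<Rightarrow> 'b::euclidean_space" and G :: "'b \<Rightarrow> 'c::real_normed_vector"
  assumes "open U" "\<And>x. x \<in> U \<Longrightarrow> F x \<in> V" "Ck_on k U F" "Ck_on k V G"
  shows "Ck_on k U (\<lambda>x. G (F x))"
  using assms(3,4)
proof (induction k arbitrary: G)
  case 0
  then show ?case using assms(2) by (auto intro: continuous_on_compose2[of V G])
next
  case (Suc k)
  have d: "((\<lambda>x. G (F x)) has_derivative
      (\<lambda>v. frechet_derivative G (at (F x)) (frechet_derivative F (at x) v))) (at x)" if "x \<in> U" for x
    by (rule has_derivative_compose[OF Ck_on_has_derivative[OF Suc.prems(1) that]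
          Ck_on_has_derivative[OF Suc.prems(2) assms(2)[OF that]]])
  have "Ck_on k U (\<lambda>x. frechet_derivative G (at (F x)) (frechet_derivative F (at x) v))" for v
  proof (rule Ck_on_frechet_derivative[OF assms(1)])
    show "G differentiable (at (F x))" if "x \<in> U" for x
      using Suc.prems(2) assms(2)[OF that] by simp
    show "Ck_on k U (\<lambda>x. frechet_derivative F (at x) v)"
      using Suc.prems by simp
    show "Ck_on k U (\<lambda>x. frechet_derivative G (at (F x)) b)" for b
      using Suc.IH[of "\<lambda>y. frechet_derivative G (at y) b"] Suc.prems Ck_on_SucD by auto
  qed
  then show ?case using Ck_on_SucI[OF assms(1) d] by blast
qed

section \<open>Calculus of infinitely differentiable maps\<close>

definition Cinf_on :: "'a::real_normed_vector set \<Rightarrow> ('a \<Rightarrow> 'b::real_normed_vector) \<Rightarrow> bool"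
  where "Cinf_on U F \<longleftrightarrow> open U \<and> (\<forall>k. Ck_on k U F)"

lemma Cinf_on_open: "Cinf_on U F \<Longrightarrow> open U"
  by (simp add: Cinf_on_def)

lemma Cinf_on_cong: "Cinf_on U F \<Longrightarrow> (\<And>x. x \<in> U \<Longrightarrow> F x = G x) \<Longrightarrow> Cinf_on U G"
  unfolding Cinf_on_def by (metis Ck_on_cong)

lemma Cinf_on_const: "open U \<Longrightarrow> Cinf_on U (\<lambda>x. c)"
  by (simp add: Cinf_on_def)

lemma Cinf_on_id: "open U \<Longrightarrow> Cinf_on U (\<lambda>x. x)"
  by (simp add: Cinf_on_def Ck_on_id)

lemma Cinf_on_add: "Cinf_on U F \<Longrightarrow> Cinf_on U G \<Longrightarrow> Cinf_on U (\<lambda>x. F x + G x)"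
  by (simp add: Cinf_on_def Ck_on_add)

lemma Cinf_on_sum:
  "open U \<Longrightarrow> (\<And>i. i \<in> I \<Longrightarrow> Cinf_on U (F i)) \<Longrightarrow> Cinf_on U (\<lambda>x. \<Sum>i\<in>I. F i x)"
  by (simp add: Cinf_on_def Ck_on_sum)

lemma Cinf_on_linear: "bounded_linear L \<Longrightarrow> Cinf_on U F \<Longrightarrow> Cinf_on U (\<lambda>x. L (F x))"
  by (simp add: Cinf_on_def Ck_on_linear)

lemma Cinf_on_bilinear:
  "bounded_bilinear B \<Longrightarrow> Cinf_on U F \<Longrightarrow> Cinf_on U G \<Longrightarrow> Cinf_on U (\<lambda>x. B (F x) (G x))"
  by (simp add: Cinf_on_def Ck_on_bilinear)

lemma Cinf_on_minus: "Cinf_on U F \<Longrightarrow> Cinf_on U (\<lambda>x. - F x)"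
  by (rule Cinf_on_linear[OF bounded_linear_minus[OF bounded_linear_ident]])

lemma Cinf_on_diff: "Cinf_on U F \<Longrightarrow> Cinf_on U G \<Longrightarrow> Cinf_on U (\<lambda>x. F x - G x)"
  using Cinf_on_add[OF _ Cinf_on_minus, of U F G] by simp

lemmas Cinf_on_mult = Cinf_on_bilinear[OF bounded_bilinear_mult]
  and Cinf_on_scaleR = Cinf_on_bilinear[OF bounded_bilinear_scaleR]

lemma Cinf_on_compose:
  fixes F :: "'a::real_normed_vector \<Rightarrow> 'b::euclidean_space" and G :: "'b \<Rightarrow> 'c::real_normed_vector"
  assumes "Cinf_on U F" "Cinf_on V G" "\<And>x. x \<in> U \<Longrightarrow> F x \<in> V"
  shows "Cinf_on U (\<lambda>x. G (F x))"
  using assms Ck_on_compose[of U F V _ G] by (auto simp: Cinf_on_def)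

lemma Cinf_on_differentiable: "Cinf_on U F \<Longrightarrow> x \<in> U \<Longrightarrow> F differentiable (at x)"
  unfolding Cinf_on_def by (metis Ck_on.simps(2))

lemma Cinf_on_has_derivative:
  "Cinf_on U F \<Longrightarrow> x \<in> U \<Longrightarrow> (F has_derivative frechet_derivative F (at x)) (at x)"
  using Cinf_on_differentiable frechet_derivative_works by blast

lemma Cinf_on_frechet_derivative:
  fixes F :: "'b::euclidean_space \<Rightarrow> 'c::real_normed_vector"
  assumes "Cinf_on U F" "Cinf_on U V"
  shows "Cinf_on U (\<lambda>x. frechet_derivative F (at x) (V x))"
  unfolding Cinf_on_def
proof (intro conjI allI)
  show "open U" by (rule Cinf_on_open[OF assms(1)])
  show "Ck_on k U (\<lambda>x. frechet_derivative F (at x) (V x))" for k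
  proof (rule Ck_on_frechet_derivative[OF \<open>open U\<close>])
    show "F differentiable (at x)" if "x \<in> U" for x
      using Cinf_on_differentiable[OF assms(1) that] .
    show "Ck_on k U V" using assms(2) by (simp add: Cinf_on_def)
    show "Ck_on k U (\<lambda>x. frechet_derivative F (at x) b)" for b
      using assms(1) unfolding Cinf_on_def by (metis Ck_on.simps(2))
  qed
qed

lemma bounded_linear_axis:
  "bounded_linear (axis i :: 'b::real_normed_vector \<Rightarrow> 'b ^ 'n)"
  by (rule bounded_linear_intro[of _ 1])
    (auto simp: vec_eq_iff axis_def norm_vec_def L2_set_def if_distrib[of norm]
      if_distrib[of "\<lambda>x. x\<^sup>2"] cong: if_cong)

lemma sum_axis_nth: "(\<Sum>i\<in>UNIV. axis i (v $ i)) = v"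
  by (simp add: vec_eq_iff axis_def)

lemma Cinf_on_vec:
  fixes F :: "'a::real_normed_vector \<Rightarrow> 'b::real_normed_vector ^ 'n"
  assumes "open U" "\<And>i. Cinf_on U (\<lambda>x. F x $ i)"
  shows "Cinf_on U F"
proof -
  have "Cinf_on U (\<lambda>x. \<Sum>i\<in>UNIV. axis i (F x $ i))"
    by (intro Cinf_on_sum assms(1) Cinf_on_linear[OF bounded_linear_axis] assms(2))
  then show ?thesis by (simp add: sum_axis_nth)
qed

lemma has_vector_derivative_vec:
  fixes F :: "real \<Rightarrow> 'b::real_normed_vector ^ 'n"
  assumes "\<And>i. ((\<lambda>s. F s $ i) has_vector_derivative A $ i) (at x)"
  shows "(F has_vector_derivative A) (at x)"
proof -
  have "((\<lambda>s. \<Sum>i\<in>UNIV. axis i (F s $ i)) has_vector_derivative (\<Sum>i\<in>UNIV. axis i (A $ i))) (at x)"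
    by (intro has_vector_derivative_sum
        bounded_linear.has_vector_derivative[OF bounded_linear_axis] assms)
  then show ?thesis by (simp add: sum_axis_nth)
qed

lemma Cinf_on_nth: "Cinf_on U F \<Longrightarrow> Cinf_on U (\<lambda>x. F x $ i)"
  by (rule Cinf_on_linear[OF bounded_linear_vec_nth])

text \<open>The derivative is a product of copies of the function itself, so order k for the
  function gives order k for its derivative and hence order k + 1. The same bootstrapping yields
  \<open>sqrt\<close>, via its reciprocal, and the pair \<open>sin\<close>,
  \<open>cos\<close>.\<close>

lemma Cinf_on_inverse: "Cinf_on (- {0}) (inverse :: real \<Rightarrow> real)"
proof -
  have "Ck_on k (- {0}) (inverse :: real \<Rightarrow> real)" for k
  proof (induction k)
    case (Suc k)
    show ?case
    proof (rule Ck_on_SucI)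
      show "(inverse has_derivative (\<lambda>v. - (inverse x * v * inverse x))) (at x)"
        if "x \<in> - {0}" for x :: real
        using has_derivative_inverse'[of x] that by simp
      have "open (- {0::real})" by auto
      then show "Ck_on k (- {0}) (\<lambda>x::real. - (inverse x * v * inverse x))" for v
        using Ck_on_linear[OF _ bounded_linear_mult_right[of "-v"]
            Ck_on_bilinear[OF _ bounded_bilinear_mult Suc Suc]]
        by (simp add: algebra_simps)
    qed auto
  qed (auto intro!: continuous_on_inverse)
  then show ?thesis by (auto simp: Cinf_on_def)
qed

lemma Cinf_on_sqrt: "Cinf_on {0<..} sqrt"
proof -
  have "Ck_on k {0<..} sqrt" for k
  proof (induction k)
    case (Suc k)
    show ?case
    proof (rule Ck_on_SucI)
      show "(sqrt has_derivative (*) (inverse (sqrt x) / 2)) (at x)"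
        if "x \<in> {0<..}" for x
        using DERIV_real_sqrt[of x] that unfolding has_field_derivative_def by simp
      have "Ck_on k {0<..} (\<lambda>x. inverse (sqrt x))"
        by (rule Ck_on_compose[OF _ _ Suc, of "- {0}"])
          (use Cinf_on_inverse in \<open>auto simp: Cinf_on_def\<close>)
      then show "Ck_on k {0<..} (\<lambda>x. inverse (sqrt x) / 2 * v)" for v
        using Ck_on_linear[OF _ bounded_linear_mult_right[of "v/2"], of "{0<..}" k "\<lambda>x. inverse (sqrt x)"]
        by (simp add: mult.commute)
    qed auto
  qed (auto intro!: continuous_on_real_sqrt)
  then show ?thesis by (auto simp: Cinf_on_def)
qed

lemma Cinf_on_sin_cos: "Cinf_on UNIV (sin :: real \<Rightarrow> real)" "Cinf_on UNIV (cos :: real \<Rightarrow> real)"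
proof -
  have "Ck_on k UNIV (sin :: real \<Rightarrow> real) \<and> Ck_on k UNIV (cos :: real \<Rightarrow> real)" for k
  proof (induction k)
    case (Suc k)
    have "Ck_on (Suc k) UNIV (sin :: real \<Rightarrow> real)"
      by (rule Ck_on_SucI[where F' = "\<lambda>x v. v * cos x"])
        (use Suc Ck_on_linear[OF _ bounded_linear_mult_right, of UNIV k cos] in
          \<open>auto intro!: derivative_eq_intros\<close>)
    moreover have "Ck_on (Suc k) UNIV (cos :: real \<Rightarrow> real)"
      by (rule Ck_on_SucI[where F' = "\<lambda>x v. (-v) * sin x"])
        (use Suc Ck_on_linear[OF _ bounded_linear_mult_right, of UNIV k sin "- v" for v] in
          \<open>auto intro!: derivative_eq_intros\<close>)
    ultimately show ?case by blast
  qed (auto intro!: continuous_intros)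
  then show "Cinf_on UNIV (sin :: real \<Rightarrow> real)" "Cinf_on UNIV (cos :: real \<Rightarrow> real)"
    by (auto simp: Cinf_on_def)
qed

lemma Cinf_on_entry: "Cinf_on U F \<Longrightarrow> Cinf_on U (\<lambda>x. F x $ i $ j)"
  by (intro Cinf_on_nth)

lemma Cinf_on_mat:
  fixes F :: "'a::real_normed_vector \<Rightarrow> cmat"
  assumes "open U" "\<And>i j. Cinf_on U (\<lambda>x. F x $ i $ j)"
  shows "Cinf_on U F"
  by (intro Cinf_on_vec assms)

lemma Cinf_on_cnj: "Cinf_on U F \<Longrightarrow> Cinf_on U (\<lambda>x. cnj (F x))"
  by (rule Cinf_on_linear[OF bounded_linear_cnj])

lemma Cinf_on_of_real: "Cinf_on U F \<Longrightarrow> Cinf_on U (\<lambda>x. complex_of_real (F x))"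
  by (rule Cinf_on_linear[OF bounded_linear_of_real])

text \<open>The modulus is not smooth at 0, but its square is \<open>z * cnj z\<close>, a real
  polynomial.\<close>

lemma Cinf_on_cmod_sq: "Cinf_on U F \<Longrightarrow> Cinf_on U (\<lambda>x. (cmod (F x))\<^sup>2)"
proof -
  assume F: "Cinf_on U F"
  have "Cinf_on U (\<lambda>x. Re (F x * cnj (F x)))"
    by (intro Cinf_on_linear[OF bounded_linear_Re] Cinf_on_mult Cinf_on_cnj F)
  then show ?thesis by (simp add: complex_norm_square[symmetric] del: complex_mult_cnj)
qed

lemmas Cinf_intros = Cinf_on_mult Cinf_on_add Cinf_on_diff Cinf_on_minus Cinf_on_cnj Cinf_on_of_real
  Cinf_on_cmod_sq Cinf_on_sum Cinf_on_entry Cinf_on_const Cinf_on_id Cinf_on_scaleR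

lemma Cinf_on_subset: "Cinf_on U F \<Longrightarrow> open V \<Longrightarrow> V \<subseteq> U \<Longrightarrow> Cinf_on V F"
  unfolding Cinf_on_def using Ck_on_subset by blast

lemma Cinf_on_inverse_sqrt:
  assumes "Cinf_on U F" "\<And>x. x \<in> U \<Longrightarrow> F x > 0"
  shows "Cinf_on U (\<lambda>x. inverse (sqrt (F x)))"
  by (rule Cinf_on_compose[OF Cinf_on_compose[OF assms(1) Cinf_on_sqrt] Cinf_on_inverse])
    (use assms(2) in force)+

lemma Cinf_on_local:
  assumes "open U" "\<And>x. x \<in> U \<Longrightarrow> \<exists>V. x \<in> V \<and> Cinf_on V F"
  shows "Cinf_on U F"
  unfolding Cinf_on_def using assms(2) by (intro conjI assms(1) allI Ck_on_local) (auto simp: Cinf_on_def)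

lemma smooth_on_Cinf: "Cinf_on U F \<Longrightarrow> S \<subseteq> U \<Longrightarrow> (\<And>x. x \<in> S \<Longrightarrow> F x = f x) \<Longrightarrow> smooth_on S f"
  unfolding smooth_on_def Cinf_on_def by (metis Int_iff subset_iff)

lemma smooth_on_UNIV_differentiable:
  assumes "smooth_on UNIV f" shows "f differentiable (at x)"
proof -
  obtain U F where U: "open U" "x \<in> U" "\<And>k. Ck_on k U F" "\<And>y. y \<in> U \<Longrightarrow> F y = f y"
    using assms unfolding smooth_on_def by (metis Int_UNIV_left UNIV_I)
  have "Cinf_on U f" using U Cinf_on_cong[of U F f] by (simp add: Cinf_on_def)
  then show ?thesis using Cinf_on_differentiable U(2) by blast
qed

text \<open>The second difference of F over the parallelogram spanned by multiples h of u and v is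
  symmetric in u and v. Two uses of the mean value theorem write it as \<open>h * h\<close> times a
  mixed derivative at an inner point, in either order; continuity of the mixed derivatives then
  equates their values at x.\<close>

lemma second_derivative_commute:
  fixes F :: "'a::euclidean_space \<Rightarrow> real"
  assumes F: "Cinf_on U F" and x: "x \<in> U"
  shows "frechet_derivative (\<lambda>y. frechet_derivative F (at y) u) (at x) v =
    frechet_derivative (\<lambda>y. frechet_derivative F (at y) v) (at x) u"
proof -
  define D where "D u y = frechet_derivative F (at y) u" for u y
  define D2 where "D2 u v y = frechet_derivative (D u) (at y) v" for u v y
  have op: "open U" by (rule Cinf_on_open[OF F])
  have D: "Cinf_on U (D u)" for u
    unfolding D_def by (rule Cinf_on_frechet_derivative[OF F Cinf_on_const[OF op]])
  have D2: "continuous_on U (D2 u v)" for u v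
    using Cinf_on_frechet_derivative[OF D Cinf_on_const[OF op]]
    unfolding D2_def Cinf_on_def by (metis Ck_on.simps(1))
  obtain e where e: "e > 0" "ball x e \<subseteq> U" using op x openE by blast
  have lin: "linear (frechet_derivative G (at y))" if "Cinf_on U G" "y \<in> U" for G :: "'a \<Rightarrow> real" and y
    using Cinf_on_differentiable[OF that] by (simp add: linear_frechet_derivative)
  have line: "((\<lambda>s. G (y + s *\<^sub>R w)) has_real_derivative frechet_derivative G (at (y + s *\<^sub>R w)) w) (at s)"
    if "Cinf_on U G" "y + s *\<^sub>R w \<in> U" for G :: "'a \<Rightarrow> real" and y w s
  proof -
    have "((\<lambda>s. y + s *\<^sub>R w) has_derivative (\<lambda>h. h *\<^sub>R w)) (at s)"
      by (auto intro!: derivative_eq_intros)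
    then have "((\<lambda>s. G (y + s *\<^sub>R w)) has_derivative
        (\<lambda>h. frechet_derivative G (at (y + s *\<^sub>R w)) (h *\<^sub>R w))) (at s)"
      by (rule has_derivative_compose) (rule Cinf_on_has_derivative[OF that])
    then show ?thesis
      by (simp add: has_field_derivative_def linear_cmul[OF lin[OF that]] mult_commute_abs)
  qed
  have step: "\<exists>s t. 0 < s \<and> s < h \<and> 0 < t \<and> t < h \<and>
      F (x + h *\<^sub>R u + h *\<^sub>R v) - F (x + h *\<^sub>R u) - F (x + h *\<^sub>R v) + F x = h * h * D2 u v (x + s *\<^sub>R u + t *\<^sub>R v)"
    if h: "h > 0" and near: "\<And>s t. 0 \<le> s \<Longrightarrow> s \<le> h \<Longrightarrow> 0 \<le> t \<Longrightarrow> t \<le> h \<Longrightarrow> x + s *\<^sub>R u + t *\<^sub>R v \<in> U"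
    for u v h
  proof -
    define p where "p s = F ((x + h *\<^sub>R v) + s *\<^sub>R u) - F (x + s *\<^sub>R u)" for s
    have "\<exists>z>0. z < h \<and> p h - p 0 = (h - 0) * (D u ((x + h *\<^sub>R v) + z *\<^sub>R u) - D u (x + z *\<^sub>R u))"
    proof (rule MVT2[OF h])
      fix s assume s: "0 \<le> s" "s \<le> h"
      have "(x + h *\<^sub>R v) + s *\<^sub>R u \<in> U" "x + s *\<^sub>R u \<in> U"
        using near[OF s, of h] near[OF s, of 0] h by (simp_all add: algebra_simps)
      then show "(p has_real_derivative (D u ((x + h *\<^sub>R v) + s *\<^sub>R u) - D u (x + s *\<^sub>R u))) (at s)"
        unfolding p_def D_def by (intro DERIV_diff line[OF F])
    qed
    then obtain s where s: "s > 0" "s < h"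
      "p h - p 0 = h * (D u ((x + h *\<^sub>R v) + s *\<^sub>R u) - D u (x + s *\<^sub>R u))" by auto
    define q where "q t = D u ((x + s *\<^sub>R u) + t *\<^sub>R v)" for t
    have "\<exists>z>0. z < h \<and> q h - q 0 = (h - 0) * D2 u v ((x + s *\<^sub>R u) + z *\<^sub>R v)"
    proof (rule MVT2[OF h])
      fix t assume t: "0 \<le> t" "t \<le> h"
      show "(q has_real_derivative D2 u v ((x + s *\<^sub>R u) + t *\<^sub>R v)) (at t)"
        unfolding q_def D2_def by (rule line[OF D near]) (use s t in auto)
    qed
    then obtain t where t: "t > 0" "t < h" "q h - q 0 = h * D2 u v ((x + s *\<^sub>R u) + t *\<^sub>R v)" by auto
    have "p h - p 0 = h * (q h - q 0)"
      unfolding s(3) q_def by (simp add: algebra_simps)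
    then have "p h - p 0 = h * h * D2 u v (x + s *\<^sub>R u + t *\<^sub>R v)" using t(3) by simp
    moreover have "p h - p 0 = F (x + h *\<^sub>R u + h *\<^sub>R v) - F (x + h *\<^sub>R u) - F (x + h *\<^sub>R v) + F x"
      by (simp add: p_def algebra_simps)
    ultimately show ?thesis using s t by metis
  qed
  have "D2 u v x = D2 v u x"
  proof (rule ccontr)
    assume ne: "D2 u v x \<noteq> D2 v u x"
    \<comment> \<open>Half the gap: two points with equal mixed derivatives cannot each be closer
      than this to its own limit.\<close>
    define \<epsilon> where "\<epsilon> = \<bar>D2 u v x - D2 v u x\<bar> / 2"
    have "\<epsilon> > 0" using ne by (simp add: \<epsilon>_def)
    obtain d where d: "d > 0" "\<And>y. y \<in> U \<Longrightarrow> dist y x < d \<Longrightarrow> dist (D2 u v y) (D2 u v x) < \<epsilon>"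
      using D2[of u v] x \<open>\<epsilon> > 0\<close> unfolding continuous_on_iff by blast
    obtain d' where d': "d' > 0" "\<And>y. y \<in> U \<Longrightarrow> dist y x < d' \<Longrightarrow> dist (D2 v u y) (D2 v u x) < \<epsilon>"
      using D2[of v u] x \<open>\<epsilon> > 0\<close> unfolding continuous_on_iff by blast
    define m where "m = min e (min d d')"
    \<comment> \<open>The whole parallelogram stays within distance m of x; the summand 1 keeps the
      denominator positive even when u and v vanish.\<close>
    define h where "h = m / (2 * (norm u + norm v + 1))"
    have m: "m > 0" using e d d' by (simp add: m_def)
    have pos: "norm u + norm v + 1 > 0" by (smt (verit) norm_ge_zero)
    have h: "h > 0" using m pos by (simp add: h_def)
    have hb: "h * (norm u + norm v) < m"
    proof -
      have "h * (norm u + norm v) \<le> h * (norm u + norm v + 1)" using h by simp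
      also have "\<dots> = m / 2" unfolding h_def using pos by (metis nonzero_mult_divide_mult_cancel_right less_irrefl times_divide_eq_left)
      finally show ?thesis using m by simp
    qed
    have near: "dist (x + s *\<^sub>R u + t *\<^sub>R v) x < m" if "0 \<le> s" "s \<le> h" "0 \<le> t" "t \<le> h" for s t
    proof -
      have "norm (s *\<^sub>R u + t *\<^sub>R v) \<le> s * norm u + t * norm v"
        using norm_triangle_ineq[of "s *\<^sub>R u" "t *\<^sub>R v"] that by simp
      also have "\<dots> \<le> h * norm u + h * norm v"
        using that by (intro add_mono mult_right_mono) auto
      finally show ?thesis using hb by (simp add: dist_norm algebra_simps)
    qed
    then have U: "x + s *\<^sub>R u + t *\<^sub>R v \<in> U" if "0 \<le> s" "s \<le> h" "0 \<le> t" "t \<le> h" for s t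
      using that e(2) unfolding m_def by (force simp: dist_commute)
    obtain s t where st: "0 < s" "s < h" "0 < t" "t < h"
      "F (x + h *\<^sub>R u + h *\<^sub>R v) - F (x + h *\<^sub>R u) - F (x + h *\<^sub>R v) + F x = h * h * D2 u v (x + s *\<^sub>R u + t *\<^sub>R v)"
      using step[OF h U] by auto
    have U': "x + s *\<^sub>R v + t *\<^sub>R u \<in> U" if "0 \<le> s" "s \<le> h" "0 \<le> t" "t \<le> h" for s t
      using U[OF that(3,4,1,2)] by (simp add: algebra_simps)
    obtain s' t' where st': "0 < s'" "s' < h" "0 < t'" "t' < h"
      "F (x + h *\<^sub>R v + h *\<^sub>R u) - F (x + h *\<^sub>R v) - F (x + h *\<^sub>R u) + F x = h * h * D2 v u (x + s' *\<^sub>R v + t' *\<^sub>R u)"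
      using step[OF h U'] by auto
    have "h * h * D2 u v (x + s *\<^sub>R u + t *\<^sub>R v) = h * h * D2 v u (x + s' *\<^sub>R v + t' *\<^sub>R u)"
      using st(5) st'(5) by (simp add: algebra_simps)
    then have eq: "D2 u v (x + s *\<^sub>R u + t *\<^sub>R v) = D2 v u (x + t' *\<^sub>R u + s' *\<^sub>R v)"
      using h by (simp add: algebra_simps)
    have "dist (D2 u v (x + s *\<^sub>R u + t *\<^sub>R v)) (D2 u v x) < \<epsilon>"
      using d(2)[OF U, of s t] near[of s t] st by (simp add: m_def)
    moreover have "dist (D2 v u (x + t' *\<^sub>R u + s' *\<^sub>R v)) (D2 v u x) < \<epsilon>"
      using d'(2)[OF U, of t' s'] near[of t' s'] st' by (simp add: m_def)
    ultimately show False
      using eq unfolding \<epsilon>_def dist_real_def by (smt (verit) field_sum_of_halves)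
  qed
  then show ?thesis by (simp add: D2_def D_def[abs_def])
qed

text \<open>Product rule for a derivative along a moving direction. Symmetry of second derivatives
  puts the second-order term into the form of a fixed-direction derivative differentiated along
  \<open>V x\<close>; in a commutator of two fields such terms cancel.\<close>

lemma frechet_derivative_along_field:
  fixes F :: "'a::euclidean_space \<Rightarrow> real" and V :: "'a \<Rightarrow> 'a"
  assumes F: "Cinf_on U F" and V: "Cinf_on U V" and x: "x \<in> U"
  shows "frechet_derivative (\<lambda>y. frechet_derivative F (at y) (V y)) (at x) v =
    frechet_derivative F (at x) (frechet_derivative V (at x) v) +
    frechet_derivative (\<lambda>y. frechet_derivative F (at y) v) (at x) (V x)"
proof -
  have op: "open U" by (rule Cinf_on_open[OF F])
  define D where "D b y = frechet_derivative F (at y) b" for b y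
  have D: "Cinf_on U (D b)" for b
    unfolding D_def by (rule Cinf_on_frechet_derivative[OF F Cinf_on_const[OF op]])
  have eq: "frechet_derivative F (at y) (V y) = (\<Sum>b\<in>Basis. (V y \<bullet> b) * D b y)" if "y \<in> U" for y
    using frechet_derivative_expand[OF Cinf_on_differentiable[OF F that], of "V y"] by (simp add: D_def)
  have dV: "((\<lambda>y. V y \<bullet> b) has_derivative (\<lambda>v. frechet_derivative V (at x) v \<bullet> b)) (at x)" for b
    by (rule bounded_linear.has_derivative[OF bounded_linear_inner_left Cinf_on_has_derivative[OF V x]])
  have "((\<lambda>y. \<Sum>b\<in>Basis. (V y \<bullet> b) * D b y) has_derivative
      (\<lambda>v. \<Sum>b\<in>Basis. (V x \<bullet> b) * frechet_derivative (D b) (at x) v + (frechet_derivative V (at x) v \<bullet> b) * D b x)) (at x)"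
    by (intro has_derivative_sum has_derivative_mult dV Cinf_on_has_derivative[OF D x])
  then have "((\<lambda>y. frechet_derivative F (at y) (V y)) has_derivative
      (\<lambda>v. \<Sum>b\<in>Basis. (V x \<bullet> b) * frechet_derivative (D b) (at x) v + (frechet_derivative V (at x) v \<bullet> b) * D b x)) (at x)"
    by (rule has_derivative_transform_within_open[OF _ op x]) (simp add: eq)
  from frechet_derivative_at[OF this]
  have "frechet_derivative (\<lambda>y. frechet_derivative F (at y) (V y)) (at x) v =
      (\<Sum>b\<in>Basis. (V x \<bullet> b) * frechet_derivative (D b) (at x) v) + (\<Sum>b\<in>Basis. (frechet_derivative V (at x) v \<bullet> b) * D b x)"
    by (simp add: sum.distrib[symmetric] fun_eq_iff)
  also have "(\<Sum>b\<in>Basis. (V x \<bullet> b) * frechet_derivative (D b) (at x) v) =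
      (\<Sum>b\<in>Basis. (V x \<bullet> b) * frechet_derivative (D v) (at x) b)"
    using second_derivative_commute[OF F x, of _ v] by (simp add: D_def[abs_def])
  also have "\<dots> = frechet_derivative (D v) (at x) (V x)"
    using frechet_derivative_expand[OF Cinf_on_differentiable[OF D x], of v "V x"] by simp
  also have "(\<Sum>b\<in>Basis. (frechet_derivative V (at x) v \<bullet> b) * D b x) = frechet_derivative F (at x) (frechet_derivative V (at x) v)"
    using frechet_derivative_expand[OF Cinf_on_differentiable[OF F x], of "frechet_derivative V (at x) v"]
    by (simp add: D_def)
  finally show ?thesis by (simp add: D_def[abs_def])
qed

section \<open>The group SU(3)\<close>

lemmas mat3_simps = vec_eq_iff forall_3 matrix_matrix_mult_def sum_3 mat_def cadjoint_def

lemma bounded_bilinear_matrix_mult: "bounded_bilinear ((**) :: cmat \<Rightarrow> cmat \<Rightarrow> cmat)"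
proof -
  have "bilinear ((**) :: cmat \<Rightarrow> cmat \<Rightarrow> cmat)"
    unfolding bilinear_def
    by (intro conjI allI linearI; simp add: mat3_simps algebra_simps)
  then show ?thesis by (simp add: bilinear_conv_bounded_bilinear)
qed

lemma bounded_linear_cadjoint: "bounded_linear cadjoint"
  by (intro linear_conv_bounded_linear[THEN iffD1] linearI)
    (simp_all add: mat3_simps)

lemma cadjoint_mult: "cadjoint (A ** B) = cadjoint B ** cadjoint A"
  by (simp add: mat3_simps mult.commute)

lemma cadjoint_cadjoint [simp]: "cadjoint (cadjoint A) = A"
  by (simp add: mat3_simps)

lemma cadjoint_one [simp]: "cadjoint (mat 1) = mat 1"
  by (simp add: mat3_simps)

lemma det_cadjoint: "det (cadjoint A) = cnj (det A)"
  by (simp add: det_3 cadjoint_def algebra_simps)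

lemma SU3_D:
  assumes "A \<in> SU3"
  shows "cadjoint A ** A = mat 1" "A ** cadjoint A = mat 1" "det A = 1"
  using assms matrix_left_right_inverse[of "cadjoint A" A] by (auto simp: SU3_def)

lemma SU3_one [simp]: "mat 1 \<in> SU3"
  by (simp add: SU3_def)

lemma SU3_mult: "A \<in> SU3 \<Longrightarrow> B \<in> SU3 \<Longrightarrow> A ** B \<in> SU3"
  by (simp add: SU3_def cadjoint_mult det_mul)
    (metis matrix_mul_assoc matrix_mul_lid)

lemma SU3_cadjoint: "A \<in> SU3 \<Longrightarrow> cadjoint A \<in> SU3"
  using SU3_D(2,3)[of A] unfolding SU3_def mem_Collect_eq det_cadjoint by simp

lemma SU3_cancel:
  assumes "A \<in> SU3"
  shows "cadjoint A ** (A ** B) = B" "A ** (cadjoint A ** B) = B"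
    "(B ** A) ** cadjoint A = B" "(B ** cadjoint A) ** A = B"
  by (metis SU3_D(1,2)[OF assms] matrix_mul_assoc matrix_mul_lid matrix_mul_rid)+

lemma SU3_matrix_inv:
  assumes "A \<in> SU3" shows "matrix_inv A = cadjoint A"
proof -
  have "A ** matrix_inv A = mat 1 \<and> matrix_inv A ** A = mat 1"
    unfolding matrix_inv_def by (rule someI[of _ "cadjoint A"]) (use SU3_D[OF assms] in simp)
  then show ?thesis
    by (metis SU3_D(1) assms matrix_mul_assoc matrix_mul_lid matrix_mul_rid)
qed

definition diag3 :: "complex \<Rightarrow> complex \<Rightarrow> complex \<Rightarrow> cmat"
  where "diag3 a b c = vector [vector [a, 0, 0], vector [0, b, 0], vector [0, 0, c]]"

lemma Tmax_iff:
  "t \<in> Tmax \<longleftrightarrow> (\<exists>a b c. t = diag3 a b c \<and> cmod a = 1 \<and> cmod b = 1 \<and> cmod c = 1 \<and> a * b * c = 1)"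
proof
  assume t: "t \<in> Tmax"
  then have d: "t = diag3 (t $ 1 $ 1) (t $ 2 $ 2) (t $ 3 $ 3)"
    by (simp add: Tmax_def diag3_def vec_eq_iff forall_3)
  have u: "cadjoint t ** t = mat 1" "det t = 1" using t by (auto simp: Tmax_def SU3_def)
  have "cnj (t $ 1 $ 1) * t $ 1 $ 1 = 1" "cnj (t $ 2 $ 2) * t $ 2 $ 2 = 1" "cnj (t $ 3 $ 3) * t $ 3 $ 3 = 1"
    using u(1) by (subst (asm) (1 2) d, simp add: mat3_simps diag3_def)+
  then have "cmod (t $ 1 $ 1) = 1" "cmod (t $ 2 $ 2) = 1" "cmod (t $ 3 $ 3) = 1"
    by (simp_all add: complex_norm_square[symmetric] mult.commute[of "cnj _"])
      (simp_all flip: of_real_power add: power2_eq_1_iff, 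
        (smt (verit) norm_ge_zero)+)
  moreover have "t $ 1 $ 1 * t $ 2 $ 2 * t $ 3 $ 3 = 1"
    using u(2) by (subst (asm) d, simp add: det_3 diag3_def)
  ultimately show "\<exists>a b c. t = diag3 a b c \<and> cmod a = 1 \<and> cmod b = 1 \<and> cmod c = 1 \<and> a * b * c = 1"
    using d by blast
next
  assume "\<exists>a b c. t = diag3 a b c \<and> cmod a = 1 \<and> cmod b = 1 \<and> cmod c = 1 \<and> a * b * c = 1"
  then obtain a b c where t: "t = diag3 a b c" and n: "cmod a = 1" "cmod b = 1" "cmod c = 1" "a * b * c = 1"
    by blast
  have "cnj a * a = 1" "cnj b * b = 1" "cnj c * c = 1"
    using n by (simp_all add: mult.commute[of "cnj _"] complex_norm_square[symmetric])
  then show "t \<in> Tmax"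
    using n(4) unfolding t by (simp add: Tmax_def SU3_def mat3_simps diag3_def det_3)
qed

lemma Tmax_subset: "Tmax \<subseteq> SU3"
  by (auto simp: Tmax_def)

lemma diag3_mult: "diag3 a b c ** diag3 a' b' c' = diag3 (a * a') (b * b') (c * c')"
  by (simp add: mat3_simps diag3_def)

lemma Tmax_one [simp]: "mat 1 \<in> Tmax"
  by (simp add: Tmax_def) (simp add: mat_def)

lemma Tmax_mult: "s \<in> Tmax \<Longrightarrow> t \<in> Tmax \<Longrightarrow> s ** t \<in> Tmax"
  unfolding Tmax_iff by (elim exE) (auto simp: diag3_mult norm_mult mult_ac intro!: exI)

lemma Tmax_cadjoint: "t \<in> Tmax \<Longrightarrow> cadjoint t \<in> Tmax"
  using SU3_cadjoint by (auto simp: Tmax_def cadjoint_def)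

lemma coset_eq_iff:
  assumes "h \<in> SU3" "k \<in> SU3"
  shows "coset h = coset k \<longleftrightarrow> (\<exists>t\<in>Tmax. k = h ** t)"
proof
  assume "coset h = coset k"
  moreover have "k \<in> coset k" unfolding coset_def using Tmax_one matrix_mul_rid[of k] by (metis (mono_tags, lifting) mem_Collect_eq)
  ultimately show "\<exists>t\<in>Tmax. k = h ** t" by (auto simp: coset_def)
next
  assume "\<exists>t\<in>Tmax. k = h ** t"
  then obtain t where t: "t \<in> Tmax" "k = h ** t" by blast
  have "h ** s \<in> coset k" if "s \<in> Tmax" for s
  proof -
    have "h ** s = k ** (cadjoint t ** s)"
      using SU3_cancel[of t s] t Tmax_subset by (simp add: subset_iff flip: matrix_mul_assoc)
    then show ?thesis using that t by (auto simp: coset_def intro: Tmax_mult Tmax_cadjoint)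
  qed
  moreover have "k ** s \<in> coset h" if "s \<in> Tmax" for s
    using that t by (auto simp: coset_def intro: Tmax_mult simp flip: matrix_mul_assoc)
  ultimately show "coset h = coset k" by (auto simp: coset_def)
qed

lemma coset_mult_Tmax: "h \<in> SU3 \<Longrightarrow> t \<in> Tmax \<Longrightarrow> coset (h ** t) = coset h"
  using coset_eq_iff[of h "h ** t"] SU3_mult[of h t] Tmax_subset by auto

lemma translate_coset: "translate h (coset k) = coset (h ** k)"
  by (auto simp: translate_def coset_def image_def matrix_mul_assoc)

lemma coset_in_M: "h \<in> SU3 \<Longrightarrow> coset h \<in> M"
  by (simp add: M_def)

lemma M_cases:
  assumes "p \<in> M" obtains h where "h \<in> SU3" "p = coset h"
  using assms by (auto simp: M_def)

lemma repr_M: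
  assumes "p \<in> M" shows "repr p \<in> SU3" "coset (repr p) = p"
  using assms someI_ex[of "\<lambda>h. h \<in> SU3 \<and> coset h = p"] unfolding repr_def M_def by auto

text \<open>\<open>repr\<close> is a choice and is controlled only up to a right torus factor; every
  construction that uses it has to absorb this factor by torus invariance.\<close>

lemma repr_coset:
  assumes "h \<in> SU3" obtains t where "t \<in> Tmax" "repr (coset h) = h ** t"
  using assms repr_M[OF coset_in_M[OF assms]] coset_eq_iff by metis

section \<open>Smooth retraction onto SU(3)\<close>

text \<open>Gram-Schmidt applied to the first two columns, without division in the orthogonalisation step;
  the third column of a special unitary matrix is the conjugate cross product of the other two.\<close>

definition col_sq :: "cmat \<Rightarrow> real"
  where "col_sq A = (\<Sum>i\<in>UNIV. (cmod (A $ i $ 1))\<^sup>2)"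

definition orth :: "cmat \<Rightarrow> 3 \<Rightarrow> complex"
  where "orth A i = of_real (col_sq A) * A $ i $ 2 - (\<Sum>j\<in>UNIV. cnj (A $ j $ 1) * A $ j $ 2) * A $ i $ 1"

definition orth_sq :: "cmat \<Rightarrow> real"
  where "orth_sq A = (\<Sum>i\<in>UNIV. (cmod (orth A i))\<^sup>2)"

definition frame3 :: "(3 \<Rightarrow> complex) \<Rightarrow> (3 \<Rightarrow> complex) \<Rightarrow> cmat"
  where "frame3 u v = vector
    [vector [u 1, v 1, cnj (u 2 * v 3 - u 3 * v 2)],
     vector [u 2, v 2, cnj (u 3 * v 1 - u 1 * v 3)],
     vector [u 3, v 3, cnj (u 1 * v 2 - u 2 * v 1)]]"

definition retr :: "cmat \<Rightarrow> cmat"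
  where "retr A = frame3 (\<lambda>i. of_real (inverse (sqrt (col_sq A))) * A $ i $ 1)
    (\<lambda>i. of_real (inverse (sqrt (orth_sq A))) * orth A i)"

text \<open>\<open>orth_sq\<close> is \<open>col_sq\<close> times the Gram determinant of the first
  two columns, so its positivity expresses their linear independence and cuts out an open
  set.\<close>

definition indep_cols :: "cmat set"
  where "indep_cols = {A. orth_sq A > 0}"

lemma frame3_SU3:
  assumes "(\<Sum>i\<in>UNIV. cnj (u i) * u i) = 1" "(\<Sum>i\<in>UNIV. cnj (v i) * v i) = 1"
    "(\<Sum>i\<in>UNIV. cnj (u i) * v i) = 0"
  shows "frame3 u v \<in> SU3"
proof -
  have 1: "cnj (u 1) * u 1 + cnj (u 2) * u 2 + cnj (u 3) * u 3 = 1"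
    "cnj (v 1) * v 1 + cnj (v 2) * v 2 + cnj (v 3) * v 3 = 1"
    "cnj (u 1) * v 1 + cnj (u 2) * v 2 + cnj (u 3) * v 3 = 0"
    using assms by (simp_all add: sum_3)
  have 2: "cnj (v 1) * u 1 + cnj (v 2) * u 2 + cnj (v 3) * u 3 = 0"
    using arg_cong[OF 1(3), of cnj] by (simp add: mult.commute)
  \<comment> \<open>Lagrange's identity for the cross product of two orthonormal vectors. The
    determinant below is the same sum, expanded along the third column.\<close>
  have 3: "(u 2 * v 3 - u 3 * v 2) * (cnj (u 2) * cnj (v 3) - cnj (u 3) * cnj (v 2)) +
    (u 3 * v 1 - u 1 * v 3) * (cnj (u 3) * cnj (v 1) - cnj (u 1) * cnj (v 3)) +
    (u 1 * v 2 - u 2 * v 1) * (cnj (u 1) * cnj (v 2) - cnj (u 2) * cnj (v 1)) = 1"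
    using 1 2 by algebra
  have "cadjoint (frame3 u v) ** frame3 u v = mat 1"
    using 1 2 3 by (simp add: mat3_simps frame3_def) (simp add: algebra_simps)
  moreover have "det (frame3 u v) = 1"
    using 3 by (simp add: det_3 frame3_def) (simp add: algebra_simps)
  ultimately show ?thesis by (simp add: SU3_def)
qed

lemma col_sq_complex: "complex_of_real (col_sq A) = (\<Sum>i\<in>UNIV. cnj (A $ i $ 1) * A $ i $ 1)"
  by (simp add: col_sq_def complex_norm_square mult.commute del: of_real_power)

lemma orth_sq_complex: "complex_of_real (orth_sq A) = (\<Sum>i\<in>UNIV. cnj (orth A i) * orth A i)"
  by (simp add: orth_sq_def complex_norm_square mult.commute del: of_real_power)

lemma orth_orth: "(\<Sum>i\<in>UNIV. cnj (A $ i $ 1) * orth A i) = 0"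
  by (simp add: orth_def col_sq_complex sum_3 algebra_simps)

lemma col_sq_pos:
  assumes "A \<in> indep_cols" shows "col_sq A > 0"
proof (rule ccontr)
  assume "\<not> col_sq A > 0"
  moreover have "col_sq A \<ge> 0" by (simp add: col_sq_def sum_nonneg)
  ultimately have z: "col_sq A = 0" by simp
  then have "A $ i $ 1 = 0" for i
    unfolding col_sq_def by (simp add: sum_nonneg_eq_0_iff)
  then have "orth_sq A = 0" using z by (simp add: orth_sq_def orth_def)
  then show False using assms by (simp add: indep_cols_def)
qed

lemma retr_SU3:
  assumes "A \<in> indep_cols" shows "retr A \<in> SU3"
  unfolding retr_def
proof (rule frame3_SU3)
  have p: "col_sq A > 0" "orth_sq A > 0" using assms col_sq_pos by (auto simp: indep_cols_def)
  have sq: "of_real (inverse (sqrt x)) * of_real (inverse (sqrt x)) * complex_of_real x = 1" if "x > 0" for x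
    using that by (simp flip: of_real_mult add: field_simps)
  show "(\<Sum>i\<in>UNIV. cnj (of_real (inverse (sqrt (col_sq A))) * A $ i $ 1) *
      (of_real (inverse (sqrt (col_sq A))) * A $ i $ 1)) = 1"
    using sq[OF p(1)] unfolding col_sq_complex[of A] by (simp add: sum_3 algebra_simps)
  show "(\<Sum>i\<in>UNIV. cnj (of_real (inverse (sqrt (orth_sq A))) * orth A i) *
      (of_real (inverse (sqrt (orth_sq A))) * orth A i)) = 1"
    using sq[OF p(2)] unfolding orth_sq_complex[of A] by (simp add: sum_3 algebra_simps)
  have "(\<Sum>i\<in>UNIV. cnj (of_real (inverse (sqrt (col_sq A))) * A $ i $ 1) *
      (of_real (inverse (sqrt (orth_sq A))) * orth A i)) =
    of_real (inverse (sqrt (col_sq A))) * of_real (inverse (sqrt (orth_sq A))) *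
      (\<Sum>i\<in>UNIV. cnj (A $ i $ 1) * orth A i)"
    by (simp add: sum_3 algebra_simps)
  then show "(\<Sum>i\<in>UNIV. cnj (of_real (inverse (sqrt (col_sq A))) * A $ i $ 1) *
      (of_real (inverse (sqrt (orth_sq A))) * orth A i)) = 0"
    by (simp add: orth_orth)
qed

text \<open>Let c be the cross product of the first two columns and z the third column. The
  determinant says that the bilinear pairing of c and z is 1, while both have norm 1. Hence the
  squared distance of z from the conjugate of c is 1 - 1 - 1 + 1 = 0.\<close>

lemma SU3_frame3:
  assumes "A \<in> SU3"
  shows "frame3 (\<lambda>i. A $ i $ 1) (\<lambda>i. A $ i $ 2) = A"
proof -
  define u1 u2 u3 v1 v2 v3 z1 z2 z3 where 
    a: "u1 = A$1$1" "u2 = A$2$1" "u3 = A$3$1" "v1 = A$1$2" "v2 = A$2$2" "v3 = A$3$2"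
      "z1 = A$1$3" "z2 = A$2$3" "z3 = A$3$3"
  define c1 c2 c3 where c: "c1 = u2 * v3 - u3 * v2" "c2 = u3 * v1 - u1 * v3" "c3 = u1 * v2 - u2 * v1"
  have 1: "cnj u1 * u1 + cnj u2 * u2 + cnj u3 * u3 = 1" "cnj v1 * v1 + cnj v2 * v2 + cnj v3 * v3 = 1"
    "cnj z1 * z1 + cnj z2 * z2 + cnj z3 * z3 = 1"
    "cnj u1 * v1 + cnj u2 * v2 + cnj u3 * v3 = 0" "cnj v1 * u1 + cnj v2 * u2 + cnj v3 * u3 = 0"
    using SU3_D(1)[OF assms] by (simp_all add: mat3_simps a)
  have d: "c1 * z1 + c2 * z2 + c3 * z3 = 1"
    using SU3_D(3)[OF assms] by (simp add: det_3 a c algebra_simps)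
  have d': "cnj c1 * cnj z1 + cnj c2 * cnj z2 + cnj c3 * cnj z3 = 1"
    using arg_cong[OF d, of cnj] by simp
  have cc: "c1 * cnj c1 + c2 * cnj c2 + c3 * cnj c3 = 1"
    unfolding c complex_cnj_diff complex_cnj_mult using 1 by algebra
  have "(z1 - cnj c1) * cnj (z1 - cnj c1) + (z2 - cnj c2) * cnj (z2 - cnj c2) + (z3 - cnj c3) * cnj (z3 - cnj c3) = 0"
    unfolding complex_cnj_diff complex_cnj_mult complex_cnj_cnj using d d' cc 1(3) by algebra
  then have "complex_of_real ((cmod (z1 - cnj c1))\<^sup>2 + (cmod (z2 - cnj c2))\<^sup>2 + (cmod (z3 - cnj c3))\<^sup>2) = 0"
    unfolding of_real_add complex_norm_square .
  then have "(cmod (z1 - cnj c1))\<^sup>2 + (cmod (z2 - cnj c2))\<^sup>2 + (cmod (z3 - cnj c3))\<^sup>2 = 0"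
    using of_real_eq_0_iff by blast
  then have "z1 = cnj c1" "z2 = cnj c2" "z3 = cnj c3"
    by (smt (verit) zero_le_power2 norm_eq_zero power2_eq_iff zero_eq_power2 right_minus_eq)+
  then show ?thesis by (simp add: frame3_def vec_eq_iff forall_3 a c)
qed

lemma SU3_col_sq:
  assumes "A \<in> SU3"
  shows "col_sq A = 1" "orth A i = A $ i $ 2" "orth_sq A = 1" "A \<in> indep_cols"
proof -
  have 1: "(\<Sum>i\<in>UNIV. cnj (A $ i $ 1) * A $ i $ 1) = 1" "(\<Sum>i\<in>UNIV. cnj (A $ i $ 2) * A $ i $ 2) = 1"
    "(\<Sum>i\<in>UNIV. cnj (A $ i $ 1) * A $ i $ 2) = 0"
    using SU3_D(1)[OF assms] by (simp_all add: mat3_simps)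
  show c: "col_sq A = 1" using col_sq_complex[of A] 1(1) by (metis of_real_eq_1_iff)
  show o: "orth A i = A $ i $ 2" for i by (simp add: orth_def c 1(3))
  show "orth_sq A = 1" using orth_sq_complex[of A] 1(2) by (simp add: o)
  then show "A \<in> indep_cols" by (simp add: indep_cols_def)
qed

lemma retr_id: "A \<in> SU3 \<Longrightarrow> retr A = A"
  unfolding retr_def by (simp add: SU3_col_sq SU3_frame3)

lemma diag3_columns:
  "(A ** diag3 d1 d2 d3) $ i $ 1 = d1 * A $ i $ 1" "(A ** diag3 d1 d2 d3) $ i $ 2 = d2 * A $ i $ 2"
  by (simp_all add: matrix_matrix_mult_def sum_3 diag3_def)

lemma col_sq_diag3: "col_sq (A ** diag3 d1 d2 d3) = (cmod d1)\<^sup>2 * col_sq A"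
  by (simp add: col_sq_def diag3_columns norm_mult power_mult_distrib sum_distrib_left)

lemma orth_diag3: "orth (A ** diag3 d1 d2 d3) i = of_real ((cmod d1)\<^sup>2) * d2 * orth A i"
  unfolding orth_def diag3_columns col_sq_diag3 sum_3 of_real_mult complex_norm_square complex_cnj_mult
  by (simp add: algebra_simps)

lemma orth_sq_diag3:
  "orth_sq (A ** diag3 d1 d2 d3) = ((cmod d1)\<^sup>2 * cmod d2)\<^sup>2 * orth_sq A"
  by (simp add: orth_sq_def orth_diag3 norm_mult norm_power power_mult_distrib sum_distrib_left)

text \<open>Normalising the first two columns discards the moduli of the factors and keeps their
  phases; the conjugate cross product then acquires the conjugate of the product of both phases. The
  factors are arbitrary nonzero numbers, not just phases, because some curves used later leave
  SU(3).\<close>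

lemma retr_diag3:
  assumes "d1 \<noteq> 0" "d2 \<noteq> 0"
  shows "retr (A ** diag3 d1 d2 d3) = retr A ** diag3 (sgn d1) (sgn d2) (cnj (sgn d1 * sgn d2))"
proof -
  let ?B = "A ** diag3 d1 d2 d3"
  have sc: "sqrt (col_sq ?B) = cmod d1 * sqrt (col_sq A)"
    by (simp add: col_sq_diag3 real_sqrt_mult)
  have so: "sqrt (orth_sq ?B) = (cmod d1)\<^sup>2 * cmod d2 * sqrt (orth_sq A)"
    unfolding orth_sq_diag3 real_sqrt_mult by simp
  have 1: "of_real (inverse (sqrt (col_sq ?B))) * ?B $ i $ 1 = sgn d1 * (of_real (inverse (sqrt (col_sq A))) * A $ i $ 1)" for i
    by (simp add: sc diag3_columns sgn_eq field_simps)
  have 2: "of_real (inverse (sqrt (orth_sq ?B))) * orth ?B i = sgn d2 * (of_real (inverse (sqrt (orth_sq A))) * orth A i)" for i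
    using assms by (simp add: so orth_diag3 sgn_eq field_simps)
  show ?thesis
    unfolding retr_def 1 2
    by (simp add: mat3_simps frame3_def diag3_def algebra_simps)
qed

lemma sgn_diag_Tmax:
  assumes "d1 \<noteq> 0" "d2 \<noteq> 0"
  shows "diag3 (sgn d1) (sgn d2) (cnj (sgn d1 * sgn d2)) \<in> Tmax"
proof -
  have "cmod (sgn d1 * sgn d2) = 1" using assms by (simp add: norm_mult norm_sgn)
  then have "sgn d1 * sgn d2 * cnj (sgn d1 * sgn d2) = 1"
    by (simp only: complex_norm_square[symmetric]) simp
  then show ?thesis
    unfolding Tmax_iff using assms
    by (intro exI[of _ "sgn d1"] exI[of _ "sgn d2"] exI[of _ "cnj (sgn d1 * sgn d2)"])
      (simp add: norm_mult norm_sgn)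
qed

lemma coset_retr_diag:
  assumes "A \<in> indep_cols" "d1 \<noteq> 0" "d2 \<noteq> 0"
  shows "coset (retr (A ** diag3 d1 d2 d3)) = coset (retr A)"
  using retr_diag3[OF assms(2,3)] coset_mult_Tmax[OF retr_SU3[OF assms(1)] sgn_diag_Tmax[OF assms(2,3)]]
  by simp

lemma Cinf_on_orth: "Cinf_on UNIV (\<lambda>A. orth A i)" "Cinf_on UNIV col_sq"
proof -
  show c: "Cinf_on UNIV col_sq"
    unfolding col_sq_def[abs_def] by (intro Cinf_intros open_UNIV)
  show "Cinf_on UNIV (\<lambda>A. orth A i)"
    unfolding orth_def by (intro Cinf_intros c open_UNIV)
qed

lemma Cinf_on_orth_sq: "Cinf_on UNIV orth_sq"
  unfolding orth_sq_def[abs_def] by (intro Cinf_intros Cinf_on_orth open_UNIV)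

lemma open_indep_cols: "open indep_cols"
proof -
  have "continuous_on UNIV orth_sq"
    using Cinf_on_orth_sq unfolding Cinf_on_def by (metis Ck_on.simps(1))
  then show ?thesis
    unfolding indep_cols_def by (intro open_Collect_less) auto
qed

lemma Cinf_on_retr: "Cinf_on indep_cols retr"
proof -
  have s: "Cinf_on indep_cols F" if "Cinf_on UNIV F" for F :: "cmat \<Rightarrow> 'b::real_normed_vector"
    using Cinf_on_subset[OF that open_indep_cols] by simp
  have 1: "Cinf_on indep_cols (\<lambda>A. of_real (inverse (sqrt (col_sq A))) * A $ i $ 1)" for i
    by (intro Cinf_intros open_indep_cols Cinf_on_inverse_sqrt s Cinf_on_orth col_sq_pos open_UNIV)
  have 2: "Cinf_on indep_cols (\<lambda>A. of_real (inverse (sqrt (orth_sq A))) * orth A i)" for i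
    by (intro Cinf_intros open_indep_cols Cinf_on_inverse_sqrt s Cinf_on_orth Cinf_on_orth_sq)
      (auto simp: indep_cols_def)
  have "Cinf_on indep_cols (\<lambda>A. retr A $ i $ j)" for i j
    using exhaust_3[of i] exhaust_3[of j] unfolding retr_def frame3_def
    by (elim disjE; simp only: vector_3; intro Cinf_on_cnj Cinf_on_diff Cinf_on_mult[of indep_cols "\<lambda>A. _ A * _ A" "\<lambda>A. _ A * _ A"] 1 2)
  then show ?thesis by (intro Cinf_on_mat open_indep_cols)
qed

text \<open>Smoothness on SU(3) is defined by local extensions that vary from point to point.
  Precomposing with the retraction gives one canonical extension on one fixed open set, which can be
  differentiated without choices.\<close>

lemma smooth_on_SU3_iff:
  fixes f :: "cmat \<Rightarrow> 'b::real_normed_vector"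
  shows "smooth_on SU3 f \<longleftrightarrow> Cinf_on indep_cols (\<lambda>A. f (retr A))"
proof
  assume f: "smooth_on SU3 f"
  show "Cinf_on indep_cols (\<lambda>A. f (retr A))"
  proof (rule Cinf_on_local[OF open_indep_cols])
    fix A assume A: "A \<in> indep_cols"
    obtain U F where U: "open U" "retr A \<in> U" "\<And>k. Ck_on k U F" "\<And>y. y \<in> SU3 \<inter> U \<Longrightarrow> F y = f y"
      using f retr_SU3[OF A] unfolding smooth_on_def by metis
    have F: "Cinf_on U F" using U by (simp add: Cinf_on_def)
    define V where "V = indep_cols \<inter> retr -` U"
    have "continuous_on indep_cols retr"
      using Cinf_on_retr unfolding Cinf_on_def by (metis Ck_on.simps(1))
    then have V: "open V" unfolding V_def
      using open_indep_cols U(1) by (metis continuous_on_open_vimage Int_commute)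
    have "Cinf_on V (\<lambda>A. F (retr A))"
      by (rule Cinf_on_compose[OF Cinf_on_subset[OF Cinf_on_retr V] F]) (auto simp: V_def)
    then have "Cinf_on V (\<lambda>A. f (retr A))"
      by (rule Cinf_on_cong) (use U(4) retr_SU3 in \<open>auto simp: V_def\<close>)
    then show "\<exists>V. A \<in> V \<and> Cinf_on V (\<lambda>A. f (retr A))"
      using A U(2) unfolding V_def by (intro exI[of _ "indep_cols \<inter> retr -` U"]) simp
  qed
next
  assume "Cinf_on indep_cols (\<lambda>A. f (retr A))"
  then show "smooth_on SU3 f"
    by (rule smooth_on_Cinf) (auto simp: SU3_col_sq retr_id)
qed

section \<open>Curves in SU(3)\<close>

definition Dm :: "complex^3 \<Rightarrow> cmat"
  where "Dm y = Dmat (y $ 1) (y $ 2) (y $ 3)"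

lemma linear_Dm: "linear Dm"
  by (intro linearI) (simp_all add: Dm_def Dmat_def vec_eq_iff forall_3)

lemma bounded_linear_Dm: "bounded_linear Dm"
  using linear_Dm by (simp add: linear_conv_bounded_linear)

text \<open>A product of three one-parameter rotations, one in each coordinate plane, replaces the
  matrix exponential. All factors are 1 at time 0, so the velocity there is the sum of the three
  velocities.\<close>

lemma SU3_curve_exists:
  obtains c where "Cinf_on UNIV c" "\<And>s. c s \<in> SU3" "c 0 = mat 1"
    "(c has_vector_derivative Dm y) (at (0::real))"
proof -
  \<comment> \<open>Angular speed \<open>cmod a\<close> together with phase \<open>sgn a\<close>
    gives velocity a at time 0, also for a = 0 because \<open>sgn 0 = 0\<close>.\<close>
  define S where "S a s = sgn a * of_real (sin (cmod a * s))" for a :: complex and s :: real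
  define C where "C a s = complex_of_real (cos (cmod a * s))" for a :: complex and s :: real
  have SC: "Cinf_on UNIV (S a)" "Cinf_on UNIV (C a)" for a
    unfolding S_def[abs_def] C_def[abs_def]
    by (intro Cinf_intros open_UNIV Cinf_on_compose[OF _ Cinf_on_sin_cos(1)] 
        Cinf_on_compose[OF _ Cinf_on_sin_cos(2)] UNIV_I)+
  have dS: "(S a has_vector_derivative a) (at 0)" for a
  proof -
    have "((\<lambda>s. sin (cmod a * s)) has_real_derivative cmod a) (at 0)"
      by (auto intro!: derivative_eq_intros)
    then have "((\<lambda>s. sgn a * complex_of_real (sin (cmod a * s))) has_vector_derivative
        sgn a * of_real (cmod a)) (at 0)"
      by (intro has_vector_derivative_mult_right has_vector_derivative_of_real)
    then show ?thesis unfolding S_def[abs_def] by (simp add: sgn_eq)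
  qed
  have dC: "(C a has_vector_derivative 0) (at 0)" for a
  proof -
    have "((\<lambda>s. cos (cmod a * s)) has_real_derivative 0) (at 0)"
      by (auto intro!: derivative_eq_intros)
    then have "((\<lambda>s. complex_of_real (cos (cmod a * s))) has_vector_derivative of_real 0) (at 0)"
      by (rule has_vector_derivative_of_real)
    then show ?thesis unfolding C_def[abs_def] by simp
  qed
  have S0: "S a 0 = 0" "C a 0 = 1" for a by (simp_all add: S_def C_def)
  have unit: "C a s * C a s + S a s * cnj (S a s) = 1" "cnj (C a s) = C a s" for a s
  proof -
    show "cnj (C a s) = C a s" by (simp add: C_def)
    have "S a s * cnj (S a s) = of_real ((sin (cmod a * s))\<^sup>2)"
      unfolding complex_norm_square[symmetric]
      by (cases "a = 0") (simp_all add: S_def norm_mult norm_sgn)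
    moreover have "C a s * C a s = of_real ((cos (cmod a * s))\<^sup>2)"
      by (simp add: C_def power2_eq_square)
    ultimately show "C a s * C a s + S a s * cnj (S a s) = 1"
      by (simp del: of_real_power flip: of_real_add)
  qed
  define R1 where "R1 s = (vector [vector [C (y$1) s, S (y$1) s, 0], vector [- cnj (S (y$1) s), C (y$1) s, 0], vector [0,0,1]] :: cmat)" for s
  define R2 where "R2 s = (vector [vector [1,0,0], vector [0, C (y$2) s, S (y$2) s], vector [0, - cnj (S (y$2) s), C (y$2) s]] :: cmat)" for s
  define R3 where "R3 s = (vector [vector [C (y$3) s, 0, cnj (S (y$3) s)], vector [0,1,0], vector [- S (y$3) s, 0, C (y$3) s]] :: cmat)" for s
  have su: "R1 s \<in> SU3" "R2 s \<in> SU3" "R3 s \<in> SU3" for s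
    using unit[of "y$1" s] unit[of "y$2" s] unit[of "y$3" s]
    by (auto simp: SU3_def R1_def R2_def R3_def mat3_simps det_3) (simp_all add: algebra_simps)
  have sm: "Cinf_on UNIV R1" "Cinf_on UNIV R2" "Cinf_on UNIV R3"
  proof -
    have "Cinf_on UNIV (\<lambda>s. R1 s $ i $ j)" "Cinf_on UNIV (\<lambda>s. R2 s $ i $ j)" "Cinf_on UNIV (\<lambda>s. R3 s $ i $ j)" for i j
      using exhaust_3[of i] exhaust_3[of j] unfolding R1_def R2_def R3_def
      by (elim disjE; simp; intro Cinf_intros SC open_UNIV)+
    then show "Cinf_on UNIV R1" "Cinf_on UNIV R2" "Cinf_on UNIV R3" by (auto intro!: Cinf_on_mat)
  qed
  have one: "R1 0 = mat 1" "R2 0 = mat 1" "R3 0 = mat 1"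
    by (simp_all add: R1_def R2_def R3_def S0 mat3_simps)
  have "((\<lambda>s. R1 s $ i $ j) has_vector_derivative Dmat (y$1) 0 0 $ i $ j) (at 0)"
    "((\<lambda>s. R2 s $ i $ j) has_vector_derivative Dmat 0 (y$2) 0 $ i $ j) (at 0)"
    "((\<lambda>s. R3 s $ i $ j) has_vector_derivative Dmat 0 0 (y$3) $ i $ j) (at 0)" for i j
    using exhaust_3[of i] exhaust_3[of j] unfolding R1_def R2_def R3_def Dmat_def
    by (elim disjE; simp; intro dS dC has_vector_derivative_minus has_vector_derivative_cnj)+
  then have d: "(R1 has_vector_derivative Dmat (y$1) 0 0) (at 0)"
    "(R2 has_vector_derivative Dmat 0 (y$2) 0) (at 0)" "(R3 has_vector_derivative Dmat 0 0 (y$3)) (at 0)"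
    by (auto intro!: has_vector_derivative_vec)
  note dm = bounded_bilinear.has_vector_derivative[OF bounded_bilinear_matrix_mult]
  have "((\<lambda>s. R1 s ** R2 s ** R3 s) has_vector_derivative
      (R1 0 ** R2 0) ** Dmat 0 0 (y$3) + (R1 0 ** Dmat 0 (y$2) 0 + Dmat (y$1) 0 0 ** R2 0) ** R3 0) (at 0)"
    by (intro dm d)
  moreover have "(R1 0 ** R2 0) ** Dmat 0 0 (y$3) + (R1 0 ** Dmat 0 (y$2) 0 + Dmat (y$1) 0 0 ** R2 0) ** R3 0 = Dm y"
    unfolding one by (simp add: matrix_mul_lid matrix_mul_rid) (simp add: Dm_def Dmat_def vec_eq_iff forall_3)
  ultimately have "((\<lambda>s. R1 s ** R2 s ** R3 s) has_vector_derivative Dm y) (at 0)" by simp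
  moreover have "Cinf_on UNIV (\<lambda>s. R1 s ** R2 s ** R3 s)"
    by (intro Cinf_on_bilinear[OF bounded_bilinear_matrix_mult] sm)
  ultimately show ?thesis
    using that[of "\<lambda>s. R1 s ** R2 s ** R3 s"] by (simp add: su SU3_mult one)
qed

section \<open>Tangent vectors of the flag manifold\<close>

definition lift :: "(point \<Rightarrow> real) \<Rightarrow> cmat \<Rightarrow> real"
  where "lift \<phi> A = \<phi> (coset (retr A))"

lemma smooth_M_iff: "\<phi> \<in> smooth_M \<longleftrightarrow> Cinf_on indep_cols (lift \<phi>)"
  by (simp add: smooth_M_def smooth_on_SU3_iff lift_def[abs_def])

lemma lift_SU3: "h \<in> SU3 \<Longrightarrow> lift \<phi> h = \<phi> (coset h)"
  by (simp add: lift_def retr_id)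

lemma smooth_M_cong:
  assumes "\<And>h. h \<in> SU3 \<Longrightarrow> \<phi> (coset h) = \<psi> (coset h)"
  shows "\<phi> \<in> smooth_M \<longleftrightarrow> \<psi> \<in> smooth_M"
  unfolding smooth_M_def smooth_on_def mem_Collect_eq using assms by (metis Int_iff)

definition tv :: "cmat \<Rightarrow> cmat \<Rightarrow> tangent"
  where "tv h \<xi> = (\<lambda>\<phi>. if \<phi> \<in> smooth_M then frechet_derivative (lift \<phi>) (at h) (h ** \<xi>) else 0)"

lemma tv_not_smooth: "\<phi> \<notin> smooth_M \<Longrightarrow> tv h \<xi> \<phi> = 0"
  by (simp add: tv_def)

lemma tv_eqI: "(\<And>\<phi>. \<phi> \<in> smooth_M \<Longrightarrow> tv h \<xi> \<phi> = v \<phi>) \<Longrightarrow> (\<And>\<phi>. \<phi> \<notin> smooth_M \<Longrightarrow> v \<phi> = 0) \<Longrightarrow> tv h \<xi> = v"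
  by (rule ext) (metis tv_not_smooth)

text \<open>The curve may leave SU(3): only the lifted function along it enters, and only near time
  0. This serves straight lines in the fibre direction and lifts that lie in SU(3) only for small
  times.\<close>

lemma tv_lifted_curve:
  assumes "\<phi> \<in> smooth_M" "h \<in> SU3" "(c has_vector_derivative h ** \<xi>) (at 0)" "c 0 = h"
    "\<forall>\<^sub>F s in nhds 0. lift \<phi> (c s) = u s"
  shows "(u has_real_derivative tv h \<xi> \<phi>) (at (0::real))"
proof -
  have "(lift \<phi> has_derivative frechet_derivative (lift \<phi>) (at h)) (at (c 0))"
    using Cinf_on_has_derivative[of indep_cols "lift \<phi>" h] assms(1,2,4) SU3_col_sq(4)
    by (simp add: smooth_M_iff)
  then have "((\<lambda>s. lift \<phi> (c s)) has_derivative
      (\<lambda>r. frechet_derivative (lift \<phi>) (at h) (r *\<^sub>R (h ** \<xi>)))) (at 0)"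
    using has_derivative_compose[OF assms(3)[unfolded has_vector_derivative_def]] by blast
  moreover have "linear (frechet_derivative (lift \<phi>) (at h))"
    using Cinf_on_differentiable[of indep_cols "lift \<phi>" h] assms(1,2) SU3_col_sq(4)
    by (simp add: smooth_M_iff linear_frechet_derivative)
  ultimately have "((\<lambda>s. lift \<phi> (c s)) has_real_derivative tv h \<xi> \<phi>) (at 0)"
    using assms(1) by (simp add: has_field_derivative_def tv_def linear_cmul mult_commute_abs)
  then show ?thesis
    by (rule DERIV_cong_ev[THEN iffD1, OF refl _ refl, rotated]) (use assms(5) in simp)
qed

lemma tv_curve:
  assumes "\<phi> \<in> smooth_M" "h \<in> SU3" "(c has_vector_derivative h ** \<xi>) (at 0)" "c 0 = h" "\<And>s. c s \<in> SU3"
  shows "((\<lambda>s. \<phi> (coset (c s))) has_real_derivative tv h \<xi> \<phi>) (at (0::real))"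
  by (rule tv_lifted_curve[OF assms(1-4)]) (simp add: lift_SU3 assms(5))

lemma has_vector_derivative_mult_left_matrix:
  fixes c :: "real \<Rightarrow> cmat" and h :: cmat
  assumes "(c has_vector_derivative X) (at s)"
  shows "((\<lambda>s. h ** c s) has_vector_derivative h ** X) (at s)"
  using bounded_linear.has_vector_derivative[OF bounded_bilinear.bounded_linear_right[OF bounded_bilinear_matrix_mult] assms] .

lemma has_vector_derivative_mult_right_matrix:
  fixes c :: "real \<Rightarrow> cmat" and h :: cmat
  assumes "(c has_vector_derivative X) (at s)"
  shows "((\<lambda>s. c s ** h) has_vector_derivative X ** h) (at s)"
  using bounded_linear.has_vector_derivative[OF bounded_bilinear.bounded_linear_left[OF bounded_bilinear_matrix_mult] assms] .

lemma SU3_curve_through: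
  assumes "h \<in> SU3"
  obtains c where "\<And>s. c s \<in> SU3" "c 0 = h" "(c has_vector_derivative h ** Dm y) (at (0::real))" "Cinf_on UNIV c"
proof -
  obtain c where c: "Cinf_on UNIV c" "\<And>s. c s \<in> SU3" "c 0 = mat 1"
    "(c has_vector_derivative Dm y) (at (0::real))"
    by (rule SU3_curve_exists[of y]) blast
  show ?thesis
    by (rule that[of "\<lambda>s. h ** c s"])
      (simp_all add: assms SU3_mult c(2,3) has_vector_derivative_mult_left_matrix[OF c(4)]
        Cinf_on_linear[OF bounded_bilinear.bounded_linear_right[OF bounded_bilinear_matrix_mult] c(1)])
qed

lemma matrix_combination: "h ** (a *\<^sub>R \<xi> + b *\<^sub>R \<eta>) = a *\<^sub>R (h ** \<xi>) + b *\<^sub>R (h ** \<eta>)" for h \<xi> \<eta> :: cmat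
  using bounded_bilinear.bounded_linear_right[OF bounded_bilinear_matrix_mult, of h]
  by (simp add: bounded_linear.linear linear_add linear_cmul)

lemma tv_linear:
  assumes "h \<in> SU3"
  shows "tv h (a *\<^sub>R \<xi> + b *\<^sub>R \<eta>) = a *\<^sub>R tv h \<xi> + b *\<^sub>R tv h \<eta>"
proof
  fix \<phi>
  have "linear (frechet_derivative (lift \<phi>) (at h))" if "\<phi> \<in> smooth_M"
    using Cinf_on_differentiable[of indep_cols "lift \<phi>" h] assms that SU3_col_sq(4)
    by (simp add: smooth_M_iff linear_frechet_derivative)
  then show "tv h (a *\<^sub>R \<xi> + b *\<^sub>R \<eta>) \<phi> = (a *\<^sub>R tv h \<xi> + b *\<^sub>R tv h \<eta>) \<phi>"
    by (simp add: tv_def scaleR_fun_def matrix_combination linear_add linear_cmul)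
qed

lemma tv_add: "h \<in> SU3 \<Longrightarrow> tv h (\<xi> + \<eta>) = tv h \<xi> + tv h \<eta>"
  using tv_linear[of h 1 \<xi> 1 \<eta>] by simp

lemma tv_scaleR: "h \<in> SU3 \<Longrightarrow> tv h (a *\<^sub>R \<xi>) = a *\<^sub>R tv h \<xi>"
  using tv_linear[of h a \<xi> 0 0] by simp

text \<open>Fibre directions are annihilated: along the straight line from h in the direction
  \<open>h ** diag3 a b c\<close> the lift is constant as long as the diagonal factors stay nonzero,
  hence near 0. The line leaves SU(3), which is harmless because \<open>retr_diag3\<close> covers
  all nonzero factors.\<close>

lemma tv_diag3:
  assumes "h \<in> SU3"
  shows "tv h (diag3 a b c) = 0"
proof (rule tv_eqI)
  fix \<phi> assume \<phi>: "\<phi> \<in> smooth_M"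
  let ?c = "\<lambda>s::real. h + s *\<^sub>R (h ** diag3 a b c)"
  have c: "?c s = h ** diag3 (1 + s *\<^sub>R a) (1 + s *\<^sub>R b) (1 + s *\<^sub>R c)" for s
    by (simp add: mat3_simps diag3_def algebra_simps)
  have ne: "\<forall>\<^sub>F s::real in nhds 0. 1 + s *\<^sub>R a \<noteq> 0" for a :: complex
  proof -
    have "((\<lambda>s::real. 1 + s *\<^sub>R a) \<longlongrightarrow> 1 + 0 *\<^sub>R a) (nhds 0)"
      by (intro tendsto_intros filterlim_ident)
    then show ?thesis using tendsto_imp_eventually_ne[of "\<lambda>s::real. 1 + s *\<^sub>R a" 1 "nhds 0" 0] by simp
  qed
  have "(?c has_vector_derivative h ** diag3 a b c) (at 0)"
    by (auto intro!: derivative_eq_intros)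
  moreover have "\<forall>\<^sub>F s in nhds 0. lift \<phi> (?c s) = \<phi> (coset h)"
    using eventually_conj[OF ne[of a] ne[of b]]
    by eventually_elim
      (simp add: c lift_def coset_retr_diag[OF SU3_col_sq(4)[OF assms]] retr_id[OF assms])
  ultimately have "((\<lambda>s. \<phi> (coset h)) has_real_derivative tv h (diag3 a b c) \<phi>) (at 0)"
    by (intro tv_lifted_curve[OF \<phi> assms]) simp_all
  then show "tv h (diag3 a b c) \<phi> = 0 \<phi>"
    using DERIV_unique[OF _ DERIV_const] by simp
qed simp

text \<open>The entries of the three orthogonal projections onto the lines of a flag embed M
  into a vector space.\<close>

definition proj_entry :: "3 \<Rightarrow> 3 \<Rightarrow> 3 \<Rightarrow> point \<Rightarrow> complex"
  where "proj_entry k i j p = repr p $ i $ k * cnj (repr p $ j $ k)"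

lemma proj_entry_coset:
  assumes "h \<in> SU3"
  shows "proj_entry k i j (coset h) = h $ i $ k * cnj (h $ j $ k)"
proof -
  obtain t where t: "t \<in> Tmax" "repr (coset h) = h ** t" using repr_coset[OF assms] .
  obtain a b c where abc: "t = diag3 a b c" "cmod a = 1" "cmod b = 1" "cmod c = 1"
    using t(1) Tmax_iff by auto
  have u: "z * x * (cnj z * y) = x * y" if "cmod z = 1" for x y z
  proof -
    have "z * cnj z = 1" using that by (simp flip: complex_norm_square)
    then show ?thesis by algebra
  qed
  have "(h ** t) $ i $ k * cnj ((h ** t) $ j $ k) = h $ i $ k * cnj (h $ j $ k)"
    using exhaust_3[of k] by (elim disjE)
      (simp_all add: abc matrix_matrix_mult_def sum_3 diag3_def u mult.commute[of _ a] mult.commute[of _ b]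
        mult.commute[of _ c] mult.commute[of _ "cnj a"] mult.commute[of _ "cnj b"] mult.commute[of _ "cnj c"])
  then show ?thesis by (simp add: proj_entry_def t(2))
qed

lemma proj_entry_smooth:
  "(\<lambda>p. Re (proj_entry k i j p)) \<in> smooth_M" "(\<lambda>p. Im (proj_entry k i j p)) \<in> smooth_M"
proof -
  have "Cinf_on indep_cols (\<lambda>A. retr A $ i $ k * cnj (retr A $ j $ k))"
    by (intro Cinf_intros Cinf_on_retr)
  then have *: "Cinf_on indep_cols (\<lambda>A. Re (retr A $ i $ k * cnj (retr A $ j $ k)))"
    "Cinf_on indep_cols (\<lambda>A. Im (retr A $ i $ k * cnj (retr A $ j $ k)))"
    by - (rule Cinf_on_linear[OF bounded_linear_Re], assumption,
        rule Cinf_on_linear[OF bounded_linear_Im])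
  then show "(\<lambda>p. Re (proj_entry k i j p)) \<in> smooth_M" "(\<lambda>p. Im (proj_entry k i j p)) \<in> smooth_M"
    unfolding smooth_M_iff
    by - (rule Cinf_on_cong[OF *(1)], simp add: lift_def proj_entry_coset retr_SU3,
        rule Cinf_on_cong[OF *(2)], simp add: lift_def proj_entry_coset retr_SU3)
qed

lemma skew_decomposition:
  assumes "\<xi> + cadjoint \<xi> = 0"
  shows "\<xi> = Dm (vector [\<xi> $ 1 $ 2, \<xi> $ 2 $ 3, - \<xi> $ 3 $ 1]) + diag3 (\<xi> $ 1 $ 1) (\<xi> $ 2 $ 2) (\<xi> $ 3 $ 3)"
proof -
  have *: "\<xi> $ i $ j = - cnj (\<xi> $ j $ i)" for i j
    using assms by (simp add: vec_eq_iff cadjoint_def add_eq_0_iff)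
  show ?thesis
    using *[of 2 1] *[of 1 3] *[of 3 2] by (simp add: Dm_def Dmat_def diag3_def vec_eq_iff forall_3)
qed

lemma tangent_spaceI:
  assumes h: "h \<in> SU3"
  shows "tv h (Dm y) \<in> tangent_space (coset h)"
proof -
  obtain c where c: "\<And>s. c s \<in> SU3" "c 0 = h" "(c has_vector_derivative h ** Dm y) (at (0::real))" "Cinf_on UNIV c"
    by (rule SU3_curve_through[OF h, of y]) blast
  let ?g = "\<lambda>s. coset (c s)"
  have "smooth_on UNIV (\<lambda>s. \<phi> (?g s))" if "\<phi> \<in> smooth_M" for \<phi>
  proof -
    have "Cinf_on UNIV (\<lambda>s. lift \<phi> (c s))"
      by (rule Cinf_on_compose[OF c(4) that[unfolded smooth_M_iff]]) (simp add: c(1) SU3_col_sq)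
    then show ?thesis by (rule smooth_on_Cinf) (auto simp: lift_SU3 c(1))
  qed
  then have "smooth_curve_M ?g" by (simp add: smooth_curve_M_def coset_in_M c(1))
  moreover have "?g 0 = coset h" by (simp add: c(2))
  moreover have "tv h (Dm y) = velocity ?g"
  proof (rule tv_eqI)
    fix \<phi> assume \<phi>: "\<phi> \<in> smooth_M"
    have "((\<lambda>s. \<phi> (?g s)) has_real_derivative tv h (Dm y) \<phi>) (at 0)"
      by (rule tv_curve[OF \<phi> h c(3,2,1)])
    then show "tv h (Dm y) \<phi> = velocity ?g \<phi>"
      using \<phi> DERIV_imp_deriv by (fastforce simp: velocity_def)
  qed (simp add: velocity_def)
  ultimately show ?thesis unfolding tangent_space_def by blast
qed

text \<open>The projections along the curve, applied to the columns of \<open>h\<close> and then retracted, lift the curve to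
  a curve in \<open>SU(3)\<close> that is differentiable at 0.\<close>

lemma tangent_spaceD:
  assumes h: "h \<in> SU3" and v: "v \<in> tangent_space (coset h)"
  shows "\<exists>y. v = tv h (Dm y)"
proof -
  obtain \<gamma> where \<gamma>: "smooth_curve_M \<gamma>" "\<gamma> 0 = coset h" "v = velocity \<gamma>"
    using v by (auto simp: tangent_space_def)
  define B where "B s = (\<chi> i k. \<Sum>j\<in>UNIV. proj_entry k i j (\<gamma> s) * h $ j $ k)" for s
  \<comment> \<open>For any representative k of the point, each column of \<open>B s\<close> is a
    multiple of the same column of k. So \<open>B s\<close> retracts into the coset of k once the
    first two multiples are nonzero.\<close>
  have B_eq: "B s = k ** diag3 (\<Sum>j\<in>UNIV. cnj (k $ j $ 1) * h $ j $ 1) (\<Sum>j\<in>UNIV. cnj (k $ j $ 2) * h $ j $ 2)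
      (\<Sum>j\<in>UNIV. cnj (k $ j $ 3) * h $ j $ 3)" if "k \<in> SU3" "\<gamma> s = coset k" for k s
    by (simp add: B_def that proj_entry_coset vec_eq_iff forall_3 matrix_matrix_mult_def sum_3 diag3_def
        algebra_simps)
  have B0: "B 0 = h"
  proof -
    have "(\<Sum>j\<in>UNIV. cnj (h $ j $ 1) * h $ j $ 1) = 1" "(\<Sum>j\<in>UNIV. cnj (h $ j $ 2) * h $ j $ 2) = 1"
      "(\<Sum>j\<in>UNIV. cnj (h $ j $ 3) * h $ j $ 3) = 1"
      using SU3_D(1)[OF h] by (simp_all add: mat3_simps)
    then have "B 0 = h ** diag3 1 1 1" using B_eq[OF h \<gamma>(2)] by simp
    also have "\<dots> = h" by (simp add: mat3_simps diag3_def)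
    finally show ?thesis .
  qed
  have Bdiff: "\<exists>B'. (B has_vector_derivative B') (at 0)"
  proof -
    \<comment> \<open>Curves in M are tested on real functions only, so a complex entry is
      differentiated through its real and imaginary parts.\<close>
    have ex: "\<exists>d. ((\<lambda>s. proj_entry k i j (\<gamma> s)) has_vector_derivative d) (at 0)" for k i j
    proof -
      have "(\<lambda>s. Re (proj_entry k i j (\<gamma> s))) differentiable (at 0)"
        "(\<lambda>s. Im (proj_entry k i j (\<gamma> s))) differentiable (at 0)"
        using \<gamma>(1) proj_entry_smooth[of k i j] unfolding smooth_curve_M_def
        by (auto intro!: smooth_on_UNIV_differentiable)
      then obtain a b where "((\<lambda>s. Re (proj_entry k i j (\<gamma> s))) has_vector_derivative a) (at 0)"
        "((\<lambda>s. Im (proj_entry k i j (\<gamma> s))) has_vector_derivative b) (at 0)"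
        using differentiableI_vector vector_derivative_works by blast
      then have "((\<lambda>s. complex_of_real (Re (proj_entry k i j (\<gamma> s))) + \<i> * complex_of_real (Im (proj_entry k i j (\<gamma> s))))
         has_vector_derivative (of_real a + \<i> * of_real b)) (at 0)"
        by (intro has_vector_derivative_add has_vector_derivative_mult_right has_vector_derivative_of_real)
          (simp_all add: has_real_derivative_iff_has_vector_derivative)
      then show ?thesis by (auto simp flip: complex_eq)
    qed
    then obtain d where d: "\<And>k i j. ((\<lambda>s. proj_entry k i j (\<gamma> s)) has_vector_derivative d k i j) (at 0)"
      by metis
    have "(B has_vector_derivative (\<chi> i k. \<Sum>j\<in>UNIV. d k i j * h $ j $ k)) (at 0)"
      by (intro has_vector_derivative_vec)
        (auto simp: B_def intro!: has_vector_derivative_sum has_vector_derivative_mult_left d)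
    then show ?thesis by blast
  qed
  then obtain B' where B': "(B has_vector_derivative B') (at 0)" by blast
  have "(B \<longlongrightarrow> h) (nhds 0)"
    using has_vector_derivative_continuous[OF B'] unfolding continuous_at B0 
    by (metis B0 tendsto_at_iff_tendsto_nhds)
  then have ev: "\<forall>\<^sub>F s in nhds 0. B s \<in> indep_cols"
    using open_indep_cols SU3_col_sq(4)[OF h] topological_tendstoD by blast
  define c where "c s = retr (B s)" for s
  obtain c' where c': "(c has_vector_derivative c') (at 0)"
  proof -
    have "(retr has_derivative frechet_derivative retr (at h)) (at (B 0))"
      using Cinf_on_has_derivative[OF Cinf_on_retr, of h] SU3_col_sq(4)[OF h] B0 by simp
    then have "((\<lambda>s. retr (B s)) has_derivative (\<lambda>r. frechet_derivative retr (at h) (r *\<^sub>R B'))) (at 0)"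
      using has_derivative_compose[OF B'[unfolded has_vector_derivative_def]] by blast
    then have "c differentiable (at 0)" unfolding c_def[abs_def] differentiable_def by blast
    then show ?thesis using that vector_derivative_works by blast
  qed
  have c0: "c 0 = h" using B0 h by (simp add: c_def retr_id)
  have cSU: "\<forall>\<^sub>F s in nhds 0. c s \<in> SU3"
    using ev by eventually_elim (simp add: c_def retr_SU3)
  have lift_c: "\<forall>\<^sub>F s in nhds 0. lift \<phi> (c s) = \<phi> (\<gamma> s)" for \<phi>
    using ev
  proof eventually_elim
    case (elim s)
    obtain k where k: "k \<in> SU3" "\<gamma> s = coset k"
      using \<gamma>(1) M_cases unfolding smooth_curve_M_def by metis
    define z where "z i = (\<Sum>j\<in>UNIV. cnj (k $ j $ i) * h $ j $ i)" for i :: 3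
    have Bz: "B s = k ** diag3 (z 1) (z 2) (z 3)" using B_eq[OF k] by (simp add: z_def)
    \<comment> \<open>Membership of \<open>B s\<close> in \<open>indep_cols\<close> is what excludes
      vanishing multiples.\<close>
    then have "((cmod (z 1))\<^sup>2 * cmod (z 2))\<^sup>2 * orth_sq k > 0"
      using elim orth_sq_diag3 by (simp add: indep_cols_def)
    then have "z 1 \<noteq> 0" "z 2 \<noteq> 0" by auto
    then have "coset (c s) = coset k"
      using coset_retr_diag[OF SU3_col_sq(4)[OF k(1)]] retr_id[OF k(1)] by (simp add: c_def Bz)
    then show ?case using retr_SU3[OF elim] by (simp add: lift_SU3 c_def k(2))
  qed
  define \<xi> where "\<xi> = cadjoint h ** c'"
  have hc: "c' = h ** \<xi>" using SU3_cancel(2)[OF h] by (simp add: \<xi>_def)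
  \<comment> \<open>Differentiating unitarity makes the velocity skew-Hermitian. Since c is known to
    lie in SU(3) only near 0, the constancy is an eventual one.\<close>
  have "((\<lambda>s. cadjoint (c s) ** c s) has_vector_derivative cadjoint (c 0) ** c' + cadjoint c' ** c 0) (at 0)"
    by (intro bounded_bilinear.has_vector_derivative[OF bounded_bilinear_matrix_mult]
        bounded_linear.has_vector_derivative[OF bounded_linear_cadjoint] c')
  moreover have "((\<lambda>s. cadjoint (c s) ** c s) has_vector_derivative 0) (at 0)"
  proof -
    have "((\<lambda>s. mat 1 :: cmat) has_vector_derivative 0) (at 0)" by simp
    moreover have "\<forall>\<^sub>F s in nhds 0. s \<in> UNIV \<longrightarrow> mat 1 = cadjoint (c s) ** c s"
      using cSU by eventually_elim (simp add: SU3_D)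
    moreover have "mat 1 = cadjoint (c 0) ** c 0"
      unfolding c0 SU3_D(1)[OF h] ..
    ultimately show ?thesis
      using has_vector_derivative_cong_ev[of UNIV "\<lambda>s. mat 1" "\<lambda>s. cadjoint (c s) ** c s" 0 0]
      by blast
  qed
  ultimately have "cadjoint (c 0) ** c' + cadjoint c' ** c 0 = 0"
    by (rule vector_derivative_unique_at)
  then have "cadjoint h ** c' + cadjoint c' ** h = 0" unfolding c0 .
  then have "\<xi> + cadjoint \<xi> = 0" by (simp add: \<xi>_def cadjoint_mult)
  note dec = skew_decomposition[OF this]
  have "tv h \<xi> = v"
  proof (rule tv_eqI)
    fix \<phi> assume \<phi>: "\<phi> \<in> smooth_M"
    have "((\<lambda>s. \<phi> (\<gamma> s)) has_real_derivative tv h \<xi> \<phi>) (at 0)"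
      by (rule tv_lifted_curve[OF \<phi> h c'[unfolded hc] c0 lift_c])
    then show "tv h \<xi> \<phi> = v \<phi>"
      using \<phi> \<gamma>(3) DERIV_imp_deriv by (fastforce simp: velocity_def)
  qed (simp add: \<gamma>(3) velocity_def)
  moreover have "tv h \<xi> = tv h (Dm (vector [\<xi> $ 1 $ 2, \<xi> $ 2 $ 3, - \<xi> $ 3 $ 1]))"
    by (subst dec, subst tv_add[OF h]) (simp add: tv_diag3[OF h])
  ultimately show ?thesis by metis
qed

lemma tangent_space_coset: "h \<in> SU3 \<Longrightarrow> tangent_space (coset h) = range (\<lambda>y. tv h (Dm y))"
  using tangent_spaceI tangent_spaceD by fast

lemma tv_Dm_add: "h \<in> SU3 \<Longrightarrow> tv h (Dm (x + y)) = tv h (Dm x) + tv h (Dm y)"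
  by (simp add: linear_add[OF linear_Dm] tv_add)

lemma tv_Dm_scaleR: "h \<in> SU3 \<Longrightarrow> tv h (Dm (a *\<^sub>R x)) = a *\<^sub>R tv h (Dm x)"
  by (simp add: linear_cmul[OF linear_Dm] tv_scaleR)

lemma tv_Dm_0: "h \<in> SU3 \<Longrightarrow> tv h (Dm 0) = 0"
  using tv_Dm_scaleR[of h 0 0] by simp

lemma tv_Dm_minus: "h \<in> SU3 \<Longrightarrow> tv h (Dm (- x)) = - tv h (Dm x)"
  using tv_Dm_scaleR[of h "-1" x] by simp

lemma tv_Dm_diff: "h \<in> SU3 \<Longrightarrow> tv h (Dm (x - y)) = tv h (Dm x) - tv h (Dm y)"
  using tv_Dm_add[of h x "- y"] by (simp add: tv_Dm_minus)

section \<open>Coordinates of tangent vectors\<close>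

definition proj_velocity :: "3 \<Rightarrow> tangent \<Rightarrow> cmat"
  where "proj_velocity k v =
    (\<chi> i j. Complex (v (\<lambda>p. Re (proj_entry k i j p))) (v (\<lambda>p. Im (proj_entry k i j p))))"

text \<open>Conjugated back by h, the velocity of the k-th projector along
  \<open>tv h (Dm y)\<close> is \<open>Dm y ** E k + E k ** cadjoint (Dm y)\<close>, with
  \<open>E k\<close> the k-th diagonal unit; off the diagonal its column k is that of
  \<open>Dm y\<close>. Hence 2 is paired with the entry (1,2), 3 with (2,3) and 1 with (3,1). Since
  v is only evaluated on fixed smooth functions, the coordinates of a vector field are seen to be
  smooth.\<close>

definition coord :: "cmat \<Rightarrow> tangent \<Rightarrow> complex^3"
  where "coord h v = vector [(cadjoint h ** proj_velocity 2 v ** h) $ 1 $ 2,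
    (cadjoint h ** proj_velocity 3 v ** h) $ 2 $ 3, - (cadjoint h ** proj_velocity 1 v ** h) $ 3 $ 1]"

lemma proj_velocity_tv:
  assumes h: "h \<in> SU3"
  shows "proj_velocity k (tv h (Dm y)) $ i $ j =
    (h ** Dm y) $ i $ k * cnj (h $ j $ k) + h $ i $ k * cnj ((h ** Dm y) $ j $ k)"
proof -
  obtain c where c: "\<And>s. c s \<in> SU3" "c 0 = h" "(c has_vector_derivative h ** Dm y) (at (0::real))" "Cinf_on UNIV c"
    by (rule SU3_curve_through[OF h, of y]) blast
  have d: "((\<lambda>s. c s $ i $ j) has_vector_derivative (h ** Dm y) $ i $ j) (at 0)" for i j
    by (intro bounded_linear.has_vector_derivative[OF bounded_linear_vec_nth] c(3))
  have dd: "((\<lambda>s. c s $ i $ k * cnj (c s $ j $ k)) has_vector_derivative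
      (h ** Dm y) $ i $ k * cnj (h $ j $ k) + h $ i $ k * cnj ((h ** Dm y) $ j $ k)) (at 0)"
    using has_vector_derivative_mult[OF d[of i k] has_vector_derivative_cnj[OF d[of j k]]]
    by (simp add: c(2) add.commute)
  have "((\<lambda>s. Re (proj_entry k i j (coset (c s)))) has_real_derivative
      tv h (Dm y) (\<lambda>p. Re (proj_entry k i j p))) (at 0)"
    "((\<lambda>s. Im (proj_entry k i j (coset (c s)))) has_real_derivative
      tv h (Dm y) (\<lambda>p. Im (proj_entry k i j p))) (at 0)"
    by (rule tv_curve[OF proj_entry_smooth(1) h c(3,2,1)] tv_curve[OF proj_entry_smooth(2) h c(3,2,1)])+
  moreover have "((\<lambda>s. Re (c s $ i $ k * cnj (c s $ j $ k))) has_real_derivative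
      Re ((h ** Dm y) $ i $ k * cnj (h $ j $ k) + h $ i $ k * cnj ((h ** Dm y) $ j $ k))) (at 0)"
    "((\<lambda>s. Im (c s $ i $ k * cnj (c s $ j $ k))) has_real_derivative
      Im ((h ** Dm y) $ i $ k * cnj (h $ j $ k) + h $ i $ k * cnj ((h ** Dm y) $ j $ k))) (at 0)"
    unfolding has_real_derivative_iff_has_vector_derivative
    by (rule bounded_linear.has_vector_derivative[OF bounded_linear_Re dd]
        bounded_linear.has_vector_derivative[OF bounded_linear_Im dd])+
  ultimately show ?thesis
    unfolding proj_entry_coset[OF c(1)] proj_velocity_def
    using DERIV_unique by (simp add: complex_eq_iff) blast
qed

lemma coord_tv:
  assumes h: "h \<in> SU3"
  shows "coord h (tv h (Dm y)) = y"
proof -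
  define E :: "3 \<Rightarrow> cmat" where "E k = (\<chi> i j. if i = k \<and> j = k then 1 else 0)" for k
  have "proj_velocity k (tv h (Dm y)) =
      h ** (Dm y ** E k + E k ** cadjoint (Dm y)) ** cadjoint h" for k
  proof -
    have 1: "(X ** E k ** cadjoint Y) $ i $ j = X $ i $ k * cnj (Y $ j $ k)" for X Y :: cmat and i j
      using exhaust_3[of k] by (auto simp: matrix_matrix_mult_def sum_3 cadjoint_def E_def)
    have "proj_velocity k (tv h (Dm y)) = (h ** Dm y) ** E k ** cadjoint h + h ** E k ** cadjoint (h ** Dm y)"
      unfolding vec_eq_iff by (simp add: proj_velocity_tv[OF h] 1)
    then show ?thesis
      by (simp add: cadjoint_mult matrix_mul_assoc bounded_bilinear.add_left[OF bounded_bilinear_matrix_mult]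
        bounded_bilinear.add_right[OF bounded_bilinear_matrix_mult])
  qed
  then have "cadjoint h ** proj_velocity k (tv h (Dm y)) ** h = Dm y ** E k + E k ** cadjoint (Dm y)" for k
    by (simp add: SU3_cancel[OF h] flip: matrix_mul_assoc) (simp add: matrix_mul_assoc SU3_D[OF h])
  then show ?thesis
    unfolding coord_def
    by (simp add: vec_eq_iff forall_3 E_def matrix_matrix_mult_def sum_3 cadjoint_def Dm_def Dmat_def)
qed

lemma tv_Dm_inject: "h \<in> SU3 \<Longrightarrow> tv h (Dm x) = tv h (Dm y) \<longleftrightarrow> x = y"
  using coord_tv by metis

text \<open>Right translation by the inverse of t moves a curve through \<open>h ** t\<close> to one
  through h without changing its image in M. So changing the representative acts on m by conjugation
  with t.\<close>

lemma tv_mult_Tmax_gen: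
  assumes h: "h \<in> SU3" and t: "t \<in> Tmax"
  shows "tv (h ** t) (Dm y) = tv h (t ** Dm y ** cadjoint t)"
proof (rule tv_eqI)
  fix \<phi> assume \<phi>: "\<phi> \<in> smooth_M"
  have tS: "t \<in> SU3" using t Tmax_subset by blast
  obtain c where c: "\<And>s. c s \<in> SU3" "c 0 = h ** t" "(c has_vector_derivative (h ** t) ** Dm y) (at (0::real))" "Cinf_on UNIV c"
    by (rule SU3_curve_through[OF SU3_mult[OF h tS], of y]) blast
  have "((\<lambda>s. \<phi> (coset (c s))) has_real_derivative tv (h ** t) (Dm y) \<phi>) (at 0)"
    by (rule tv_curve[OF \<phi> SU3_mult[OF h tS] c(3,2,1)])
  moreover have "((\<lambda>s. \<phi> (coset (c s ** cadjoint t))) has_real_derivative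
      tv h (t ** Dm y ** cadjoint t) \<phi>) (at 0)"
  proof (rule tv_curve[OF \<phi> h])
    show "((\<lambda>s. c s ** cadjoint t) has_vector_derivative h ** (t ** Dm y ** cadjoint t)) (at 0)"
      using has_vector_derivative_mult_right_matrix[OF c(3), of "cadjoint t"]
      by (simp add: matrix_mul_assoc)
    show "c 0 ** cadjoint t = h" by (simp add: c(2) SU3_cancel[OF tS])
    show "c s ** cadjoint t \<in> SU3" for s by (intro SU3_mult c(1) SU3_cadjoint tS)
  qed
  moreover have "coset (c s ** cadjoint t) = coset (c s)" for s
    by (rule coset_mult_Tmax[OF c(1) Tmax_cadjoint[OF t]])
  ultimately show "tv (h ** t) (Dm y) \<phi> = tv h (t ** Dm y ** cadjoint t) \<phi>"
    using DERIV_unique by fastforce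
qed (simp add: tv_not_smooth)

text \<open>The adjoint action of the torus on m in coordinates. The three factors are root
  characters whose product is 1 on the torus.\<close>

definition rot :: "cmat \<Rightarrow> complex^3 \<Rightarrow> complex^3"
  where "rot t y = vector [t $ 1 $ 1 * cnj (t $ 2 $ 2) * y $ 1,
    t $ 2 $ 2 * cnj (t $ 3 $ 3) * y $ 2, t $ 3 $ 3 * cnj (t $ 1 $ 1) * y $ 3]"

lemma Dm_rot:
  assumes "t \<in> Tmax" shows "t ** Dm y ** cadjoint t = Dm (rot t y)"
proof -
  obtain a b c where t: "t = diag3 a b c" using assms Tmax_iff by auto
  show ?thesis
    by (simp add: t diag3_def rot_def mat3_simps Dm_def Dmat_def algebra_simps)
qed

lemma tv_mult_Tmax:
  "h \<in> SU3 \<Longrightarrow> t \<in> Tmax \<Longrightarrow> tv (h ** t) (Dm y) = tv h (Dm (rot t y))"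
  by (simp add: tv_mult_Tmax_gen Dm_rot)

lemma smooth_M_translate:
  assumes "h \<in> SU3"
  shows "(\<lambda>p. \<phi> (translate h p)) \<in> smooth_M \<longleftrightarrow> \<phi> \<in> smooth_M"
proof -
  have *: "(\<lambda>p. \<phi> (translate h p)) \<in> smooth_M" if "\<phi> \<in> smooth_M" "h \<in> SU3" for \<phi> h
  proof -
    have r: "h ** retr A \<in> SU3" if "A \<in> indep_cols" for A
      using \<open>h \<in> SU3\<close> retr_SU3[OF that] SU3_mult by blast
    have "Cinf_on indep_cols (\<lambda>A. h ** retr A)"
      by (rule Cinf_on_linear[OF bounded_bilinear.bounded_linear_right[OF bounded_bilinear_matrix_mult] Cinf_on_retr])
    then have "Cinf_on indep_cols (\<lambda>A. lift \<phi> (h ** retr A))"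
      by (rule Cinf_on_compose[OF _ that(1)[unfolded smooth_M_iff]]) (simp add: r SU3_col_sq)
    then show ?thesis unfolding smooth_M_iff
      by (rule Cinf_on_cong) (simp add: lift_def translate_coset retr_id r)
  qed
  have "(\<lambda>p. \<phi> (translate h (translate (cadjoint h) p))) \<in> smooth_M \<longleftrightarrow> \<phi> \<in> smooth_M"
    by (rule smooth_M_cong) (simp add: translate_coset matrix_mul_assoc SU3_D[OF assms])
  then show ?thesis using *[OF _ assms] *[OF _ SU3_cadjoint[OF assms]] by blast
qed

lemma push_tv:
  assumes h: "h \<in> SU3" and k: "k \<in> SU3"
  shows "push h (tv k (Dm y)) = tv (h ** k) (Dm y)"
proof (rule sym, rule tv_eqI)
  fix \<phi> assume \<phi>: "\<phi> \<in> smooth_M"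
  obtain c where c: "\<And>s. c s \<in> SU3" "c 0 = k" "(c has_vector_derivative k ** Dm y) (at (0::real))" "Cinf_on UNIV c"
    by (rule SU3_curve_through[OF k, of y]) blast
  have "((\<lambda>s. \<phi> (translate h (coset (c s)))) has_real_derivative tv k (Dm y) (\<lambda>p. \<phi> (translate h p))) (at 0)"
    by (rule tv_curve[of "\<lambda>p. \<phi> (translate h p)", OF _ k c(3,2,1)]) (simp add: \<phi> smooth_M_translate h)
  moreover have "((\<lambda>s. \<phi> (coset (h ** c s))) has_real_derivative tv (h ** k) (Dm y) \<phi>) (at 0)"
    by (rule tv_curve[OF \<phi> SU3_mult[OF h k]])
      (use has_vector_derivative_mult_left_matrix[OF c(3), of h] in \<open>simp_all add: matrix_mul_assoc c SU3_mult h\<close>)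
  ultimately show "tv (h ** k) (Dm y) \<phi> = push h (tv k (Dm y)) \<phi>"
    unfolding push_def using DERIV_unique by (fastforce simp: translate_coset matrix_mul_assoc)
next
  fix \<phi> assume "\<phi> \<notin> smooth_M"
  then show "push h (tv k (Dm y)) \<phi> = 0"
    by (simp add: push_def tv_not_smooth smooth_M_translate h)
qed

text \<open>The definite description is legitimate: by \<open>tv_curve\<close> all curves in SU(3)
  through 1 with the same velocity project to curves of the same velocity, and
  \<open>SU3_curve_exists\<close> provides one.\<close>

lemma dproj_Dm: "dproj (Dm y) = tv (mat 1) (Dm y)"
  unfolding dproj_def
proof (rule the_equality)
  have vel: "velocity (\<lambda>s. coset (c s)) = tv (mat 1) (Dm y)"
    if "\<And>s. c s \<in> SU3" "c 0 = mat 1" "(c has_vector_derivative Dm y) (at 0)" for c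
  proof (rule sym, rule tv_eqI)
    fix \<phi> assume \<phi>: "\<phi> \<in> smooth_M"
    have "((\<lambda>s. \<phi> (coset (c s))) has_real_derivative tv (mat 1) (Dm y) \<phi>) (at 0)"
      by (rule tv_curve[OF \<phi> SU3_one]) (use that in simp_all)
    then show "tv (mat 1) (Dm y) \<phi> = velocity (\<lambda>s. coset (c s)) \<phi>"
      using \<phi> DERIV_imp_deriv by (fastforce simp: velocity_def)
  qed (simp add: velocity_def)
  obtain c where c: "Cinf_on UNIV c" "\<And>s. c s \<in> SU3" "c 0 = mat 1"
    "(c has_vector_derivative Dm y) (at (0::real))"
    by (rule SU3_curve_exists[of y]) blast
  show "\<exists>c. smooth_on UNIV c \<and> (\<forall>s. c s \<in> SU3) \<and> c 0 = mat 1 \<and>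
      (c has_vector_derivative Dm y) (at 0) \<and> tv (mat 1) (Dm y) = velocity (\<lambda>s. coset (c s))"
    using c smooth_on_Cinf[OF c(1), of UNIV c] vel[OF c(2-4)] by auto
  show "v = tv (mat 1) (Dm y)" if "\<exists>c. smooth_on UNIV c \<and> (\<forall>s. c s \<in> SU3) \<and> c 0 = mat 1 \<and>
      (c has_vector_derivative Dm y) (at 0) \<and> v = velocity (\<lambda>s. coset (c s))" for v
    using that vel by blast
qed

lemma Dmat_eq_Dm: "Dmat a b c = Dm (vector [a, b, c])"
  by (simp add: Dm_def)

lemma mm_eq: "\<mm> = range Dm"
proof -
  have "Dmat a b c \<in> range Dm" for a b c unfolding Dmat_eq_Dm by blast
  moreover have "Dm y \<in> \<mm>" for y unfolding Dm_def \<mm>_def by blast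
  ultimately show ?thesis unfolding \<mm>_def by blast
qed

lemma to_m_tv: "to_m (tv (mat 1) (Dm y)) = Dm y"
proof -
  have "inj_on dproj \<mm>"
    unfolding mm_eq by (rule inj_onI) (auto simp: dproj_Dm tv_Dm_inject)
  then show ?thesis
    unfolding to_m_def using inv_into_f_f[of dproj \<mm> "Dm y"] by (simp add: mm_eq dproj_Dm)
qed

text \<open>Pulling back from the chosen representative instead of h leaves a translation by the
  inverse of t, that is, a rotation of the coordinates. It disappears later because the standard
  metrics are invariant under \<open>rot\<close> and the standard f-structures commute with
  it.\<close>

lemma to_m_push_repr:
  assumes h: "h \<in> SU3"
  obtains t where "t \<in> Tmax" "repr (coset h) = h ** t"
    "\<And>y. to_m (push (matrix_inv (repr (coset h))) (tv h (Dm y))) = Dm (rot (cadjoint t) y)"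
proof -
  obtain t where t: "t \<in> Tmax" "repr (coset h) = h ** t" using repr_coset[OF h] .
  have tS: "t \<in> SU3" using t(1) Tmax_subset by blast
  have inv: "matrix_inv (repr (coset h)) = cadjoint t ** cadjoint h"
    using t(2) SU3_matrix_inv[OF SU3_mult[OF h tS]] by (simp add: cadjoint_mult)
  have "push (cadjoint t ** cadjoint h) (tv h (Dm y)) = tv (mat 1) (Dm (rot (cadjoint t) y))" for y
    using push_tv[OF SU3_mult[OF SU3_cadjoint[OF tS] SU3_cadjoint[OF h]] h]
      tv_mult_Tmax[OF SU3_one Tmax_cadjoint[OF t(1)]] SU3_D(1)[OF h]
    by (simp add: matrix_mul_rid matrix_mul_lid flip: matrix_mul_assoc)
  then show ?thesis using that[OF t] by (simp add: inv to_m_tv)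
qed

lemma rot_cancel:
  assumes "t \<in> Tmax" shows "rot t (rot (cadjoint t) y) = y" "rot (cadjoint t) (rot t y) = y"
proof -
  obtain a b c where t: "t = diag3 a b c" "cmod a = 1" "cmod b = 1" "cmod c = 1"
    using assms Tmax_iff by auto
  have "a * cnj a = 1" "b * cnj b = 1" "c * cnj c = 1"
    using t by (simp_all flip: complex_norm_square)
  then have "a * cnj b * (cnj a * b * z) = z" "cnj a * b * (a * cnj b * z) = z"
    "b * cnj c * (cnj b * c * z) = z" "cnj b * c * (b * cnj c * z) = z"
    "c * cnj a * (cnj c * a * z) = z" "cnj c * a * (c * cnj a * z) = z" for z
    by algebra+
  then show "rot t (rot (cadjoint t) y) = y" "rot (cadjoint t) (rot t y) = y"
    by (simp_all add: rot_def t diag3_def cadjoint_def vec_eq_iff forall_3)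
qed

section \<open>The given metrics and f-structures in coordinates\<close>

definition metric_coord :: "real \<Rightarrow> real \<Rightarrow> real \<Rightarrow> complex^3 \<Rightarrow> complex^3 \<Rightarrow> real"
  where "metric_coord l1 l2 l3 x y =
    l1 * (x $ 1 \<bullet> y $ 1) + l2 * (x $ 2 \<bullet> y $ 2) + l3 * (x $ 3 \<bullet> y $ 3)"

definition f_coord :: "int \<Rightarrow> int \<Rightarrow> int \<Rightarrow> complex^3 \<Rightarrow> complex^3"
  where "f_coord z1 z2 z3 y = vector [of_int z1 * \<i> * y $ 1, of_int z2 * \<i> * y $ 2, of_int z3 * \<i> * y $ 3]"

text \<open>Within one summand the real part of the trace pairing is minus twice the real inner
  product of the entries, which the factor -1/2 in \<open>ip\<close> undoes.\<close>

lemma metric_m_Dm: "metric_m l1 l2 l3 (Dm x) (Dm y) = metric_coord l1 l2 l3 x y"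
  by (simp add: metric_m_def metric_coord_def ip_def trace_def sum_3 matrix_matrix_mult_def Dm_def Dmat_def
      inner_complex_def field_simps)

lemma inner_unit_complex:
  assumes "cmod u = 1" shows "(u * x) \<bullet> (u * y) = x \<bullet> y"
proof -
  have "(Re u)\<^sup>2 + (Im u)\<^sup>2 = 1" using assms cmod_power2[of u] by simp
  then show ?thesis by (simp add: inner_complex_def) algebra
qed

lemma metric_coord_rot:
  assumes "t \<in> Tmax" shows "metric_coord l1 l2 l3 (rot t x) (rot t y) = metric_coord l1 l2 l3 x y"
proof -
  obtain a b c where t: "t = diag3 a b c" "cmod a = 1" "cmod b = 1" "cmod c = 1"
    using assms Tmax_iff by auto
  have "cmod (a * cnj b) = 1" "cmod (b * cnj c) = 1" "cmod (c * cnj a) = 1"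
    using t by (simp_all add: norm_mult)
  then show ?thesis by (simp add: metric_coord_def rot_def t(1) diag3_def inner_unit_complex)
qed

lemma inv_metric_tv:
  assumes "h \<in> SU3"
  shows "inv_metric l1 l2 l3 (coset h) (tv h (Dm x)) (tv h (Dm y)) = metric_coord l1 l2 l3 x y"
proof -
  obtain t where "t \<in> Tmax" "repr (coset h) = h ** t"
    "\<And>y. to_m (push (matrix_inv (repr (coset h))) (tv h (Dm y))) = Dm (rot (cadjoint t) y)"
    using to_m_push_repr[OF assms] by metis
  then show ?thesis
    by (simp add: inv_metric_def metric_m_Dm metric_coord_rot Tmax_cadjoint)
qed

lemma f_m_Dm: "f_m z1 z2 z3 (Dm y) = Dm (f_coord z1 z2 z3 y)"
  by (simp add: f_m_def Dm_def Dmat_def f_coord_def)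

lemma f_coord_rot: "f_coord z1 z2 z3 (rot t y) = rot t (f_coord z1 z2 z3 y)"
  by (simp add: f_coord_def rot_def vec_eq_iff forall_3)

lemma inv_f_tv:
  assumes "h \<in> SU3"
  shows "inv_f z1 z2 z3 (coset h) (tv h (Dm y)) = tv h (Dm (f_coord z1 z2 z3 y))"
proof -
  obtain t where t: "t \<in> Tmax" "repr (coset h) = h ** t"
    "\<And>y. to_m (push (matrix_inv (repr (coset h))) (tv h (Dm y))) = Dm (rot (cadjoint t) y)"
    using to_m_push_repr[OF assms] by metis
  have tS: "t \<in> SU3" using t(1) Tmax_subset by blast
  have "inv_f z1 z2 z3 (coset h) (tv h (Dm y)) = push (h ** t) (tv (mat 1) (Dm (f_coord z1 z2 z3 (rot (cadjoint t) y))))"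
    by (simp add: inv_f_def t(3) f_m_Dm dproj_Dm) (simp add: t(2))
  also have "\<dots> = tv (h ** t) (Dm (f_coord z1 z2 z3 (rot (cadjoint t) y)))"
    using push_tv[OF SU3_mult[OF assms tS] SU3_one] by simp
  also have "\<dots> = tv h (Dm (f_coord z1 z2 z3 y))"
    by (simp add: tv_mult_Tmax[OF assms t(1)] f_coord_rot[symmetric] rot_cancel[OF t(1)])
  finally show ?thesis .
qed

section \<open>Vector fields as equivariant functions\<close>

lemma smooth_M_add: "\<phi> \<in> smooth_M \<Longrightarrow> \<psi> \<in> smooth_M \<Longrightarrow> (\<lambda>p. \<phi> p + \<psi> p) \<in> smooth_M"
  unfolding smooth_M_iff lift_def[abs_def] by (rule Cinf_on_add)

lemma smooth_M_mult: "\<phi> \<in> smooth_M \<Longrightarrow> \<psi> \<in> smooth_M \<Longrightarrow> (\<lambda>p. \<phi> p * \<psi> p) \<in> smooth_M"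
  unfolding smooth_M_iff lift_def[abs_def] by (rule Cinf_on_mult)

lemma smooth_M_const: "(\<lambda>p. c) \<in> smooth_M"
  unfolding smooth_M_iff lift_def[abs_def] by (rule Cinf_on_const[OF open_indep_cols])

text \<open>Smoothness on SU(3) as characterised by \<open>smooth_on_SU3_iff\<close>, in the form to
  which the calculus on open sets applies directly.\<close>

definition smooth_lift :: "(cmat \<Rightarrow> 'b::real_normed_vector) \<Rightarrow> bool"
  where "smooth_lift Y \<longleftrightarrow> Cinf_on indep_cols (\<lambda>A. Y (retr A))"

lemma smooth_lift_cong:
  "smooth_lift Y \<Longrightarrow> (\<And>h. h \<in> SU3 \<Longrightarrow> Y h = Z h) \<Longrightarrow> smooth_lift Z"
  unfolding smooth_lift_def
  using Cinf_on_cong[of indep_cols "\<lambda>A. Y (retr A)" "\<lambda>A. Z (retr A)"] by (simp add: retr_SU3)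

lemma smooth_M_iff_lift: "\<phi> \<in> smooth_M \<longleftrightarrow> smooth_lift (\<lambda>h. \<phi> (coset h))"
  by (simp add: smooth_M_iff smooth_lift_def lift_def[abs_def])

lemma smooth_lift_id: "smooth_lift (\<lambda>h. h)"
  unfolding smooth_lift_def by (rule Cinf_on_retr)

lemma smooth_lift_linear: "bounded_linear L \<Longrightarrow> smooth_lift Y \<Longrightarrow> smooth_lift (\<lambda>h. L (Y h))"
  unfolding smooth_lift_def by (rule Cinf_on_linear)

lemma smooth_lift_bilinear:
  "bounded_bilinear B \<Longrightarrow> smooth_lift Y \<Longrightarrow> smooth_lift Z \<Longrightarrow> smooth_lift (\<lambda>h. B (Y h) (Z h))"
  unfolding smooth_lift_def by (rule Cinf_on_bilinear)

lemma smooth_lift_add: "smooth_lift Y \<Longrightarrow> smooth_lift Z \<Longrightarrow> smooth_lift (\<lambda>h. Y h + Z h)"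
  unfolding smooth_lift_def by (rule Cinf_on_add)

lemma smooth_lift_minus: "smooth_lift Y \<Longrightarrow> smooth_lift (\<lambda>h. - Y h)"
  unfolding smooth_lift_def by (rule Cinf_on_minus)

lemma smooth_lift_diff: "smooth_lift Y \<Longrightarrow> smooth_lift Z \<Longrightarrow> smooth_lift (\<lambda>h. Y h - Z h)"
  unfolding smooth_lift_def by (rule Cinf_on_diff)

lemma smooth_lift_const: "smooth_lift (\<lambda>h. c)"
  unfolding smooth_lift_def by (rule Cinf_on_const[OF open_indep_cols])

lemma smooth_lift_nth: "smooth_lift Y \<Longrightarrow> smooth_lift (\<lambda>h. Y h $ i)"
  unfolding smooth_lift_def by (rule Cinf_on_nth)

lemma smooth_lift_vec: "(\<And>i. smooth_lift (\<lambda>h. Y h $ i)) \<Longrightarrow> smooth_lift Y"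
  unfolding smooth_lift_def by (rule Cinf_on_vec[OF open_indep_cols])

lemma smooth_lift_vec3:
  assumes "smooth_lift a" "smooth_lift b" "smooth_lift c"
  shows "smooth_lift (\<lambda>h. vector [a h, b h, c h] :: complex^3)"
proof (rule smooth_lift_vec)
  show "smooth_lift (\<lambda>h. (vector [a h, b h, c h] :: complex^3) $ i)" for i
    using exhaust_3[of i] by (elim disjE) (simp_all add: assms)
qed

lemmas smooth_lift_intros = smooth_lift_add smooth_lift_minus smooth_lift_diff smooth_lift_const smooth_lift_nth
  smooth_lift_bilinear[OF bounded_bilinear_mult] smooth_lift_bilinear[OF bounded_bilinear_matrix_mult]
  smooth_lift_bilinear[OF bounded_bilinear_scaleR]
  smooth_lift_linear[OF bounded_linear_cadjoint] smooth_lift_linear[OF bounded_linear_cnj]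
  smooth_lift_linear[OF bounded_linear_of_real] smooth_lift_linear[OF bounded_linear_Dm] smooth_lift_vec3 smooth_lift_id

text \<open>Components of X in the left-invariant frame. They are functions on SU(3) rather than on
  M, since the frame depends on the representative.\<close>

definition hat :: "vfield \<Rightarrow> cmat \<Rightarrow> complex^3"
  where "hat X h = coord h (X (coset h))"

lemma hat_eqI: "h \<in> SU3 \<Longrightarrow> X (coset h) = tv h (Dm y) \<Longrightarrow> hat X h = y"
  by (simp add: hat_def coord_tv)

lemma vector_field_tv:
  assumes "X \<in> vector_fields" "h \<in> SU3"
  shows "X (coset h) = tv h (Dm (hat X h))"
proof -
  have "X (coset h) \<in> tangent_space (coset h)"
    using assms coset_in_M by (auto simp: vector_fields_def)
  then obtain y where "X (coset h) = tv h (Dm y)" using tangent_spaceD[OF assms(2)] by blast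
  then show ?thesis by (simp add: hat_eqI[OF assms(2)])
qed

lemma vector_field_off_M: "X \<in> vector_fields \<Longrightarrow> p \<notin> M \<Longrightarrow> X p = 0"
  by (simp add: vector_fields_def)

lemma vector_field_eqI:
  assumes "X \<in> vector_fields" "Y \<in> vector_fields" "\<And>h. h \<in> SU3 \<Longrightarrow> hat X h = hat Y h"
  shows "X = Y"
proof
  fix p show "X p = Y p"
  proof (cases "p \<in> M")
    case True
    then obtain h where "h \<in> SU3" "p = coset h" by (rule M_cases)
    then show ?thesis using vector_field_tv assms by metis
  qed (use assms vector_field_off_M in metis)
qed

text \<open>Smooth sections of the associated bundle: the rotation compensates the change of frame
  recorded in \<open>tv_mult_Tmax\<close>.\<close>

definition equivariant :: "(cmat \<Rightarrow> complex^3) \<Rightarrow> bool"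
  where "equivariant Y \<longleftrightarrow> smooth_lift Y \<and> (\<forall>h\<in>SU3. \<forall>t\<in>Tmax. rot t (Y (h ** t)) = Y h)"

lemma equivariant_hat:
  assumes X: "X \<in> vector_fields" shows "equivariant (hat X)"
  unfolding equivariant_def
proof (intro conjI ballI)
  fix h t assume h: "h \<in> SU3" and t: "t \<in> Tmax"
  have ht: "h ** t \<in> SU3" using h t Tmax_subset SU3_mult by blast
  have "tv h (Dm (rot t (hat X (h ** t)))) = tv h (Dm (hat X h))"
    using vector_field_tv[OF X h] vector_field_tv[OF X ht] tv_mult_Tmax[OF h t] coset_mult_Tmax[OF h t]
    by simp
  then show "rot t (hat X (h ** t)) = hat X h" using tv_Dm_inject[OF h] by simp
next
  have "smooth_lift (\<lambda>h. proj_velocity k (X (coset h)) $ i $ j)" for i j k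
  proof -
    have "(\<lambda>p. X p (\<lambda>p. Re (proj_entry k i j p))) \<in> smooth_M" "(\<lambda>p. X p (\<lambda>p. Im (proj_entry k i j p))) \<in> smooth_M"
      using X proj_entry_smooth by (auto simp: vector_fields_def)
    then have "smooth_lift (\<lambda>h. complex_of_real (X (coset h) (\<lambda>p. Re (proj_entry k i j p))) +
        \<i> * complex_of_real (X (coset h) (\<lambda>p. Im (proj_entry k i j p))))"
      unfolding smooth_M_iff_lift by (intro smooth_lift_intros)
    then show ?thesis by (simp add: proj_velocity_def Complex_eq)
  qed
  then have "smooth_lift (\<lambda>h. proj_velocity k (X (coset h)))" for k
    by (intro smooth_lift_vec)
  then show "smooth_lift (hat X)"
    unfolding hat_def[abs_def] coord_def by (intro smooth_lift_intros)
qed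

definition field_of :: "(cmat \<Rightarrow> complex^3) \<Rightarrow> vfield"
  where "field_of Y = (\<lambda>p. if p \<in> M then tv (repr p) (Dm (Y (repr p))) else 0)"

lemma field_of_coset:
  assumes Y: "equivariant Y" and h: "h \<in> SU3"
  shows "field_of Y (coset h) = tv h (Dm (Y h))"
proof -
  obtain t where t: "t \<in> Tmax" "repr (coset h) = h ** t" using repr_coset[OF h] .
  then show ?thesis
    using Y h tv_mult_Tmax[OF h t(1)] by (simp add: field_of_def coset_in_M equivariant_def)
qed

text \<open>The second form keeps the moving base point A and is smooth on an open set, ready to be
  differentiated again in \<open>apply_twice\<close>; on SU(3) it agrees with the first.\<close>

lemma smooth_field_apply:
  assumes Y: "smooth_lift Y" and \<phi>: "\<phi> \<in> smooth_M"
  shows "smooth_lift (\<lambda>h. tv h (Dm (Y h)) \<phi>)"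
    "Cinf_on indep_cols (\<lambda>A. frechet_derivative (lift \<phi>) (at A) (A ** Dm (Y (retr A))))"
proof -
  have "Cinf_on indep_cols (\<lambda>A. A ** Dm (Y (retr A)))"
    by (intro Cinf_on_bilinear[OF bounded_bilinear_matrix_mult] Cinf_on_id open_indep_cols
        Cinf_on_linear[OF bounded_linear_Dm] Y[unfolded smooth_lift_def])
  with \<phi> show *: "Cinf_on indep_cols (\<lambda>A. frechet_derivative (lift \<phi>) (at A) (A ** Dm (Y (retr A))))"
    unfolding smooth_M_iff by (rule Cinf_on_frechet_derivative)
  have "Cinf_on indep_cols (\<lambda>A. frechet_derivative (lift \<phi>) (at (retr A)) (retr A ** Dm (Y (retr (retr A)))))"
    by (rule Cinf_on_compose[OF Cinf_on_retr *]) (simp add: retr_SU3 SU3_col_sq)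
  then show "smooth_lift (\<lambda>h. tv h (Dm (Y h)) \<phi>)"
    unfolding smooth_lift_def
    by (rule Cinf_on_cong) (simp add: tv_def \<phi> retr_id retr_SU3)
qed

lemma field_of_vector_field:
  assumes Y: "equivariant Y" shows "field_of Y \<in> vector_fields"
  unfolding vector_fields_def
proof (intro CollectI conjI ballI allI impI)
  show "field_of Y p \<in> tangent_space p" if "p \<in> M" for p
    using that by (elim M_cases) (simp add: field_of_coset[OF Y] tangent_spaceI)
  show "field_of Y p = 0" if "p \<notin> M" for p using that by (simp add: field_of_def)
  fix \<phi> assume \<phi>: "\<phi> \<in> smooth_M"
  have "smooth_lift Y" using Y by (simp add: equivariant_def)
  then have "smooth_lift (\<lambda>h. tv h (Dm (Y h)) \<phi>)" using smooth_field_apply \<phi> by blast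
  then show "(\<lambda>p. field_of Y p \<phi>) \<in> smooth_M"
    unfolding smooth_M_iff_lift by (rule smooth_lift_cong) (simp add: field_of_coset[OF Y])
qed

lemma hat_field_of: "equivariant Y \<Longrightarrow> h \<in> SU3 \<Longrightarrow> hat (field_of Y) h = Y h"
  by (rule hat_eqI) (simp_all add: field_of_coset)

lemma vector_field_combination:
  assumes "X \<in> vector_fields" "Y \<in> vector_fields" "\<phi> \<in> smooth_M" "\<psi> \<in> smooth_M"
  shows "(\<lambda>p. \<phi> p *\<^sub>R X p + \<psi> p *\<^sub>R Y p) \<in> vector_fields"
    "h \<in> SU3 \<Longrightarrow> hat (\<lambda>p. \<phi> p *\<^sub>R X p + \<psi> p *\<^sub>R Y p) h = \<phi> (coset h) *\<^sub>R hat X h + \<psi> (coset h) *\<^sub>R hat Y h"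
proof -
  have eq: "\<phi> (coset h) *\<^sub>R X (coset h) + \<psi> (coset h) *\<^sub>R Y (coset h) =
      tv h (Dm (\<phi> (coset h) *\<^sub>R hat X h + \<psi> (coset h) *\<^sub>R hat Y h))" if "h \<in> SU3" for h
    using that assms vector_field_tv by (simp add: tv_Dm_add tv_Dm_scaleR)
  then show "hat (\<lambda>p. \<phi> p *\<^sub>R X p + \<psi> p *\<^sub>R Y p) h = \<phi> (coset h) *\<^sub>R hat X h + \<psi> (coset h) *\<^sub>R hat Y h"
    if "h \<in> SU3" using that by (intro hat_eqI)
  show "(\<lambda>p. \<phi> p *\<^sub>R X p + \<psi> p *\<^sub>R Y p) \<in> vector_fields"
    unfolding vector_fields_def
  proof (intro CollectI conjI ballI allI impI)
    show "\<phi> p *\<^sub>R X p + \<psi> p *\<^sub>R Y p \<in> tangent_space p" if "p \<in> M" for p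
      using that by (elim M_cases) (simp add: eq tangent_spaceI)
    show "\<phi> p *\<^sub>R X p + \<psi> p *\<^sub>R Y p = 0" if "p \<notin> M" for p
      using assms that by (simp add: vector_field_off_M scaleR_fun_def fun_eq_iff)
    show "(\<lambda>p. (\<phi> p *\<^sub>R X p + \<psi> p *\<^sub>R Y p) \<theta>) \<in> smooth_M" if "\<theta> \<in> smooth_M" for \<theta>
      using assms that by (auto simp: scaleR_fun_def vector_fields_def intro!: smooth_M_add smooth_M_mult)
  qed
qed

lemma vector_field_add:
  assumes "X \<in> vector_fields" "Y \<in> vector_fields"
  shows "X + Y \<in> vector_fields" "h \<in> SU3 \<Longrightarrow> hat (X + Y) h = hat X h + hat Y h"
  using vector_field_combination[OF assms smooth_M_const[of 1] smooth_M_const[of 1]]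
  by (simp_all add: plus_fun_def)

lemma vector_field_diff:
  assumes "X \<in> vector_fields" "Y \<in> vector_fields"
  shows "X - Y \<in> vector_fields" "h \<in> SU3 \<Longrightarrow> hat (X - Y) h = hat X h - hat Y h"
  using vector_field_combination[OF assms smooth_M_const[of 1] smooth_M_const[of "-1"]]
  by (simp_all add: fun_diff_def)

lemma vector_field_scaleR:
  assumes "X \<in> vector_fields" "\<phi> \<in> smooth_M"
  shows "(\<lambda>p. \<phi> p *\<^sub>R X p) \<in> vector_fields" "h \<in> SU3 \<Longrightarrow> hat (\<lambda>p. \<phi> p *\<^sub>R X p) h = \<phi> (coset h) *\<^sub>R hat X h"
  using vector_field_combination[OF assms(1,1,2) smooth_M_const[of 0]] by simp_all

text \<open>The derivative along the left-invariant direction of x, for functions that matter only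
  on SU(3). The extension by \<open>retr\<close> makes it a Frechet derivative, and
  \<open>dd_curve\<close> computes it along curves inside SU(3).\<close>

definition dd :: "cmat \<Rightarrow> complex^3 \<Rightarrow> (cmat \<Rightarrow> 'b::real_normed_vector) \<Rightarrow> 'b"
  where "dd h x Y = frechet_derivative (\<lambda>A. Y (retr A)) (at h) (h ** Dm x)"

lemma dd_curve:
  assumes Y: "smooth_lift Y" and h: "h \<in> SU3"
    and c: "\<And>s. c s \<in> SU3" "c 0 = h" "(c has_vector_derivative h ** Dm x) (at 0)"
  shows "((\<lambda>s. Y (c s)) has_vector_derivative dd h x Y) (at (0::real))"
proof -
  have d: "((\<lambda>A. Y (retr A)) has_derivative frechet_derivative (\<lambda>A. Y (retr A)) (at h)) (at (c 0))"
    using Cinf_on_has_derivative[OF Y[unfolded smooth_lift_def] SU3_col_sq(4)[OF h]] c(2) by simp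
  then have "((\<lambda>s. Y (retr (c s))) has_derivative
      (\<lambda>r. frechet_derivative (\<lambda>A. Y (retr A)) (at h) (r *\<^sub>R (h ** Dm x)))) (at 0)"
    using has_derivative_compose[OF c(3)[unfolded has_vector_derivative_def]] by blast
  moreover have "linear (frechet_derivative (\<lambda>A. Y (retr A)) (at h))"
    using has_derivative_linear[OF d] .
  ultimately show ?thesis
    by (simp add: has_vector_derivative_def dd_def linear_cmul retr_id c(1))
qed

text \<open>Every direction in m is the velocity of a curve in SU(3), so each rule for
  \<open>dd\<close> reduces to the one-variable rule along curves.\<close>

lemma dd_eqI:
  assumes Y: "smooth_lift Y" and h: "h \<in> SU3"
    and d: "\<And>c. (\<And>s. c s \<in> SU3) \<Longrightarrow> c 0 = h \<Longrightarrow> (c has_vector_derivative h ** Dm x) (at 0) \<Longrightarrow>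
      ((\<lambda>s. Y (c s)) has_vector_derivative d) (at (0::real))"
  shows "dd h x Y = d"
proof -
  obtain c where c: "\<And>s. c s \<in> SU3" "c 0 = h" "(c has_vector_derivative h ** Dm x) (at (0::real))"
    by (rule SU3_curve_through[OF h, of x]) blast
  show ?thesis
    using vector_derivative_unique_at[OF dd_curve[OF Y h c] d[OF c]] .
qed

lemma dd_linear_left:
  assumes "smooth_lift Y" "h \<in> SU3"
  shows "dd h (a *\<^sub>R x + b *\<^sub>R y) Y = a *\<^sub>R dd h x Y + b *\<^sub>R dd h y Y"
proof -
  have "linear (frechet_derivative (\<lambda>A. Y (retr A)) (at h))"
    using has_derivative_linear[OF Cinf_on_has_derivative[OF assms(1)[unfolded smooth_lift_def] SU3_col_sq(4)[OF assms(2)]]] .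
  then show ?thesis
    by (simp add: dd_def linear_add[OF linear_Dm] linear_cmul[OF linear_Dm] matrix_combination
        linear_add linear_cmul)
qed

lemma dd_cong:
  assumes "smooth_lift Y" "h \<in> SU3" "\<And>h. h \<in> SU3 \<Longrightarrow> Y h = Z h"
  shows "dd h x Z = dd h x Y"
  by (rule dd_eqI[OF smooth_lift_cong[OF assms(1,3)] assms(2)])
    (use dd_curve[OF assms(1,2)] assms(3) in simp_all)

lemma dd_add:
  assumes "smooth_lift Y" "smooth_lift Z" "h \<in> SU3"
  shows "dd h x (\<lambda>h. Y h + Z h) = dd h x Y + dd h x Z"
  by (rule dd_eqI[OF smooth_lift_add[OF assms(1,2)] assms(3)])
    (intro has_vector_derivative_add dd_curve assms; assumption)

lemma dd_linear:
  assumes "bounded_linear L" "smooth_lift Y" "h \<in> SU3"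
  shows "dd h x (\<lambda>h. L (Y h)) = L (dd h x Y)"
  by (rule dd_eqI[OF smooth_lift_linear[OF assms(1,2)] assms(3)])
    (intro bounded_linear.has_vector_derivative[OF assms(1)] dd_curve assms; assumption)

lemma dd_bilinear:
  assumes "bounded_bilinear B" "smooth_lift Y" "smooth_lift Z" "h \<in> SU3"
  shows "dd h x (\<lambda>h. B (Y h) (Z h)) = B (dd h x Y) (Z h) + B (Y h) (dd h x Z)"
proof (rule dd_eqI[OF smooth_lift_bilinear[OF assms(1-3)] assms(4)])
  fix c :: "real \<Rightarrow> cmat" 
  assume c: "\<And>s. c s \<in> SU3" "c 0 = h" "(c has_vector_derivative h ** Dm x) (at 0)"
  show "((\<lambda>s. B (Y (c s)) (Z (c s))) has_vector_derivative B (dd h x Y) (Z h) + B (Y h) (dd h x Z)) (at 0)"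
    using bounded_bilinear.has_vector_derivative[OF assms(1) dd_curve[OF assms(2,4) c] dd_curve[OF assms(3,4) c]]
    by (simp add: c(2) add.commute)
qed

lemma tv_eq_dd:
  assumes \<phi>: "\<phi> \<in> smooth_M" and h: "h \<in> SU3"
  shows "tv h (Dm x) \<phi> = dd h x (\<lambda>h. \<phi> (coset h))"
  by (rule dd_eqI[symmetric]) 
    (use \<phi> h in \<open>auto simp: smooth_M_iff_lift[symmetric] has_real_derivative_iff_has_vector_derivative[symmetric] intro!: tv_curve\<close>)

lemma bounded_linear_rot: "bounded_linear (rot t)"
  unfolding linear_conv_bounded_linear[symmetric]
  by (intro linearI) (simp_all add: rot_def vec_eq_iff forall_3 algebra_simps)

text \<open>The equivariance relation is differentiated along a curve and its right translate. As a
  result, the derivative of an equivariant function in an equivariant direction is again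
  equivariant.\<close>

lemma dd_rot:
  assumes Y: "equivariant Y" and h: "h \<in> SU3" and t: "t \<in> Tmax"
  shows "rot t (dd (h ** t) x Y) = dd h (rot t x) Y"
proof -
  have tS: "t \<in> SU3" using t Tmax_subset by blast
  have sY: "smooth_lift Y" using Y by (simp add: equivariant_def)
  obtain c where c: "\<And>s. c s \<in> SU3" "c 0 = h ** t" "(c has_vector_derivative (h ** t) ** Dm x) (at (0::real))"
    by (rule SU3_curve_through[OF SU3_mult[OF h tS], of x]) blast
  have SU': "c s ** cadjoint t \<in> SU3" for s by (intro SU3_mult c(1) SU3_cadjoint tS)
  have "((\<lambda>s. Y (c s)) has_vector_derivative dd (h ** t) x Y) (at 0)"
    by (rule dd_curve[OF sY SU3_mult[OF h tS] c])
  from bounded_linear.has_vector_derivative[OF bounded_linear_rot[of t] this]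
  have "((\<lambda>s. rot t (Y (c s))) has_vector_derivative rot t (dd (h ** t) x Y)) (at 0)" .
  moreover have "rot t (Y (c s)) = Y (c s ** cadjoint t)" for s
  proof -
    have "rot t (Y (c s ** cadjoint t ** t)) = Y (c s ** cadjoint t)"
      using Y SU'[of s] t unfolding equivariant_def by blast
    then show ?thesis by (simp add: SU3_cancel[OF tS])
  qed
  moreover have "((\<lambda>s. Y (c s ** cadjoint t)) has_vector_derivative dd h (rot t x) Y) (at 0)"
  proof (rule dd_curve[OF sY h SU'])
    show "((\<lambda>s. c s ** cadjoint t) has_vector_derivative h ** Dm (rot t x)) (at 0)"
      using has_vector_derivative_mult_right_matrix[OF c(3), of "cadjoint t"]
      by (simp add: matrix_mul_assoc flip: Dm_rot[OF t])
    show "c 0 ** cadjoint t = h" by (simp add: c(2) SU3_cancel[OF tS])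
  qed
  ultimately show ?thesis using vector_derivative_unique_at by fastforce
qed

lemma smooth_lift_dd:
  fixes Y :: "cmat \<Rightarrow> 'b::real_normed_vector"
  assumes X: "smooth_lift X" and Y: "smooth_lift Y"
  shows "smooth_lift (\<lambda>h. dd h (X h) Y)"
proof -
  have "Cinf_on indep_cols (\<lambda>A. A ** Dm (X (retr A)))"
    by (intro Cinf_on_bilinear[OF bounded_bilinear_matrix_mult] Cinf_on_id open_indep_cols
        Cinf_on_linear[OF bounded_linear_Dm] X[unfolded smooth_lift_def])
  then have *: "Cinf_on indep_cols (\<lambda>A. frechet_derivative (\<lambda>A. Y (retr A)) (at A) (A ** Dm (X (retr A))))"
    by (rule Cinf_on_frechet_derivative[OF Y[unfolded smooth_lift_def]])
  have "Cinf_on indep_cols (\<lambda>A. frechet_derivative (\<lambda>A. Y (retr A)) (at (retr A)) (retr A ** Dm (X (retr (retr A)))))"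
    by (rule Cinf_on_compose[OF Cinf_on_retr *]) (simp add: retr_SU3 SU3_col_sq)
  then show ?thesis
    unfolding smooth_lift_def
    by (rule Cinf_on_cong) (simp add: dd_def retr_id retr_SU3)
qed

section \<open>The Levi-Civita connection\<close>

text \<open>The m-component of the matrix commutator; the diagonal component is annihilated by
  \<open>tv\<close>.\<close>

definition bracket :: "complex^3 \<Rightarrow> complex^3 \<Rightarrow> complex^3"
  where "bracket x y = vector [cnj (x $ 2 * y $ 3 - x $ 3 * y $ 2),
    cnj (x $ 3 * y $ 1 - x $ 1 * y $ 3), cnj (x $ 1 * y $ 2 - x $ 2 * y $ 1)]"

lemma tv_commutator:
  assumes h: "h \<in> SU3"
  shows "tv h (Dm x ** Dm y - Dm y ** Dm x) = tv h (Dm (bracket x y))"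
proof -
  let ?E = "Dm x ** Dm y - Dm y ** Dm x"
  have "?E + cadjoint ?E = 0"
    by (simp add: mat3_simps Dm_def Dmat_def algebra_simps)
  note dec = skew_decomposition[OF this]
  have "vector [?E $ 1 $ 2, ?E $ 2 $ 3, - ?E $ 3 $ 1] = bracket x y"
    by (simp add: bracket_def matrix_matrix_mult_def sum_3 Dm_def Dmat_def vec_eq_iff forall_3 algebra_simps)
  then show ?thesis
    by (subst dec) (simp only: tv_add[OF h] tv_diag3[OF h] add_0_right)
qed

text \<open>In the first-order part, the moving frame contributes the matrix product and the moving
  coefficients contribute \<open>dd\<close>. The second-order term is symmetric under exchange of X
  and Y and cancels in the Lie bracket.\<close>

lemma apply_twice:
  assumes X: "smooth_lift X" and Y: "smooth_lift Y" and \<phi>: "\<phi> \<in> smooth_M" and h: "h \<in> SU3"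
  shows "dd h (X h) (\<lambda>h. tv h (Dm (Y h)) \<phi>) = tv h (Dm (X h) ** Dm (Y h) + Dm (dd h (X h) Y)) \<phi> +
    frechet_derivative (\<lambda>A. frechet_derivative (lift \<phi>) (at A) (h ** Dm (X h))) (at h) (h ** Dm (Y h))"
proof -
  let ?V = "\<lambda>A. A ** Dm (Y (retr A))"
  let ?G = "\<lambda>A. frechet_derivative (lift \<phi>) (at A) (?V A)"
  have hi: "h \<in> indep_cols" by (rule SU3_col_sq(4)[OF h])
  have F: "Cinf_on indep_cols (lift \<phi>)" using \<phi> by (simp add: smooth_M_iff)
  have V: "Cinf_on indep_cols ?V"
    by (intro Cinf_on_bilinear[OF bounded_bilinear_matrix_mult] Cinf_on_id open_indep_cols
        Cinf_on_linear[OF bounded_linear_Dm] Y[unfolded smooth_lift_def])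
  have G: "Cinf_on indep_cols ?G" by (rule smooth_field_apply(2)[OF Y \<phi>])
  have "dd h (X h) (\<lambda>h. tv h (Dm (Y h)) \<phi>) = frechet_derivative ?G (at h) (h ** Dm (X h))"
  proof (rule dd_eqI[OF smooth_field_apply(1)[OF Y \<phi>] h])
    fix c :: "real \<Rightarrow> cmat"
    assume c: "\<And>s. c s \<in> SU3" "c 0 = h" "(c has_vector_derivative h ** Dm (X h)) (at 0)"
    have d: "(?G has_derivative frechet_derivative ?G (at h)) (at (c 0))"
      using Cinf_on_has_derivative[OF G hi] c(2) by simp
    then have "((\<lambda>s. ?G (c s)) has_derivative
        (\<lambda>r. frechet_derivative ?G (at h) (r *\<^sub>R (h ** Dm (X h))))) (at 0)"
      using has_derivative_compose[OF c(3)[unfolded has_vector_derivative_def]] by blast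
    moreover have "?G (c s) = tv (c s) (Dm (Y (c s))) \<phi>" for s
      by (simp add: tv_def \<phi> retr_id c(1))
    ultimately show "((\<lambda>s. tv (c s) (Dm (Y (c s))) \<phi>) has_vector_derivative frechet_derivative ?G (at h) (h ** Dm (X h))) (at 0)"
      using linear_cmul[OF has_derivative_linear[OF d]] by (simp add: has_vector_derivative_def)
  qed
  also have "\<dots> = frechet_derivative (lift \<phi>) (at h) (frechet_derivative ?V (at h) (h ** Dm (X h))) +
      frechet_derivative (\<lambda>A. frechet_derivative (lift \<phi>) (at A) (h ** Dm (X h))) (at h) (?V h)"
    by (rule frechet_derivative_along_field[OF F V hi])
  also have "frechet_derivative ?V (at h) (h ** Dm (X h)) = h ** (Dm (X h) ** Dm (Y h) + Dm (dd h (X h) Y))"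
  proof -
    have "(?V has_derivative (\<lambda>v. h ** Dm (frechet_derivative (\<lambda>A. Y (retr A)) (at h) v) + v ** Dm (Y (retr h)))) (at h)"
      by (intro bounded_bilinear.FDERIV[OF bounded_bilinear_matrix_mult] has_derivative_ident
          bounded_linear.has_derivative[OF bounded_linear_Dm] Cinf_on_has_derivative[OF Y[unfolded smooth_lift_def] hi])
    from frechet_derivative_at[OF this, symmetric] show ?thesis
      by (simp add: dd_def retr_id h matrix_add_ldistrib matrix_mul_assoc)
  qed
  finally show ?thesis by (simp add: retr_id h tv_def \<phi>)
qed

lemma lie_bracket_tv:
  assumes X: "X \<in> vector_fields" and Y: "Y \<in> vector_fields" and h: "h \<in> SU3"
  shows "lie_bracket X Y (coset h) =
    tv h (Dm (dd h (hat X h) (hat Y) - dd h (hat Y h) (hat X) + bracket (hat X h) (hat Y h)))"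
proof (rule sym, rule tv_eqI)
  have sX: "smooth_lift (hat X)" and sY: "smooth_lift (hat Y)"
    using equivariant_hat X Y by (auto simp: equivariant_def)
  fix \<phi> assume \<phi>: "\<phi> \<in> smooth_M"
  have lin: "tv h (\<xi> - \<eta>) \<phi> = tv h \<xi> \<phi> - tv h \<eta> \<phi>" for \<xi> \<eta>
    using tv_linear[OF h, of 1 \<xi> "-1" \<eta>] by simp
  have XY: "X (coset h) (\<lambda>q. Y q \<phi>) = dd h (hat X h) (\<lambda>h. tv h (Dm (hat Y h)) \<phi>)"
    if X: "X \<in> vector_fields" and Y: "Y \<in> vector_fields" for X Y
  proof -
    have sm: "(\<lambda>q. Y q \<phi>) \<in> smooth_M" using Y \<phi> by (auto simp: vector_fields_def)
    have "X (coset h) (\<lambda>q. Y q \<phi>) = dd h (hat X h) (\<lambda>h. Y (coset h) \<phi>)"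
      using tv_eq_dd[OF sm h] vector_field_tv[OF X h] by simp
    also have "\<dots> = dd h (hat X h) (\<lambda>h. tv h (Dm (hat Y h)) \<phi>)"
      by (rule dd_cong[symmetric, OF sm[unfolded smooth_M_iff_lift] h]) (simp add: vector_field_tv[OF Y])
    finally show ?thesis .
  qed
  have F: "Cinf_on indep_cols (lift \<phi>)" using \<phi> by (simp add: smooth_M_iff)
  have "lie_bracket X Y (coset h) \<phi> =
      tv h (Dm (hat X h) ** Dm (hat Y h) + Dm (dd h (hat X h) (hat Y))) \<phi> -
      tv h (Dm (hat Y h) ** Dm (hat X h) + Dm (dd h (hat Y h) (hat X))) \<phi>"
    unfolding lie_bracket_def XY[OF X Y] XY[OF Y X] apply_twice[OF sX sY \<phi> h] apply_twice[OF sY sX \<phi> h]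
    using second_derivative_commute[OF F SU3_col_sq(4)[OF h], of "h ** Dm (hat X h)" "h ** Dm (hat Y h)"]
    by simp
  also have "\<dots> = tv h ((Dm (hat X h) ** Dm (hat Y h) - Dm (hat Y h) ** Dm (hat X h)) +
      (Dm (dd h (hat X h) (hat Y)) - Dm (dd h (hat Y h) (hat X)))) \<phi>"
    unfolding lin[symmetric] by (simp add: algebra_simps)
  also have "\<dots> = tv h (Dm (bracket (hat X h) (hat Y h)) + Dm (dd h (hat X h) (hat Y) - dd h (hat Y h) (hat X))) \<phi>"
    by (simp only: tv_add[OF h] tv_commutator[OF h] linear_diff[OF linear_Dm])
  also have "\<dots> = tv h (Dm (dd h (hat X h) (hat Y) - dd h (hat Y h) (hat X) + bracket (hat X h) (hat Y h))) \<phi>"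
    by (simp only: linear_add[OF linear_Dm, symmetric] add.commute)
  finally show "tv h (Dm (dd h (hat X h) (hat Y) - dd h (hat Y h) (hat X) + bracket (hat X h) (hat Y h))) \<phi> =
      lie_bracket X Y (coset h) \<phi>" by simp
next
  fix \<phi> assume \<phi>: "\<phi> \<notin> smooth_M"
  have z: "X q \<phi> = 0" if "X \<in> vector_fields" for X q
  proof (cases "q \<in> M")
    case True
    then obtain k where "k \<in> SU3" "q = coset k" by (rule M_cases)
    then show ?thesis using vector_field_tv[OF that] tv_not_smooth[OF \<phi>] by metis
  qed (use vector_field_off_M[OF that] in simp)
  \<comment> \<open>On a non-smooth function both fields give 0, so each iterated term applies a
    tangent vector to the zero function, which is smooth and constant.\<close>
  have "tv h (Dm x) (\<lambda>q. 0) = 0" for x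
    using tv_eq_dd[OF smooth_M_const h, of x 0] by (simp add: dd_def frechet_derivative_const)
  then show "lie_bracket X Y (coset h) \<phi> = 0"
    by (simp add: lie_bracket_def z[OF X] z[OF Y] vector_field_tv[OF _ h] X Y)
qed

text \<open>The coefficients are the unique ones for which \<open>lam\<close> is torsion-free and metric, as in
  \<open>lam_torsion\<close> and \<open>lam_metric\<close>.\<close>

definition lam :: "real \<Rightarrow> real \<Rightarrow> real \<Rightarrow> complex^3 \<Rightarrow> complex^3 \<Rightarrow> complex^3"
  where "lam l1 l2 l3 x y = vector
    [cnj (((l1 + l3 - l2) / (2 * l1)) *\<^sub>R (x $ 2 * y $ 3) - ((l1 - l3 + l2) / (2 * l1)) *\<^sub>R (x $ 3 * y $ 2)),
     cnj (((l2 + l1 - l3) / (2 * l2)) *\<^sub>R (x $ 3 * y $ 1) - ((l2 - l1 + l3) / (2 * l2)) *\<^sub>R (x $ 1 * y $ 3)),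
     cnj (((l3 + l2 - l1) / (2 * l3)) *\<^sub>R (x $ 1 * y $ 2) - ((l3 - l2 + l1) / (2 * l3)) *\<^sub>R (x $ 2 * y $ 1))]"

lemma lam_linear_left: "lam l1 l2 l3 (a *\<^sub>R x + b *\<^sub>R y) z = a *\<^sub>R lam l1 l2 l3 x z + b *\<^sub>R lam l1 l2 l3 y z"
  by (simp add: lam_def vec_eq_iff forall_3 algebra_simps)

lemma lam_linear_right: "lam l1 l2 l3 z (a *\<^sub>R x + b *\<^sub>R y) = a *\<^sub>R lam l1 l2 l3 z x + b *\<^sub>R lam l1 l2 l3 z y"
  by (simp add: lam_def vec_eq_iff forall_3 algebra_simps)

lemma lam_rot:
  assumes "t \<in> Tmax" shows "rot t (lam l1 l2 l3 x y) = lam l1 l2 l3 (rot t x) (rot t y)"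
proof -
  obtain a b c where t: "t = diag3 a b c" "cmod a = 1" "cmod b = 1" "cmod c = 1"
    using assms Tmax_iff by auto
  have u: "a * cnj a = 1" "b * cnj b = 1" "c * cnj c = 1"
    using t by (simp_all flip: complex_norm_square)
  \<comment> \<open>The three characters multiply to 1, so each is the conjugate of the product of
    the other two. This matches the conjugated products in \<open>lam\<close>.\<close>
  have w: "a * cnj b = cnj (b * cnj c) * cnj (c * cnj a)"
    "b * cnj c = cnj (c * cnj a) * cnj (a * cnj b)" "c * cnj a = cnj (a * cnj b) * cnj (b * cnj c)"
    unfolding complex_cnj_mult complex_cnj_cnj using u by algebra+
  have *: "w * cnj (p *\<^sub>R (x * y') - q *\<^sub>R (x' * y)) = cnj (p *\<^sub>R ((u * x) * (v * y')) - q *\<^sub>R ((v * x') * (u * y)))"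
    if "w = cnj u * cnj v" for p q :: real and u v w x y x' y' :: complex
    unfolding that by (simp add: algebra_simps)
  show ?thesis
    unfolding rot_def t(1) diag3_def lam_def vector_3
    by (simp only: *[OF w(1)] *[OF w(2)] *[OF w(3)])
qed

lemma lam_torsion:
  assumes "l1 > 0" "l2 > 0" "l3 > 0"
  shows "lam l1 l2 l3 x y - lam l1 l2 l3 y x = bracket x y"
proof -
  have *: "((a + c - b) / (2 * a)) *\<^sub>R u - ((a - c + b) / (2 * a)) *\<^sub>R v -
      (((a + c - b) / (2 * a)) *\<^sub>R v - ((a - c + b) / (2 * a)) *\<^sub>R u) = u - v"
    if "a > 0" for a b c :: real and u v :: complex
  proof -
    \<comment> \<open>The two coefficients in a component sum to 1, so antisymmetrising collapses
      them to the bracket.\<close>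
    have eq: "(a + c - b) / (2 * a) = 1 - (a - c + b) / (2 * a)" using that by (simp add: field_simps)
    show ?thesis unfolding eq by (simp add: scaleR_left_diff_distrib scaleR_right_diff_distrib)
  qed
  show ?thesis
    using *[OF assms(1), of l3 l2 "x $ 2 * y $ 3" "x $ 3 * y $ 2"]
      *[OF assms(2), of l1 l3 "x $ 3 * y $ 1" "x $ 1 * y $ 3"]
      *[OF assms(3), of l2 l1 "x $ 1 * y $ 2" "x $ 2 * y $ 1"]
    unfolding lam_def bracket_def
    by (simp add: vec_eq_iff forall_3 mult.commute flip: complex_cnj_diff)
qed

lemma lam_metric:
  assumes "l1 > 0" "l2 > 0" "l3 > 0"
  shows "metric_coord l1 l2 l3 (lam l1 l2 l3 x y) z + metric_coord l1 l2 l3 y (lam l1 l2 l3 x z) = 0"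
proof -
  \<comment> \<open>The weight of the metric cancels the denominator and leaves real parts of triple
    products of components of x, y and z. Each triple product then occurs twice, with opposite
    coefficients.\<close>
  have *: "l * (cnj ((a / (2 * l)) *\<^sub>R u - (b / (2 * l)) *\<^sub>R v) \<bullet> w) = (a * Re (u * w) - b * Re (v * w)) / 2"
    "l * (w \<bullet> cnj ((a / (2 * l)) *\<^sub>R u - (b / (2 * l)) *\<^sub>R v)) = (a * Re (u * w) - b * Re (v * w)) / 2"
    if "l > 0" for l a b :: real and u v w :: complex
    using that by (simp_all add: inner_complex_def field_simps)
  show ?thesis
    unfolding metric_coord_def lam_def vector_3 *[OF assms(1)] *[OF assms(2)] *[OF assms(3)]
    by (simp add: field_simps)
qed

lemma bounded_bilinear_metric_coord: "bounded_bilinear (metric_coord l1 l2 l3)"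
proof -
  have "bilinear (metric_coord l1 l2 l3)"
    unfolding bilinear_def
    by (intro conjI allI linearI; simp add: metric_coord_def inner_complex_def algebra_simps)
  then show ?thesis by (simp add: bilinear_conv_bounded_bilinear)
qed

definition conn :: "real \<Rightarrow> real \<Rightarrow> real \<Rightarrow> vfield \<Rightarrow> vfield \<Rightarrow> cmat \<Rightarrow> complex^3"
  where "conn l1 l2 l3 X Y h = dd h (hat X h) (hat Y) + lam l1 l2 l3 (hat X h) (hat Y h)"

lemma equivariant_conn:
  assumes X: "X \<in> vector_fields" and Y: "Y \<in> vector_fields"
  shows "equivariant (conn l1 l2 l3 X Y)"
  unfolding equivariant_def
proof (intro conjI ballI)
  have sX: "smooth_lift (hat X)" and sY: "smooth_lift (hat Y)"
    using equivariant_hat X Y by (auto simp: equivariant_def)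
  then show "smooth_lift (conn l1 l2 l3 X Y)"
    unfolding conn_def[abs_def] lam_def by (intro smooth_lift_intros smooth_lift_dd)
  fix h t assume h: "h \<in> SU3" and t: "t \<in> Tmax"
  have r: "rot t (hat X (h ** t)) = hat X h" "rot t (hat Y (h ** t)) = hat Y h"
    using equivariant_hat X Y h t by (auto simp: equivariant_def)
  show "rot t (conn l1 l2 l3 X Y (h ** t)) = conn l1 l2 l3 X Y h"
    using dd_rot[OF equivariant_hat[OF Y] h t, of "hat X (h ** t)"]
      lam_rot[OF t, of l1 l2 l3 "hat X (h ** t)" "hat Y (h ** t)"]
      linear_add[OF bounded_linear.linear[OF bounded_linear_rot]]
    by (simp add: conn_def r)
qed

text \<open>A metric is determined only on tangent vectors at points of M, so a predicate is used
  instead of equality with \<open>inv_metric\<close>; \<open>f_is\<close> follows the same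
  pattern.\<close>

definition metric_is :: "metric \<Rightarrow> real \<Rightarrow> real \<Rightarrow> real \<Rightarrow> bool"
  where "metric_is g l1 l2 l3 \<longleftrightarrow>
    (\<forall>h\<in>SU3. \<forall>x y. g (coset h) (tv h (Dm x)) (tv h (Dm y)) = metric_coord l1 l2 l3 x y)"

text \<open>Passing to \<open>hat\<close> turns the linearity and Leibniz axioms into rules for
  \<open>dd\<close> and bilinearity of \<open>lam\<close>. The torsion axiom compares
  \<open>lie_bracket_tv\<close> with \<open>lam_torsion\<close>. In the left-invariant frame the
  metric is constant, so after the product rule only \<open>lam_metric\<close> is left for
  compatibility.\<close>

lemma levi_civita_conn:
  assumes l: "l1 > 0" "l2 > 0" "l3 > 0" and g: "metric_is g l1 l2 l3"
  shows "levi_civita g (\<lambda>X Y. field_of (conn l1 l2 l3 X Y))"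
proof -
  let ?C = "conn l1 l2 l3" and ?D = "\<lambda>X Y. field_of (conn l1 l2 l3 X Y)"
  have D: "?D X Y \<in> vector_fields" "\<And>h. h \<in> SU3 \<Longrightarrow> hat (?D X Y) h = ?C X Y h"
    if "X \<in> vector_fields" "Y \<in> vector_fields" for X Y
    using equivariant_conn[OF that] field_of_vector_field hat_field_of by blast+
  have s: "smooth_lift (hat X)" if "X \<in> vector_fields" for X
    using equivariant_hat that by (auto simp: equivariant_def)
  have 1: "?D (X + X') Y = ?D X Y + ?D X' Y"
    if "X \<in> vector_fields" "X' \<in> vector_fields" "Y \<in> vector_fields" for X X' Y
  proof (rule vector_field_eqI)
    show "?D (X + X') Y \<in> vector_fields" "?D X Y + ?D X' Y \<in> vector_fields"
      using that D vector_field_add by auto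
    fix h assume h: "h \<in> SU3"
    show "hat (?D (X + X') Y) h = hat (?D X Y + ?D X' Y) h"
      using that h D vector_field_add dd_linear_left[OF s[OF that(3)] h, of 1 "hat X h" 1 "hat X' h"]
        lam_linear_left[of l1 l2 l3 1 "hat X h" 1 "hat X' h"]
      by (simp add: conn_def)
  qed
  have 2: "?D (\<lambda>p. \<psi> p *\<^sub>R X p) Y = (\<lambda>p. \<psi> p *\<^sub>R ?D X Y p)"
    if "\<psi> \<in> smooth_M" "X \<in> vector_fields" "Y \<in> vector_fields" for \<psi> X Y
  proof (rule vector_field_eqI)
    show "?D (\<lambda>p. \<psi> p *\<^sub>R X p) Y \<in> vector_fields" "(\<lambda>p. \<psi> p *\<^sub>R ?D X Y p) \<in> vector_fields"
      using that D vector_field_scaleR by auto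
    fix h assume h: "h \<in> SU3"
    show "hat (?D (\<lambda>p. \<psi> p *\<^sub>R X p) Y) h = hat (\<lambda>p. \<psi> p *\<^sub>R ?D X Y p) h"
      using that h D vector_field_scaleR dd_linear_left[OF s[OF that(3)] h, of "\<psi> (coset h)" "hat X h" 0 0]
        lam_linear_left[of l1 l2 l3 "\<psi> (coset h)" "hat X h" 0 0]
      by (simp add: conn_def scaleR_add_right)
  qed
  have 3: "?D X (Y + Y') = ?D X Y + ?D X Y'"
    if "X \<in> vector_fields" "Y \<in> vector_fields" "Y' \<in> vector_fields" for X Y Y'
  proof (rule vector_field_eqI)
    show "?D X (Y + Y') \<in> vector_fields" "?D X Y + ?D X Y' \<in> vector_fields"
      using that D vector_field_add by auto
    fix h assume h: "h \<in> SU3"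
    have "dd h (hat X h) (hat (Y + Y')) = dd h (hat X h) (\<lambda>h. hat Y h + hat Y' h)"
      by (rule dd_cong[OF smooth_lift_add[OF s s] h]) (use that vector_field_add in auto)
    then show "hat (?D X (Y + Y')) h = hat (?D X Y + ?D X Y') h"
      using that h D vector_field_add dd_add[OF s[OF that(2)] s[OF that(3)] h]
        lam_linear_right[of l1 l2 l3 _ 1 "hat Y h" 1 "hat Y' h"]
      by (simp add: conn_def)
  qed
  have 4: "?D X (\<lambda>p. \<psi> p *\<^sub>R Y p) = (\<lambda>p. X p \<psi> *\<^sub>R Y p + \<psi> p *\<^sub>R ?D X Y p)"
    if "\<psi> \<in> smooth_M" "X \<in> vector_fields" "Y \<in> vector_fields" for \<psi> X Y
  proof (rule vector_field_eqI)
    have sm: "(\<lambda>p. X p \<psi>) \<in> smooth_M" using that by (simp add: vector_fields_def)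
    note comb = vector_field_combination[OF that(3) D(1)[OF that(2,3)] sm that(1)]
    show "?D X (\<lambda>p. \<psi> p *\<^sub>R Y p) \<in> vector_fields" using that D vector_field_scaleR by auto
    show "(\<lambda>p. X p \<psi> *\<^sub>R Y p + \<psi> p *\<^sub>R ?D X Y p) \<in> vector_fields" by (rule comb)
    fix h assume h: "h \<in> SU3"
    have sp: "smooth_lift (\<lambda>h. \<psi> (coset h))" using that(1) by (simp add: smooth_M_iff_lift)
    have "dd h (hat X h) (hat (\<lambda>p. \<psi> p *\<^sub>R Y p)) = dd h (hat X h) (\<lambda>h. \<psi> (coset h) *\<^sub>R hat Y h)"
      by (rule dd_cong[OF smooth_lift_bilinear[OF bounded_bilinear_scaleR sp s[OF that(3)]] h])
        (use that vector_field_scaleR in auto)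
    then have "dd h (hat X h) (hat (\<lambda>p. \<psi> p *\<^sub>R Y p)) =
        X (coset h) \<psi> *\<^sub>R hat Y h + \<psi> (coset h) *\<^sub>R dd h (hat X h) (hat Y)"
      using dd_bilinear[OF bounded_bilinear_scaleR sp s[OF that(3)] h]
        tv_eq_dd[OF that(1) h] vector_field_tv[OF that(2) h] by simp
    then show "hat (?D X (\<lambda>p. \<psi> p *\<^sub>R Y p)) h = hat (\<lambda>p. X p \<psi> *\<^sub>R Y p + \<psi> p *\<^sub>R ?D X Y p) h"
      using that h D vector_field_scaleR comb(2)[OF h]
        lam_linear_right[of l1 l2 l3 "hat X h" "\<psi> (coset h)" "hat Y h" 0 0]
      by (simp add: conn_def scaleR_add_right)
  qed
  have 5: "?D X Y - ?D Y X = lie_bracket X Y" if "X \<in> vector_fields" "Y \<in> vector_fields" for X Y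
  proof
    fix p show "(?D X Y - ?D Y X) p = lie_bracket X Y p"
    proof (cases "p \<in> M")
      case True
      then obtain h where h: "h \<in> SU3" "p = coset h" by (rule M_cases)
      have "(?D X Y - ?D Y X) (coset h) = tv h (Dm (?C X Y h - ?C Y X h))"
        using vector_field_tv[OF D(1)[OF that] h(1)] vector_field_tv[OF D(1)[OF that(2,1)] h(1)] D that h
        by (simp add: tv_Dm_diff)
      also have "?C X Y h - ?C Y X h = dd h (hat X h) (hat Y) - dd h (hat Y h) (hat X) + bracket (hat X h) (hat Y h)"
        using lam_torsion[OF l, of "hat X h" "hat Y h"] by (simp add: conn_def algebra_simps)
      finally show ?thesis unfolding h(2) lie_bracket_tv[OF that h(1)] .
    next
      case False
      then show ?thesis
        using that D by (simp add: vector_field_off_M lie_bracket_def fun_eq_iff)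
    qed
  qed
  have 6: "X p (\<lambda>q. g q (Y q) (Z q)) = g p (?D X Y p) (Z p) + g p (Y p) (?D X Z p)"
    if "X \<in> vector_fields" "Y \<in> vector_fields" "Z \<in> vector_fields" "p \<in> M" for X Y Z p
  proof -
    obtain h where h: "h \<in> SU3" "p = coset h" using \<open>p \<in> M\<close> by (rule M_cases)
    let ?m = "metric_coord l1 l2 l3"
    have gm: "g (coset k) (Y (coset k)) (Z (coset k)) = ?m (hat Y k) (hat Z k)"
      if "k \<in> SU3" "Y \<in> vector_fields" "Z \<in> vector_fields" for k Y Z
      using g that vector_field_tv by (simp add: metric_is_def)
    have sm: "smooth_lift (\<lambda>h. ?m (hat Y h) (hat Z h))"
      by (intro smooth_lift_bilinear[OF bounded_bilinear_metric_coord] s that)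
    have sg: "(\<lambda>q. g q (Y q) (Z q)) \<in> smooth_M"
      unfolding smooth_M_iff_lift by (rule smooth_lift_cong[OF sm]) (simp add: gm that)
    have "X p (\<lambda>q. g q (Y q) (Z q)) = dd h (hat X h) (\<lambda>h. g (coset h) (Y (coset h)) (Z (coset h)))"
      using tv_eq_dd[OF sg h(1)] vector_field_tv[OF that(1) h(1)] h(2) by simp
    also have "\<dots> = dd h (hat X h) (\<lambda>h. ?m (hat Y h) (hat Z h))"
      by (rule dd_cong[OF sm h(1)]) (simp add: gm that)
    also have "\<dots> = ?m (dd h (hat X h) (hat Y)) (hat Z h) + ?m (hat Y h) (dd h (hat X h) (hat Z))"
      by (rule dd_bilinear[OF bounded_bilinear_metric_coord s s h(1)]) fact+
    also have "\<dots> = ?m (?C X Y h) (hat Z h) + ?m (hat Y h) (?C X Z h)"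
      using lam_metric[OF l, of "hat X h" "hat Y h" "hat Z h"]
      by (simp add: conn_def bounded_bilinear.add_left[OF bounded_bilinear_metric_coord]
          bounded_bilinear.add_right[OF bounded_bilinear_metric_coord])
    also have "\<dots> = g p (?D X Y p) (Z p) + g p (Y p) (?D X Z p)"
      using gm[OF h(1)] D that h by simp
    finally show ?thesis .
  qed
  show ?thesis
    unfolding levi_civita_def
    by (intro conjI ballI allI 1 2 3 4 5 6 D(1))
qed

section \<open>Uniqueness of the Levi-Civita connection\<close>

lemma levi_civitaD:
  assumes "levi_civita g D" "X \<in> vector_fields" "Y \<in> vector_fields"
  shows "D X Y \<in> vector_fields" "D X Y - D Y X = lie_bracket X Y"
    "Z \<in> vector_fields \<Longrightarrow> p \<in> M \<Longrightarrow>
      X p (\<lambda>q. g q (Y q) (Z q)) = g p (D X Y p) (Z p) + g p (Y p) (D X Z p)"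
  using assms(1)[unfolded levi_civita_def, THEN conjunct1]
    assms(1)[unfolded levi_civita_def, THEN conjunct2, THEN conjunct2, THEN conjunct2, THEN conjunct2, THEN conjunct2]
    assms(2,3)
  by simp_all

lemma riemannian_metricD:
  assumes "riemannian_metric g" "p \<in> M" "u \<in> tangent_space p"
  shows "v \<in> tangent_space p \<Longrightarrow> w \<in> tangent_space p \<Longrightarrow>
      g p (a *\<^sub>R u + b *\<^sub>R v) w = a * g p u w + b * g p v w"
    "v \<in> tangent_space p \<Longrightarrow> g p u v = g p v u" "u \<noteq> 0 \<Longrightarrow> g p u u > 0"
  using assms(1)[unfolded riemannian_metric_def, THEN conjunct1]
    assms(1)[unfolded riemannian_metric_def, THEN conjunct2, THEN conjunct1]
    assms(1)[unfolded riemannian_metric_def, THEN conjunct2, THEN conjunct2, THEN conjunct1]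
    assms(2,3)
  by simp_all

lemma levi_civita_unique:
  assumes g: "riemannian_metric g" and D: "levi_civita g D" and E: "levi_civita g E"
    and X: "X \<in> vector_fields" and Y: "Y \<in> vector_fields"
  shows "D X Y = E X Y"
proof -
  (* S is symmetric and S(X, -) is skew, so g(S(X,Y), Z) = - g(S(X,Y), Z); take Z = S(X,Y). *)
  define S where "S X Y = D X Y - E X Y" for X Y
  have cl: "D X Y \<in> vector_fields" "E X Y \<in> vector_fields" if "X \<in> vector_fields" "Y \<in> vector_fields" for X Y
    using levi_civitaD(1)[OF D] levi_civitaD(1)[OF E] that by auto
  have S: "S X Y \<in> vector_fields" if "X \<in> vector_fields" "Y \<in> vector_fields" for X Y
    unfolding S_def by (intro vector_field_diff cl that)
  have tan: "X p \<in> tangent_space p" if "X \<in> vector_fields" "p \<in> M" for X p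
    using that by (auto simp: vector_fields_def)
  have sym: "S X Y = S Y X" if "X \<in> vector_fields" "Y \<in> vector_fields" for X Y
  proof -
    have "D X Y - D Y X = lie_bracket X Y" "E X Y - E Y X = lie_bracket X Y"
      using levi_civitaD(2)[OF D that] levi_civitaD(2)[OF E that] .
    then show ?thesis unfolding S_def by (simp add: algebra_simps)
  qed
  have gsym: "g p u v = g p v u" if "p \<in> M" "u \<in> tangent_space p" "v \<in> tangent_space p" for p u v
    by (rule riemannian_metricD(2)[OF g that])
  have glin: "g p (u - v) w = g p u w - g p v w"
    if "p \<in> M" "u \<in> tangent_space p" "v \<in> tangent_space p" "w \<in> tangent_space p" for p u v w
  proof -
    have "g p (1 *\<^sub>R u + (-1) *\<^sub>R v) w = 1 * g p u w + (-1) * g p v w"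
      by (rule riemannian_metricD(1)[OF g that])
    then show ?thesis by simp
  qed
  have skew: "g p (S X Y p) (Z p) = - g p (S X Z p) (Y p)"
    if "X \<in> vector_fields" "Y \<in> vector_fields" "Z \<in> vector_fields" "p \<in> M" for X Y Z p
  proof -
    have "X p (\<lambda>q. g q (Y q) (Z q)) = g p (D X Y p) (Z p) + g p (Y p) (D X Z p)"
      "X p (\<lambda>q. g q (Y q) (Z q)) = g p (E X Y p) (Z p) + g p (Y p) (E X Z p)"
      by (rule levi_civitaD(3)[OF D that] levi_civitaD(3)[OF E that])+
    moreover have "g p (Y p) (D X Z p) = g p (D X Z p) (Y p)" "g p (Y p) (E X Z p) = g p (E X Z p) (Y p)"
      using that by (intro gsym tan cl; simp)+
    ultimately show ?thesis
      unfolding S_def using that by (simp add: glin tan cl)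
  qed
  have "S X Y p = 0" if p: "p \<in> M" for p
  proof (rule ccontr)
    assume "S X Y p \<noteq> 0"
    then have pos: "g p (S X Y p) (S X Y p) > 0"
      by (rule riemannian_metricD(3)[OF g p tan[OF S[OF X Y] p]])
    let ?Z = "S X Y"
    have Z: "?Z \<in> vector_fields" by (rule S[OF X Y])
    have "g p (S X Y p) (?Z p) = - g p (S X ?Z p) (Y p)" by (rule skew[OF X Y Z p])
    also have "\<dots> = - g p (S ?Z X p) (Y p)" by (simp only: sym[OF X Z])
    also have "\<dots> = g p (S ?Z Y p) (X p)" using skew[OF Z X Y p] by simp
    also have "\<dots> = g p (S Y ?Z p) (X p)" by (simp only: sym[OF Z Y])
    also have "\<dots> = - g p (S Y X p) (?Z p)" using skew[OF Y Z X p] by simp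
    also have "\<dots> = - g p (S X Y p) (?Z p)" by (simp only: sym[OF X Y])
    finally have "g p (S X Y p) (?Z p) = 0" by simp
    then show False using pos by simp
  qed
  moreover have "S X Y p = 0" if "p \<notin> M" for p by (rule vector_field_off_M[OF S[OF X Y] that])
  ultimately have "S X Y = 0" by (auto simp: fun_eq_iff)
  then show ?thesis by (simp add: S_def)
qed

lemma riemannian_metric_is:
  assumes l: "l1 > 0" "l2 > 0" "l3 > 0" and g: "metric_is g l1 l2 l3"
  shows "riemannian_metric g"
proof -
  let ?m = "metric_coord l1 l2 l3"
  have g': "g (coset h) (tv h (Dm x)) (tv h (Dm y)) = ?m x y" if "h \<in> SU3" for h x y
    using g that by (simp add: metric_is_def)
  have lin: "g p (a *\<^sub>R u + b *\<^sub>R v) w = a * g p u w + b * g p v w"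
    if uvw: "p \<in> M" "u \<in> tangent_space p" "v \<in> tangent_space p" "w \<in> tangent_space p" for p u v w a b
  proof -
    obtain h where h: "h \<in> SU3" "p = coset h" using \<open>p \<in> M\<close> by (rule M_cases)
    obtain x y z where "u = tv h (Dm x)" "v = tv h (Dm y)" "w = tv h (Dm z)"
      using uvw h tangent_spaceD[OF h(1), of u] tangent_spaceD[OF h(1), of v] tangent_spaceD[OF h(1), of w] by auto
    moreover have "a *\<^sub>R tv h (Dm x) + b *\<^sub>R tv h (Dm y) = tv h (Dm (a *\<^sub>R x + b *\<^sub>R y))"
      by (simp add: tv_Dm_add tv_Dm_scaleR h)
    ultimately show ?thesis
      using h(2) by (simp add: g'[OF h(1)] metric_coord_def inner_add_left algebra_simps)
  qed
  have sym: "g p u v = g p v u" if uv: "p \<in> M" "u \<in> tangent_space p" "v \<in> tangent_space p" for p u v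
  proof -
    obtain h where h: "h \<in> SU3" "p = coset h" using \<open>p \<in> M\<close> by (rule M_cases)
    obtain x y where "u = tv h (Dm x)" "v = tv h (Dm y)"
      using uv h tangent_spaceD[OF h(1), of u] tangent_spaceD[OF h(1), of v] by auto
    then show ?thesis using h(2) by (simp add: g'[OF h(1)] metric_coord_def inner_commute)
  qed
  have pos: "g p u u > 0" if u: "p \<in> M" "u \<in> tangent_space p" "u \<noteq> 0" for p u
  proof -
    obtain h where h: "h \<in> SU3" "p = coset h" using \<open>p \<in> M\<close> by (rule M_cases)
    obtain x where x: "u = tv h (Dm x)" using u h tangent_spaceD[OF h(1), of u] by auto
    then have "x \<noteq> 0" using u(3) tv_Dm_0[OF h(1)] by auto
    then have "x $ 1 \<noteq> 0 \<or> x $ 2 \<noteq> 0 \<or> x $ 3 \<noteq> 0" by (simp add: vec_eq_iff forall_3)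
    then have "x $ 1 \<bullet> x $ 1 > 0 \<or> x $ 2 \<bullet> x $ 2 > 0 \<or> x $ 3 \<bullet> x $ 3 > 0" by simp
    moreover have "x $ 1 \<bullet> x $ 1 \<ge> 0" "x $ 2 \<bullet> x $ 2 \<ge> 0" "x $ 3 \<bullet> x $ 3 \<ge> 0" by simp_all
    ultimately have "?m x x > 0"
      unfolding metric_coord_def using l
      by (smt (verit) mult_pos_pos mult_nonneg_nonneg)
    then show ?thesis using x h(2) by (simp add: g'[OF h(1)])
  qed
  have "(\<lambda>p. g p (X p) (Y p)) \<in> smooth_M" if "X \<in> vector_fields" "Y \<in> vector_fields" for X Y
  proof -
    have "smooth_lift (\<lambda>h. ?m (hat X h) (hat Y h))"
      using equivariant_hat that
      by (intro smooth_lift_bilinear[OF bounded_bilinear_metric_coord]) (auto simp: equivariant_def)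
    then show ?thesis
      unfolding smooth_M_iff_lift
      by (rule smooth_lift_cong) (use that g' vector_field_tv in simp)
  qed
  then show ?thesis unfolding riemannian_metric_def using lin sym pos by blast
qed

text \<open>Existence makes the operator chosen by \<open>SOME\<close> satisfy the axioms, and
  uniqueness identifies it with the explicit one.\<close>

lemma nabla_hat:
  assumes l: "l1 > 0" "l2 > 0" "l3 > 0" and g: "metric_is g l1 l2 l3"
    and X: "X \<in> vector_fields" and Y: "Y \<in> vector_fields"
  shows "nabla g X Y \<in> vector_fields" "h \<in> SU3 \<Longrightarrow> hat (nabla g X Y) h = conn l1 l2 l3 X Y h"
proof -
  note LC = levi_civita_conn[OF l g]
  have "levi_civita g (nabla g)" unfolding nabla_def by (rule someI[where P = "levi_civita g", OF LC])
  from levi_civita_unique[OF riemannian_metric_is[OF l g] this LC X Y]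
  have eq: "nabla g X Y = field_of (conn l1 l2 l3 X Y)" .
  show "nabla g X Y \<in> vector_fields"
    unfolding eq by (rule field_of_vector_field[OF equivariant_conn[OF X Y]])
  show "hat (nabla g X Y) h = conn l1 l2 l3 X Y h" if "h \<in> SU3"
    unfolding eq by (rule hat_field_of[OF equivariant_conn[OF X Y] that])
qed

section \<open>Invariant metrics and invariant f-structures\<close>

lemma rot_diag3: "rot (diag3 a b c) y = vector [a * cnj b * y $ 1, b * cnj c * y $ 2, c * cnj a * y $ 3]"
  by (simp add: rot_def diag3_def)

text \<open>Witnesses for the torus arguments below. On the three summands of m the first acts by
  the signs +, -, - and the second by -, +, -, which tells any two summands apart. The third
  multiplies the first two summands by the imaginary unit, and the fourth does so on the third
  summand.\<close>

lemma diag3_in_Tmax: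
  "diag3 (-1) (-1) 1 \<in> Tmax" "diag3 1 (-1) (-1) \<in> Tmax" "diag3 \<i> 1 (-\<i>) \<in> Tmax" "diag3 (-\<i>) \<i> 1 \<in> Tmax"
  unfolding Tmax_iff by (rule exI, rule exI, rule exI, rule conjI[OF refl], simp)+

lemma push_Tmax:
  assumes "t \<in> Tmax"
  shows "push t (tv (mat 1) (Dm x)) = tv (mat 1) (Dm (rot t x))" "translate t (coset (mat 1)) = coset (mat 1)"
  using assms Tmax_subset push_tv[of t "mat 1" x] tv_mult_Tmax[OF SU3_one assms, of x] coset_mult_Tmax[OF SU3_one assms]
  by (auto simp: matrix_mul_lid matrix_mul_rid translate_coset subset_iff)

lemma push_from_base:
  assumes "h \<in> SU3"
  shows "push h (tv (mat 1) (Dm x)) = tv h (Dm x)" "translate h (coset (mat 1)) = coset h"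
  using push_tv[OF assms SU3_one, of x] by (simp_all add: matrix_mul_rid translate_coset)

lemma vec3_expand: "x = axis 1 (x $ 1) + axis 2 (x $ 2) + axis 3 (x $ 3)" for x :: "complex^3"
  by (simp add: vec_eq_iff forall_3 axis_def)

lemma axis_expand: "axis i z = Re z *\<^sub>R axis i 1 + Im z *\<^sub>R axis i \<i>" for i :: 3
  by (auto simp: vec_eq_iff axis_def complex_eq_iff)

lemma rot_axis:
  "rot (diag3 a b c) (axis 1 z) = axis 1 (a * cnj b * z)"
  "rot (diag3 a b c) (axis 2 z) = axis 2 (b * cnj c * z)"
  "rot (diag3 a b c) (axis 3 z) = axis 3 (c * cnj a * z)"
  by (simp_all add: rot_diag3 vec_eq_iff forall_3 axis_def)

text \<open>The three summands are pairwise inequivalent representations of the torus, and each admits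
  multiplication by \<open>\<i>\<close>; hence an invariant form is a combination of the three standard ones.\<close>

lemma invariant_form:
  fixes B :: "complex^3 \<Rightarrow> complex^3 \<Rightarrow> real"
  assumes lin: "\<And>x y z a b. B (a *\<^sub>R x + b *\<^sub>R y) z = a * B x z + b * B y z"
    and sym: "\<And>x y. B x y = B y x"
    and inv: "\<And>t x y. t \<in> Tmax \<Longrightarrow> B (rot t x) (rot t y) = B x y"
  shows "B = metric_coord (B (axis 1 1) (axis 1 1)) (B (axis 2 1) (axis 2 1)) (B (axis 3 1) (axis 3 1))"
proof (intro ext)
  fix x y
  have add: "B (x + y) z = B x z + B y z" for x y z using lin[of 1 x 1 y z] by simp
  have scale: "B (a *\<^sub>R x) z = a * B x z" for a x z using lin[of a x 0 0 z] by simp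
  have addr: "B z (x + y) = B z x + B z y" for x y z using add[of x y z] by (simp add: sym[of z])
  have scaler: "B z (a *\<^sub>R x) = a * B z x" for a x z using scale[of a x z] by (simp add: sym[of z])
  have neg: "B (axis i (- z)) w = - B (axis i z) w" for i :: 3 and z w
  proof -
    have "axis i (- z) = (-1) *\<^sub>R axis i z" by (simp add: vec_eq_iff axis_def)
    then show ?thesis using scale[of "-1"] by simp
  qed
  have negr: "B w (axis i (- z)) = - B w (axis i z)" for i :: 3 and z w
    using neg[of i z w] by (simp add: sym[of w])
  have orth: "B (axis 1 z) (axis 2 w) = 0" "B (axis 1 z) (axis 3 w) = 0" "B (axis 2 z) (axis 3 w) = 0" for z w
    using inv[OF diag3_in_Tmax(1), of "axis 1 z" "axis 2 w"] inv[OF diag3_in_Tmax(1), of "axis 1 z" "axis 3 w"]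
      inv[OF diag3_in_Tmax(2), of "axis 2 z" "axis 3 w"]
    by (simp_all add: rot_axis neg negr)
  have orth': "B (axis 2 z) (axis 1 w) = 0" "B (axis 3 z) (axis 1 w) = 0" "B (axis 3 z) (axis 2 w) = 0" for z w
    using orth by (simp_all add: sym[of "axis 2 z" "axis 1 w"] sym[of "axis 3 z"])
  have I: "B (axis i (\<i> * z)) (axis i (\<i> * w)) = B (axis i z) (axis i w)" for i :: 3 and z w
    using exhaust_3[of i] inv[OF diag3_in_Tmax(3), of "axis 1 z" "axis 1 w"]
      inv[OF diag3_in_Tmax(3), of "axis 2 z" "axis 2 w"] inv[OF diag3_in_Tmax(4), of "axis 3 z" "axis 3 w"]
    by (elim disjE) (simp_all add: rot_axis)
  have diag: "B (axis i z) (axis i w) = B (axis i 1) (axis i 1) * (z \<bullet> w)" for i :: 3 and z w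
  proof -
    have 1: "B (axis i \<i>) (axis i \<i>) = B (axis i 1) (axis i 1)" using I[of i 1 1] by simp
    \<comment> \<open>Invariance makes the mixed value equal to minus its transpose, while symmetry
      makes it equal to its transpose.\<close>
    have 2: "B (axis i 1) (axis i \<i>) = 0" using I[of i 1 \<i>] by (simp add: negr sym[of "axis i \<i>"])
    show ?thesis
      unfolding axis_expand[of i z] axis_expand[of i w]
      by (simp add: add addr scale scaler 1 2 sym[of "axis i \<i>" "axis i 1"] inner_complex_def algebra_simps)
  qed
  show "B x y = metric_coord (B (axis 1 1) (axis 1 1)) (B (axis 2 1) (axis 2 1)) (B (axis 3 1) (axis 3 1)) x y"
    by (subst vec3_expand[of x], subst vec3_expand[of y])
      (simp add: add addr orth orth' diag[of _ "x $ _" "y $ _"] metric_coord_def)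
qed

text \<open>Isotropy invariance determines the form at the base point. Left translation leaves the
  coordinates unchanged, by \<open>push_tv\<close>, and so spreads the same form over M.\<close>

lemma invariant_metric_iff:
  "invariant_metric g \<longleftrightarrow> (\<exists>l1>0. \<exists>l2>0. \<exists>l3>0. metric_is g l1 l2 l3)"
proof
  assume g: "invariant_metric g"
  then have r: "riemannian_metric g" by (simp add: invariant_metric_def)
  have inv: "g (translate h p) (push h u) (push h v) = g p u v"
    if "h \<in> SU3" "p \<in> M" "u \<in> tangent_space p" "v \<in> tangent_space p" for h p u v
    using g that by (simp add: invariant_metric_def)
  define B where "B x y = g (coset (mat 1)) (tv (mat 1) (Dm x)) (tv (mat 1) (Dm y))" for x y
  have M1: "coset (mat 1) \<in> M" by (simp add: coset_in_M)
  note T = tangent_spaceI[OF SU3_one]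
  have eq: "B = metric_coord (B (axis 1 1) (axis 1 1)) (B (axis 2 1) (axis 2 1)) (B (axis 3 1) (axis 3 1))"
  proof (rule invariant_form)
    show "B (a *\<^sub>R x + b *\<^sub>R y) z = a * B x z + b * B y z" for x y z a b
      unfolding B_def by (simp add: tv_Dm_add tv_Dm_scaleR riemannian_metricD(1)[OF r M1 T T T])
    show "B x y = B y x" for x y
      unfolding B_def by (rule riemannian_metricD(2)[OF r M1 T T])
    show "B (rot t x) (rot t y) = B x y" if "t \<in> Tmax" for t x y
      unfolding B_def push_Tmax(1)[OF that, symmetric]
      using inv[OF _ M1 T T, of t x y] push_Tmax(2)[OF that] that Tmax_subset by (simp add: subset_iff)
  qed
  have pos: "B (axis i 1) (axis i 1) > 0" for i
    unfolding B_def
  proof (rule riemannian_metricD(3)[OF r M1 T])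
    have "axis i 1 \<noteq> (0 :: complex^3)" by (simp add: axis_eq_0_iff)
    then show "tv (mat 1) (Dm (axis i 1)) \<noteq> 0"
      using tv_Dm_inject[OF SU3_one, of "axis i 1" 0] tv_Dm_0[OF SU3_one] by simp
  qed
  have "metric_is g (B (axis 1 1) (axis 1 1)) (B (axis 2 1) (axis 2 1)) (B (axis 3 1) (axis 3 1))"
    unfolding metric_is_def
  proof (intro ballI allI)
    fix h x y assume h: "h \<in> SU3"
    have "g (coset h) (tv h (Dm x)) (tv h (Dm y)) = B x y"
      unfolding B_def push_from_base(1)[OF h, symmetric] push_from_base(2)[OF h, symmetric]
      by (rule inv[OF h M1 T T])
    then show "g (coset h) (tv h (Dm x)) (tv h (Dm y)) =
        metric_coord (B (axis 1 1) (axis 1 1)) (B (axis 2 1) (axis 2 1)) (B (axis 3 1) (axis 3 1)) x y"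
      by (metis eq)
  qed
  then show "\<exists>l1>0. \<exists>l2>0. \<exists>l3>0. metric_is g l1 l2 l3" using pos by blast
next
  assume "\<exists>l1>0. \<exists>l2>0. \<exists>l3>0. metric_is g l1 l2 l3"
  then obtain l1 l2 l3 where l: "l1 > 0" "l2 > 0" "l3 > 0" and g: "metric_is g l1 l2 l3" by blast
  have "g (translate h p) (push h u) (push h v) = g p u v"
    if h: "h \<in> SU3" and p: "p \<in> M" and uv: "u \<in> tangent_space p" "v \<in> tangent_space p" for h p u v
  proof -
    obtain k where k: "k \<in> SU3" "p = coset k" using p by (rule M_cases)
    obtain x y where "u = tv k (Dm x)" "v = tv k (Dm y)"
      using uv k tangent_spaceD[OF k(1), of u] tangent_spaceD[OF k(1), of v] by auto
    then show ?thesis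
      using g k h SU3_mult[OF h k(1)] by (simp add: push_tv translate_coset metric_is_def)
  qed
  then show "invariant_metric g"
    using riemannian_metric_is[OF l g] by (simp add: invariant_metric_def)
qed

lemma homothetic_iff:
  "homothetic g (inv_metric l1 l2 l3) \<longleftrightarrow> (\<exists>r>0. metric_is g (r * l1) (r * l2) (r * l3))"
proof -
  have m: "r * metric_coord l1 l2 l3 x y = metric_coord (r * l1) (r * l2) (r * l3) x y" for r x y
    by (simp add: metric_coord_def algebra_simps)
  have "(\<forall>p\<in>M. \<forall>u\<in>tangent_space p. \<forall>v\<in>tangent_space p. g p u v = r * inv_metric l1 l2 l3 p u v) \<longleftrightarrow>
      metric_is g (r * l1) (r * l2) (r * l3)" for r
    unfolding M_def metric_is_def
    by (simp add: tangent_space_coset inv_metric_tv m cong: ball_cong)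
  then show ?thesis by (simp add: homothetic_def)
qed

section \<open>Classification of invariant f-structures and their ranks\<close>

definition f_is :: "endo_field \<Rightarrow> int \<Rightarrow> int \<Rightarrow> int \<Rightarrow> bool"
  where "f_is f z1 z2 z3 \<longleftrightarrow> (\<forall>h\<in>SU3. \<forall>y. f (coset h) (tv h (Dm y)) = tv h (Dm (f_coord z1 z2 z3 y)))"

lemma eq_up_to_sign_iff:
  "eq_up_to_sign f (inv_f z1 z2 z3) \<longleftrightarrow> f_is f z1 z2 z3 \<or> f_is f (- z1) (- z2) (- z3)"
proof -
  have m: "f_coord (- z1) (- z2) (- z3) y = - f_coord z1 z2 z3 y" for y
    by (simp add: f_coord_def vec_eq_iff forall_3)
  have 1: "(\<forall>p\<in>M. \<forall>v\<in>tangent_space p. f p v = inv_f z1 z2 z3 p v) \<longleftrightarrow> f_is f z1 z2 z3"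
    unfolding M_def f_is_def by (simp add: tangent_space_coset inv_f_tv cong: ball_cong)
  have 2: "(\<forall>p\<in>M. \<forall>v\<in>tangent_space p. f p v = - inv_f z1 z2 z3 p v) \<longleftrightarrow> f_is f (- z1) (- z2) (- z3)"
    unfolding M_def f_is_def by (simp add: tangent_space_coset inv_f_tv m tv_Dm_minus cong: ball_cong)
  show ?thesis unfolding eq_up_to_sign_def 1 2 ..
qed

lemma linear_f_coord: "linear (f_coord z1 z2 z3)"
  by (intro linearI) (simp_all add: f_coord_def vec_eq_iff forall_3 algebra_simps)

lemma cube_root_minus: "c = 0 \<or> c = \<i> \<or> c = - \<i>" if "c * c * c + c = 0" for c :: complex
proof -
  have "c * ((c - \<i>) * (c + \<i>)) = 0" using that by (simp add: algebra_simps)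
  then have "c = 0 \<or> c - \<i> = 0 \<or> c + \<i> = 0" by simp
  then show ?thesis by (auto simp: eq_neg_iff_add_eq_0)
qed

text \<open>The sign elements of the torus force F to preserve each summand, and the elements acting
  by the imaginary unit force it to be complex linear there. So F multiplies each summand by a
  complex number c with \<open>c * c * c + c = 0\<close>.\<close>

lemma invariant_endomorphism:
  fixes F :: "complex^3 \<Rightarrow> complex^3"
  assumes lin: "linear F" and inv: "\<And>t x. t \<in> Tmax \<Longrightarrow> F (rot t x) = rot t (F x)"
    and cube: "\<And>x. F (F (F x)) + F x = 0"
  shows "\<exists>z1\<in>{-1,0,1}. \<exists>z2\<in>{-1,0,1}. \<exists>z3\<in>{-1,0,1}. F = f_coord z1 z2 z3"
proof -
  have neg: "F (axis i (- z)) = - F (axis i z)" for i :: 3 and z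
  proof -
    have "axis i (- z) = - axis i z" by (simp add: vec_eq_iff axis_def)
    then show ?thesis using linear_neg[OF lin, of "axis i z"] by simp
  qed
  have off: "F (axis i z) $ j = 0" if "i \<noteq> j" for i j :: 3 and z
    using that exhaust_3[of i] exhaust_3[of j]
      arg_cong[OF inv[OF diag3_in_Tmax(1), of "axis 1 z"], of "\<lambda>v. v $ j"]
      arg_cong[OF inv[OF diag3_in_Tmax(2), of "axis 2 z"], of "\<lambda>v. v $ j"]
      arg_cong[OF inv[OF diag3_in_Tmax(1), of "axis 2 z"], of "\<lambda>v. v $ j"]
      arg_cong[OF inv[OF diag3_in_Tmax(1), of "axis 3 z"], of "\<lambda>v. v $ j"]
      arg_cong[OF inv[OF diag3_in_Tmax(2), of "axis 3 z"], of "\<lambda>v. v $ j"]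
    by (elim disjE) (simp_all add: rot_axis, simp_all add: rot_diag3 neg)
  have I: "F (axis i \<i>) $ i = \<i> * F (axis i 1) $ i" for i :: 3
    using exhaust_3[of i] 
      arg_cong[OF inv[OF diag3_in_Tmax(3), of "axis 1 1"], of "\<lambda>v. v $ 1"]
      arg_cong[OF inv[OF diag3_in_Tmax(3), of "axis 2 1"], of "\<lambda>v. v $ 2"]
      arg_cong[OF inv[OF diag3_in_Tmax(4), of "axis 3 1"], of "\<lambda>v. v $ 3"]
    by (elim disjE) (simp_all add: rot_axis, simp_all add: rot_diag3)
  define c where "c i = F (axis i 1) $ i" for i
  have on: "F (axis i z) $ i = c i * z" for i :: 3 and z
  proof -
    have "F (axis i z) = Re z *\<^sub>R F (axis i 1) + Im z *\<^sub>R F (axis i \<i>)"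
      by (subst axis_expand) (simp only: linear_add[OF lin] linear_cmul[OF lin])
    then have "F (axis i z) $ i = of_real (Re z) * c i + of_real (Im z) * (\<i> * c i)"
      unfolding c_def by (simp only: vector_add_component vector_scaleR_component I
          scaleR_conv_of_real[where 'a = complex])
    also have "\<dots> = c i * (of_real (Re z) + \<i> * of_real (Im z))" by (simp add: algebra_simps)
    also have "\<dots> = c i * z" by (simp flip: complex_eq)
    finally show ?thesis .
  qed
  have Fx: "F x $ i = c i * x $ i" for x i
  proof -
    have "F x = F (axis 1 (x $ 1)) + F (axis 2 (x $ 2)) + F (axis 3 (x $ 3))"
      by (subst vec3_expand[of x]) (simp add: linear_add[OF lin])
    then show ?thesis using exhaust_3[of i] by (elim disjE) (simp_all add: off on)
  qed
  have cc: "\<exists>z\<in>{-1,0,1::int}. c i = of_int z * \<i>" for i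
  proof -
    have "c i * c i * c i + c i = 0"
      using arg_cong[OF cube[of "axis i 1"], of "\<lambda>v. v $ i"] by (simp add: Fx axis_def mult.assoc)
    from cube_root_minus[OF this] show ?thesis by auto
  qed
  obtain z1 z2 z3 where z: "z1 \<in> {-1,0,1::int}" "z2 \<in> {-1,0,1::int}" "z3 \<in> {-1,0,1::int}"
    "c 1 = of_int z1 * \<i>" "c 2 = of_int z2 * \<i>" "c 3 = of_int z3 * \<i>"
    using cc[of 1] cc[of 2] cc[of 3] by blast
  have "F = f_coord z1 z2 z3"
    by (rule ext) (simp add: vec_eq_iff forall_3 Fx z f_coord_def)
  then show ?thesis using z(1-3) by blast
qed

lemma f_structureD:
  assumes "f_structure f" "p \<in> M" "u \<in> tangent_space p"
  shows "f p u \<in> tangent_space p" "f p (f p (f p u)) + f p u = 0"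
    "v \<in> tangent_space p \<Longrightarrow> f p (a *\<^sub>R u + b *\<^sub>R v) = a *\<^sub>R f p u + b *\<^sub>R f p v"
  using assms(1)[unfolded f_structure_def tensor_field_11_def, THEN conjunct2]
    assms(1)[unfolded f_structure_def tensor_field_11_def, THEN conjunct1, THEN conjunct1]
    assms(1)[unfolded f_structure_def tensor_field_11_def, THEN conjunct1, THEN conjunct2, THEN conjunct1]
    assms(2,3)
  by simp_all

lemma invariant_f_structureD:
  assumes f: "invariant_f_structure f"
  shows "\<exists>z1\<in>{-1,0,1}. \<exists>z2\<in>{-1,0,1}. \<exists>z3\<in>{-1,0,1}. f_is f z1 z2 z3"
proof -
  have fs: "f_structure f" using f by (simp add: invariant_f_structure_def)
  have inv: "f (translate h p) (push h v) = push h (f p v)"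
    if "h \<in> SU3" "p \<in> M" "v \<in> tangent_space p" for h p v
    using f that by (simp add: invariant_f_structure_def)
  let ?o = "coset (mat 1)" and ?T = "\<lambda>x. tv (mat 1) (Dm x)"
  have M1: "?o \<in> M" by (simp add: coset_in_M)
  note T = tangent_spaceI[OF SU3_one]
  have "\<exists>y. f ?o (?T x) = ?T y" for x
    by (rule tangent_spaceD[OF SU3_one f_structureD(1)[OF fs M1 T]])
  then obtain F where F: "\<And>x. f ?o (?T x) = ?T (F x)" by metis
  have inj: "?T x = ?T y \<Longrightarrow> x = y" for x y using tv_Dm_inject[OF SU3_one] by blast
  have comb: "?T (a *\<^sub>R x + b *\<^sub>R y) = a *\<^sub>R ?T x + b *\<^sub>R ?T y" for a b x y
    by (simp add: tv_Dm_add tv_Dm_scaleR)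
  have lc: "F (a *\<^sub>R x + b *\<^sub>R y) = a *\<^sub>R F x + b *\<^sub>R F y" for a b x y
    by (rule inj) (simp add: F[symmetric] comb f_structureD(3)[OF fs M1 T T])
  have lin: "linear F"
    using lc[of 1 _ 1 _] lc[of _ _ 0 0] by (intro linearI) simp_all
  have "\<exists>z1\<in>{-1,0,1}. \<exists>z2\<in>{-1,0,1}. \<exists>z3\<in>{-1,0,1}. F = f_coord z1 z2 z3"
  proof (rule invariant_endomorphism[OF lin])
    show "F (rot t x) = rot t (F x)" if t: "t \<in> Tmax" for t x
    proof (rule inj)
      have "f (translate t ?o) (push t (?T x)) = push t (f ?o (?T x))"
        using inv[OF _ M1 T, of t x] t Tmax_subset by blast
      then show "?T (F (rot t x)) = ?T (rot t (F x))"
        by (simp add: F push_Tmax[OF t])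
    qed
    show "F (F (F x)) + F x = 0" for x
      by (rule inj) (use f_structureD(2)[OF fs M1 T, of x] in \<open>simp add: F tv_Dm_add tv_Dm_0\<close>)
  qed
  then obtain z1 z2 z3 where z: "z1 \<in> {-1,0,1}" "z2 \<in> {-1,0,1}" "z3 \<in> {-1,0,1}" "F = f_coord z1 z2 z3" by blast
  have "f_is f z1 z2 z3"
    unfolding f_is_def
  proof (intro ballI allI)
    fix h y assume h: "h \<in> SU3"
    have "f (translate h ?o) (push h (?T y)) = push h (f ?o (?T y))" by (rule inv[OF h M1 T])
    then show "f (coset h) (tv h (Dm y)) = tv h (Dm (f_coord z1 z2 z3 y))"
      by (simp add: F push_from_base[OF h] z(4))
  qed
  then show ?thesis using z by blast
qed

lemma invariant_f_structure_cases:
  assumes "invariant_f_structure f"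
  obtains z1 z2 z3 where "z1 \<in> {-1,0,1}" "z2 \<in> {-1,0,1}" "z3 \<in> {-1,0,1}" "f_is f z1 z2 z3"
  using invariant_f_structureD[OF assms] by (elim bexE) (rule that)

lemma smooth_lift_f_coord: "smooth_lift Y \<Longrightarrow> smooth_lift (\<lambda>h. f_coord z1 z2 z3 (Y h))"
  unfolding f_coord_def by (intro smooth_lift_intros)

text \<open>\<open>f_coord\<close> commutes with \<open>rot\<close>, so it maps equivariant
  functions to equivariant ones. This also supplies the smoothness clause of
  \<open>tensor_field_11\<close>.\<close>

lemma hat_app:
  assumes f: "f_is f z1 z2 z3" and X: "X \<in> vector_fields"
  shows "app f X \<in> vector_fields" "h \<in> SU3 \<Longrightarrow> hat (app f X) h = f_coord z1 z2 z3 (hat X h)"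
proof -
  let ?Y = "\<lambda>h. f_coord z1 z2 z3 (hat X h)"
  have Y: "equivariant ?Y"
    using equivariant_hat[OF X] unfolding equivariant_def
    by (simp add: smooth_lift_f_coord f_coord_rot[symmetric])
  have "app f X p = field_of ?Y p" for p
  proof (cases "p \<in> M")
    case True
    then obtain h where h: "h \<in> SU3" "p = coset h" by (rule M_cases)
    then show ?thesis
      using f True by (simp add: app_def field_of_coset[OF Y] vector_field_tv[OF X] f_is_def)
  qed (simp add: app_def field_of_def)
  then have eq: "app f X = field_of ?Y" by blast
  show "app f X \<in> vector_fields" unfolding eq by (rule field_of_vector_field[OF Y])
  show "hat (app f X) h = f_coord z1 z2 z3 (hat X h)" if "h \<in> SU3"
    unfolding eq by (rule hat_field_of[OF Y that])
qed

lemma f_coord_cube: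
  assumes "z1 \<in> {-1,0,1}" "z2 \<in> {-1,0,1}" "z3 \<in> {-1,0,1}"
  shows "f_coord z1 z2 z3 (f_coord z1 z2 z3 (f_coord z1 z2 z3 y)) + f_coord z1 z2 z3 y = 0"
  using assms by (auto simp: f_coord_def vec_eq_iff forall_3)

lemma f_is_invariant:
  assumes z: "z1 \<in> {-1,0,1}" "z2 \<in> {-1,0,1}" "z3 \<in> {-1,0,1}" and f: "f_is f z1 z2 z3"
  shows "invariant_f_structure f"
proof -
  let ?F = "f_coord z1 z2 z3"
  have f': "f (coset h) (tv h (Dm y)) = tv h (Dm (?F y))" if "h \<in> SU3" for h y
    using f that by (simp add: f_is_def)
  have 1: "f p v \<in> tangent_space p" "f p (f p (f p v)) + f p v = 0"
    "h \<in> SU3 \<Longrightarrow> f (translate h p) (push h v) = push h (f p v)"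
    if p: "p \<in> M" and v: "v \<in> tangent_space p" for p v h
  proof -
    obtain k where k: "k \<in> SU3" "p = coset k" using p by (rule M_cases)
    obtain x where x: "v = tv k (Dm x)" using v k tangent_spaceD[OF k(1), of v] by auto
    show "f p v \<in> tangent_space p" using k by (simp add: f' x tangent_spaceI)
    show "f p (f p (f p v)) + f p v = 0"
      using k by (simp add: f' x f_coord_cube[OF z] tv_Dm_0 flip: tv_Dm_add)
    show "f (translate h p) (push h v) = push h (f p v)" if "h \<in> SU3"
      using that k SU3_mult[OF that k(1)] by (simp add: x translate_coset push_tv f')
  qed
  have 2: "f p (a *\<^sub>R u + b *\<^sub>R v) = a *\<^sub>R f p u + b *\<^sub>R f p v"
    if p: "p \<in> M" and uv: "u \<in> tangent_space p" "v \<in> tangent_space p" for p u v a b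
  proof -
    obtain k where k: "k \<in> SU3" "p = coset k" using p by (rule M_cases)
    obtain x y where xy: "u = tv k (Dm x)" "v = tv k (Dm y)"
      using uv k tangent_spaceD[OF k(1), of u] tangent_spaceD[OF k(1), of v] by auto
    have "f p (a *\<^sub>R u + b *\<^sub>R v) = f (coset k) (tv k (Dm (a *\<^sub>R x + b *\<^sub>R y)))"
      by (simp add: xy tv_Dm_add tv_Dm_scaleR k)
    also have "\<dots> = a *\<^sub>R f p u + b *\<^sub>R f p v"
      by (subst f'[OF k(1)]) (simp only: f'[OF k(1)] k(2) xy linear_add[OF linear_f_coord] linear_cmul[OF linear_f_coord]
          tv_Dm_add[OF k(1)] tv_Dm_scaleR[OF k(1)])
    finally show ?thesis .
  qed
  show ?thesis
    unfolding invariant_f_structure_def f_structure_def tensor_field_11_def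
    using 1 2 hat_app(1)[OF f] by simp
qed

lemma range_f_coord:
  assumes "z1 \<in> {-1,0,1}" "z2 \<in> {-1,0,1}" "z3 \<in> {-1,0,1}"
  shows "range (f_coord z1 z2 z3) = {y. (z1 = 0 \<longrightarrow> y $ 1 = 0) \<and> (z2 = 0 \<longrightarrow> y $ 2 = 0) \<and> (z3 = 0 \<longrightarrow> y $ 3 = 0)}"
proof (intro equalityI subsetI)
  fix y :: "complex^3"
  assume y: "y \<in> {y. (z1 = 0 \<longrightarrow> y $ 1 = 0) \<and> (z2 = 0 \<longrightarrow> y $ 2 = 0) \<and> (z3 = 0 \<longrightarrow> y $ 3 = 0)}"
  \<comment> \<open>For z = 1 or z = -1, negating z inverts multiplication by z times the imaginary
    unit; this gives an explicit preimage.\<close>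
  have *: "of_int z * \<i> * (of_int (- z) * \<i> * w) = w" if "z \<in> {-1,0,1}" "z = 0 \<longrightarrow> w = 0" for z :: int and w
    using that by auto
  have "y = f_coord z1 z2 z3 (f_coord (- z1) (- z2) (- z3) y)"
    using y *[OF assms(1), of "y $ 1"] *[OF assms(2), of "y $ 2"] *[OF assms(3), of "y $ 3"]
    unfolding f_coord_def vec_eq_iff forall_3 vector_3 by simp
  then show "y \<in> range (f_coord z1 z2 z3)" by blast
qed (auto simp: f_coord_def)

text \<open>Tangent vectors sit in an infinite-dimensional function space, so the dimension is
  counted on a basis: each nonzero zeta contributes the two real basis vectors of its complex line,
  and an injective linear map carries them over.\<close>

lemma dim_range_f:
  assumes z: "z1 \<in> {-1,0,1}" "z2 \<in> {-1,0,1}" "z3 \<in> {-1,0,1}" and f: "f_is f z1 z2 z3" and p: "p \<in> M"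
  shows "dim (f p ` tangent_space p) = (if z1 = 0 then 0 else 2) + (if z2 = 0 then 0 else 2) + (if z3 = 0 then 0 else 2)"
proof -
  obtain h where h: "h \<in> SU3" "p = coset h" using p by (rule M_cases)
  let ?T = "\<lambda>y. tv h (Dm y)"
  define d :: "(complex^3) set" where "d = (if z1 = 0 then {} else {axis 1 1, axis 1 \<i>}) \<union>
    (if z2 = 0 then {} else {axis 2 1, axis 2 \<i>}) \<union> (if z3 = 0 then {} else {axis 3 1, axis 3 \<i>})"
  have lin: "linear ?T" by (intro linearI) (simp_all add: tv_Dm_add tv_Dm_scaleR h)
  have inj: "inj ?T" by (rule injI) (simp add: tv_Dm_inject h)
  have dB: "d \<subseteq> Basis" by (auto simp: d_def Basis_vec_def Basis_complex_def split: if_splits)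
  have "range (f_coord z1 z2 z3) = span d"
    unfolding range_f_coord[OF z] span_substd_basis[OF dB]
    by (auto simp: d_def Basis_vec_def Basis_complex_def inner_axis axis_eq_axis inner_complex_def complex_eq_iff
        exhaust_3 split: if_splits) (metis exhaust_3)+
  moreover have "f p ` tangent_space p = ?T ` range (f_coord z1 z2 z3)"
    unfolding h(2) tangent_space_coset[OF h(1)] image_image using f h by (simp add: f_is_def)
  ultimately have "f p ` tangent_space p = span (?T ` d)"
    by (simp add: linear_span_image[OF lin])
  moreover have "independent (?T ` d)"
    using linear_independent_injective_image[OF lin] independent_mono[OF independent_Basis dB] inj
    by (metis inj_on_subset subset_UNIV)
  ultimately have "dim (f p ` tangent_space p) = card (?T ` d)"
    by (metis dim_span_eq_card_independent)
  also have "\<dots> = card d" by (intro card_image) (metis inj inj_on_subset subset_UNIV)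
  also have "card d = (if z1 = 0 then 0 else 2) + (if z2 = 0 then 0 else 2) + (if z3 = 0 then 0 else 2)"
    by (simp add: d_def axis_eq_axis complex_eq_iff)
  finally show ?thesis .
qed

lemma has_rank_iff:
  assumes z: "z1 \<in> {-1,0,1}" "z2 \<in> {-1,0,1}" "z3 \<in> {-1,0,1}" and f: "f_is f z1 z2 z3"
  shows "has_rank f r \<longleftrightarrow> (if z1 = 0 then 0 else 2) + (if z2 = 0 then 0 else 2) + (if z3 = 0 then 0 else 2) = r"
  using dim_range_f[OF assms] coset_in_M[OF SU3_one] unfolding has_rank_def by metis

lemma metric_f_structure_is:
  assumes l: "l1 > 0" "l2 > 0" "l3 > 0" and g: "metric_is g l1 l2 l3"
    and z: "z1 \<in> {-1,0,1}" "z2 \<in> {-1,0,1}" "z3 \<in> {-1,0,1}" and f: "f_is f z1 z2 z3"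
  shows "metric_f_structure g f"
proof -
  have "g p (f p u) v + g p u (f p v) = 0"
    if p: "p \<in> M" and uv: "u \<in> tangent_space p" "v \<in> tangent_space p" for p u v
  proof -
    obtain k where k: "k \<in> SU3" "p = coset k" using p by (rule M_cases)
    obtain x y where xy: "u = tv k (Dm x)" "v = tv k (Dm y)"
      using uv k tangent_spaceD[OF k(1), of u] tangent_spaceD[OF k(1), of v] by auto
    show ?thesis
      using f g k by (simp add: xy f_is_def metric_is_def metric_coord_def f_coord_def inner_complex_def algebra_simps)
  qed
  then show ?thesis
    using riemannian_metric_is[OF l g] f_is_invariant[OF z f]
    by (simp add: metric_f_structure_def invariant_f_structure_def)
qed

section \<open>The algebraic conditions\<close>

text \<open>The vector field of the flow of left translations by a one-parameter subgroup; it serves to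
  realise every tangent vector at the base point.\<close>

definition fundamental_hat :: "complex^3 \<Rightarrow> cmat \<Rightarrow> complex^3"
  where "fundamental_hat y h = vector [(cadjoint h ** Dm y ** h) $ 1 $ 2, (cadjoint h ** Dm y ** h) $ 2 $ 3,
    - (cadjoint h ** Dm y ** h) $ 3 $ 1]"

text \<open>A constant function with nonzero value is not equivariant, so y is extended by
  conjugation with the inverse of h. Only entries of the m-part are read off, and on these the torus
  acts by scalars.\<close>

lemma vector_field_through:
  obtains X where "X \<in> vector_fields" "hat X (mat 1) = y"
proof -
  have rt: "rot t (fundamental_hat y (h ** t)) = fundamental_hat y h" if t: "t \<in> Tmax" for h t
  proof -
    obtain a b c where abc: "t = diag3 a b c" "cmod a = 1" "cmod b = 1" "cmod c = 1"
      using t Tmax_iff by auto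
    have u: "a * cnj a = 1" "b * cnj b = 1" "c * cnj c = 1"
      using abc by (simp_all flip: complex_norm_square)
    have e: "cadjoint (h ** t) ** Dm y ** (h ** t) = cadjoint t ** (cadjoint h ** Dm y ** h) ** t"
      by (simp add: cadjoint_mult matrix_mul_assoc)
    have d: "(cadjoint t ** A ** t) $ 1 $ 2 = cnj a * A $ 1 $ 2 * b" "(cadjoint t ** A ** t) $ 2 $ 3 = cnj b * A $ 2 $ 3 * c"
      "(cadjoint t ** A ** t) $ 3 $ 1 = cnj c * A $ 3 $ 1 * a" for A
      by (simp_all add: abc(1) diag3_def matrix_matrix_mult_def sum_3 cadjoint_def)
    have uu: "a * cnj b * (cnj a * w * b) = w" "b * cnj c * (cnj b * w * c) = w" "c * cnj a * - (cnj c * w * a) = - w" for w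
      using u by algebra+
    show ?thesis
      unfolding fundamental_hat_def e d unfolding rot_def abc(1) diag3_def by (simp only: vector_3 uu)
  qed
  have eq: "equivariant (fundamental_hat y)"
    unfolding equivariant_def
    by (intro conjI ballI, unfold fundamental_hat_def[abs_def], intro smooth_lift_intros,
        fold fundamental_hat_def) (rule rt)
  have "hat (field_of (fundamental_hat y)) (mat 1) = y"
    unfolding hat_field_of[OF eq SU3_one]
    by (simp add: fundamental_hat_def matrix_mul_lid matrix_mul_rid Dm_def Dmat_def vec_eq_iff forall_3)
  then show ?thesis using that field_of_vector_field[OF eq] by blast
qed

lemma bounded_linear_f_coord: "bounded_linear (f_coord z1 z2 z3)"
  using linear_f_coord by (simp add: linear_conv_bounded_linear)

lemma hat_nabla_f:
  assumes l: "l1 > 0" "l2 > 0" "l3 > 0" and g: "metric_is g l1 l2 l3" and f: "f_is f z1 z2 z3"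
    and X: "X \<in> vector_fields" and Y: "Y \<in> vector_fields"
  shows "nabla_f g f X Y \<in> vector_fields"
    "h \<in> SU3 \<Longrightarrow> hat (nabla_f g f X Y) h = lam l1 l2 l3 (hat X h) (f_coord z1 z2 z3 (hat Y h)) -
      f_coord z1 z2 z3 (lam l1 l2 l3 (hat X h) (hat Y h))"
proof -
  note n = nabla_hat[OF l g X]
  note a = hat_app[OF f]
  show "nabla_f g f X Y \<in> vector_fields"
    unfolding nabla_f_def by (intro vector_field_diff n a Y)
  assume h: "h \<in> SU3"
  have s: "smooth_lift (hat Y)" using equivariant_hat[OF Y] by (simp add: equivariant_def)
  have "dd h (hat X h) (hat (app f Y)) = dd h (hat X h) (\<lambda>h. f_coord z1 z2 z3 (hat Y h))"
    by (rule dd_cong[OF smooth_lift_f_coord[OF s] h]) (simp add: a(2)[OF Y])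
  also have "\<dots> = f_coord z1 z2 z3 (dd h (hat X h) (hat Y))"
    by (rule dd_linear[OF bounded_linear_f_coord s h])
  finally show "hat (nabla_f g f X Y) h = lam l1 l2 l3 (hat X h) (f_coord z1 z2 z3 (hat Y h)) -
      f_coord z1 z2 z3 (lam l1 l2 l3 (hat X h) (hat Y h))"
    unfolding nabla_f_def
    using h vector_field_diff(2)[OF n(1)[OF a(1)[OF Y]] a(1)[OF n(1)[OF Y]] h]
    by (simp add: n(2)[OF a(1)[OF Y]] n(2)[OF Y] a(2)[OF n(1)[OF Y]] a(2)[OF Y] conn_def
        linear_add[OF linear_f_coord])
qed

lemma vector_field_eq_0_iff:
  assumes "W \<in> vector_fields" shows "W = 0 \<longleftrightarrow> (\<forall>h\<in>SU3. hat W h = 0)"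
proof -
  have z: "0 \<in> vector_fields" "h \<in> SU3 \<Longrightarrow> hat 0 h = 0" for h
    using vector_field_diff[OF assms assms] by simp_all
  show ?thesis using vector_field_eqI[OF assms z(1)] z(2) by metis
qed

text \<open>By \<open>hat_nabla_f\<close> the covariant derivative of f is the same bilinear
  expression at every h. Fields with prescribed values at the identity give the condition for all x
  and y; conversely the condition is applied at every h.\<close>

lemma kahler_iff:
  assumes l: "l1 > 0" "l2 > 0" "l3 > 0" and g: "metric_is g l1 l2 l3"
    and z: "z1 \<in> {-1,0,1}" "z2 \<in> {-1,0,1}" "z3 \<in> {-1,0,1}" and f: "f_is f z1 z2 z3"
  shows "kahler_f_structure g f \<longleftrightarrow>
    (\<forall>x y. lam l1 l2 l3 x (f_coord z1 z2 z3 y) = f_coord z1 z2 z3 (lam l1 l2 l3 x y))"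
proof -
  note n = hat_nabla_f[OF l g f]
  have "(\<forall>X\<in>vector_fields. \<forall>Y\<in>vector_fields. nabla_f g f X Y = 0) \<longleftrightarrow>
    (\<forall>x y. lam l1 l2 l3 x (f_coord z1 z2 z3 y) = f_coord z1 z2 z3 (lam l1 l2 l3 x y))"
  proof (intro iffI allI ballI)
    fix x y assume *: "\<forall>X\<in>vector_fields. \<forall>Y\<in>vector_fields. nabla_f g f X Y = 0"
    obtain X where X: "X \<in> vector_fields" "hat X (mat 1) = x" by (rule vector_field_through)
    obtain Y where Y: "Y \<in> vector_fields" "hat Y (mat 1) = y" by (rule vector_field_through)
    have "hat (nabla_f g f X Y) (mat 1) = 0"
      using * X(1) Y(1) vector_field_eq_0_iff[OF n(1)[OF X(1) Y(1)]] SU3_one by blast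
    then show "lam l1 l2 l3 x (f_coord z1 z2 z3 y) = f_coord z1 z2 z3 (lam l1 l2 l3 x y)"
      using n(2)[OF X(1) Y(1) SU3_one] X(2) Y(2) by simp
  next
    fix X Y assume *: "\<forall>x y. lam l1 l2 l3 x (f_coord z1 z2 z3 y) = f_coord z1 z2 z3 (lam l1 l2 l3 x y)"
      and X: "X \<in> vector_fields" and Y: "Y \<in> vector_fields"
    show "nabla_f g f X Y = 0"
      unfolding vector_field_eq_0_iff[OF n(1)[OF X Y]] using n(2)[OF X Y] * by simp
  qed
  then show ?thesis
    using metric_f_structure_is[OF l g z f] by (simp add: kahler_f_structure_def)
qed

lemma nearly_kahler_iff:
  assumes l: "l1 > 0" "l2 > 0" "l3 > 0" and g: "metric_is g l1 l2 l3"
    and z: "z1 \<in> {-1,0,1}" "z2 \<in> {-1,0,1}" "z3 \<in> {-1,0,1}" and f: "f_is f z1 z2 z3"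
  shows "nearly_kahler_f_structure g f \<longleftrightarrow>
    (\<forall>x. lam l1 l2 l3 (f_coord z1 z2 z3 x) (f_coord z1 z2 z3 (f_coord z1 z2 z3 x)) =
      f_coord z1 z2 z3 (lam l1 l2 l3 (f_coord z1 z2 z3 x) (f_coord z1 z2 z3 x)))"
proof -
  let ?F = "f_coord z1 z2 z3"
  note n = hat_nabla_f[OF l g f]
  note a = hat_app[OF f]
  have "(\<forall>X\<in>vector_fields. nabla_f g f (app f X) (app f X) = 0) \<longleftrightarrow>
    (\<forall>x. lam l1 l2 l3 (?F x) (?F (?F x)) = ?F (lam l1 l2 l3 (?F x) (?F x)))"
  proof (intro iffI allI ballI)
    fix x assume *: "\<forall>X\<in>vector_fields. nabla_f g f (app f X) (app f X) = 0"
    obtain X where X: "X \<in> vector_fields" "hat X (mat 1) = x" by (rule vector_field_through)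
    have "hat (nabla_f g f (app f X) (app f X)) (mat 1) = 0"
      using * X(1) vector_field_eq_0_iff[OF n(1)[OF a(1)[OF X(1)] a(1)[OF X(1)]]] SU3_one by blast
    then show "lam l1 l2 l3 (?F x) (?F (?F x)) = ?F (lam l1 l2 l3 (?F x) (?F x))"
      using n(2)[OF a(1)[OF X(1)] a(1)[OF X(1)] SU3_one] X(2) by (simp add: a(2)[OF X(1) SU3_one])
  next
    fix X assume *: "\<forall>x. lam l1 l2 l3 (?F x) (?F (?F x)) = ?F (lam l1 l2 l3 (?F x) (?F x))"
      and X: "X \<in> vector_fields"
    show "nabla_f g f (app f X) (app f X) = 0"
      unfolding vector_field_eq_0_iff[OF n(1)[OF a(1)[OF X] a(1)[OF X]]]
      using n(2)[OF a(1)[OF X] a(1)[OF X]] a(2)[OF X] * by simp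
  qed
  then show ?thesis
    using metric_f_structure_is[OF l g z f] by (simp add: nearly_kahler_f_structure_def)
qed

text \<open>Each component of the defect contains two of the six monomials \<open>x_i * y_j\<close>,
  and pairs of unit vectors isolate them. Sums of zetas appear, not differences, because
  \<open>lam\<close> conjugates its products and conjugation flips the sign of the imaginary
  unit.\<close>

lemma kahler_algebra:
  assumes l: "l1 > 0" "l2 > 0" "l3 > 0"
  shows "(\<forall>x y. lam l1 l2 l3 x (f_coord z1 z2 z3 y) = f_coord z1 z2 z3 (lam l1 l2 l3 x y)) \<longleftrightarrow>
    (l1 + l3 - l2) * of_int (z1 + z3) = 0 \<and> (l1 - l3 + l2) * of_int (z1 + z2) = 0 \<and>
    (l2 + l1 - l3) * of_int (z2 + z1) = 0 \<and> (l2 - l1 + l3) * of_int (z2 + z3) = 0 \<and>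
    (l3 + l2 - l1) * of_int (z3 + z2) = 0 \<and> (l3 - l2 + l1) * of_int (z3 + z1) = 0"
    (is "?L \<longleftrightarrow> ?R")
proof -
  have d: "cnj ((p / (2 * l)) *\<^sub>R (u * (of_int a * \<i> * v)) - (q / (2 * l)) *\<^sub>R (w * (of_int b * \<i> * x))) -
      of_int c * \<i> * cnj ((p / (2 * l)) *\<^sub>R (u * v) - (q / (2 * l)) *\<^sub>R (w * x)) =
    cnj (\<i> * (((p * of_int (c + a)) / (2 * l)) *\<^sub>R (u * v) - ((q * of_int (c + b)) / (2 * l)) *\<^sub>R (w * x)))"
    for p q l :: real and a b c :: int and u v w x :: complex
    by (simp add: scaleR_conv_of_real field_simps add_divide_distrib)
  have diff: "lam l1 l2 l3 x (f_coord z1 z2 z3 y) - f_coord z1 z2 z3 (lam l1 l2 l3 x y) = vector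
    [cnj (\<i> * ((((l1 + l3 - l2) * of_int (z1 + z3)) / (2 * l1)) *\<^sub>R (x $ 2 * y $ 3) -
       (((l1 - l3 + l2) * of_int (z1 + z2)) / (2 * l1)) *\<^sub>R (x $ 3 * y $ 2))),
     cnj (\<i> * ((((l2 + l1 - l3) * of_int (z2 + z1)) / (2 * l2)) *\<^sub>R (x $ 3 * y $ 1) -
       (((l2 - l1 + l3) * of_int (z2 + z3)) / (2 * l2)) *\<^sub>R (x $ 1 * y $ 3))),
     cnj (\<i> * ((((l3 + l2 - l1) * of_int (z3 + z2)) / (2 * l3)) *\<^sub>R (x $ 1 * y $ 2) -
       (((l3 - l2 + l1) * of_int (z3 + z1)) / (2 * l3)) *\<^sub>R (x $ 2 * y $ 1)))]" for x y
    unfolding d[symmetric] by (simp add: lam_def f_coord_def vec_eq_iff forall_3)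
  have "?L \<longleftrightarrow> (\<forall>x y. lam l1 l2 l3 x (f_coord z1 z2 z3 y) - f_coord z1 z2 z3 (lam l1 l2 l3 x y) = 0)" by simp
  also have "\<dots> \<longleftrightarrow> ?R"
  proof
    assume *: "\<forall>x y. lam l1 l2 l3 x (f_coord z1 z2 z3 y) - f_coord z1 z2 z3 (lam l1 l2 l3 x y) = 0"
    have a: "axis i (1::complex) $ j = (if i = j then 1 else 0)" for i j :: 3 by (simp add: axis_def)
    show ?R
      using *[unfolded diff vec_eq_iff forall_3 vector_3, rule_format, of "axis 2 1" "axis 3 1"]
        *[unfolded diff vec_eq_iff forall_3 vector_3, rule_format, of "axis 3 1" "axis 2 1"]
        *[unfolded diff vec_eq_iff forall_3 vector_3, rule_format, of "axis 3 1" "axis 1 1"]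
        *[unfolded diff vec_eq_iff forall_3 vector_3, rule_format, of "axis 1 1" "axis 3 1"]
        *[unfolded diff vec_eq_iff forall_3 vector_3, rule_format, of "axis 1 1" "axis 2 1"]
        *[unfolded diff vec_eq_iff forall_3 vector_3, rule_format, of "axis 2 1" "axis 1 1"] l
      unfolding a by simp
  next
    assume ?R
    then show "\<forall>x y. lam l1 l2 l3 x (f_coord z1 z2 z3 y) - f_coord z1 z2 z3 (lam l1 l2 l3 x y) = 0"
      unfolding diff by (simp only: vec_eq_iff forall_3 vector_3) simp
  qed
  finally show ?thesis .
qed

text \<open>With both arguments built from one x, the two monomials of a component coincide. Only
  the difference of their coefficients is constrained, and only if both zetas involved are
  nonzero.\<close>

lemma nearly_kahler_algebra:
  assumes l: "l1 > 0" "l2 > 0" "l3 > 0"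
  shows "(\<forall>x. lam l1 l2 l3 (f_coord z1 z2 z3 x) (f_coord z1 z2 z3 (f_coord z1 z2 z3 x)) =
      f_coord z1 z2 z3 (lam l1 l2 l3 (f_coord z1 z2 z3 x) (f_coord z1 z2 z3 x))) \<longleftrightarrow>
    of_int (z2 * z3) * ((l1 - l3 + l2) * of_int (z1 + z2) - (l1 + l3 - l2) * of_int (z1 + z3)) = 0 \<and>
    of_int (z3 * z1) * ((l2 - l1 + l3) * of_int (z2 + z3) - (l2 + l1 - l3) * of_int (z2 + z1)) = 0 \<and>
    of_int (z1 * z2) * ((l3 - l2 + l1) * of_int (z3 + z1) - (l3 + l2 - l1) * of_int (z3 + z2)) = 0"
    (is "?L \<longleftrightarrow> ?R")
proof -
  let ?F = "f_coord z1 z2 z3"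
  have d: "cnj ((p / (2 * l)) *\<^sub>R ((of_int b * \<i> * u) * (of_int c * \<i> * (of_int c * \<i> * v))) -
      (q / (2 * l)) *\<^sub>R ((of_int c * \<i> * v) * (of_int b * \<i> * (of_int b * \<i> * u)))) -
      of_int a * \<i> * cnj ((p / (2 * l)) *\<^sub>R ((of_int b * \<i> * u) * (of_int c * \<i> * v)) -
        (q / (2 * l)) *\<^sub>R ((of_int c * \<i> * v) * (of_int b * \<i> * u))) =
    cnj (\<i> * (((of_int (b * c) * (q * of_int (a + b) - p * of_int (a + c))) / (2 * l)) *\<^sub>R (u * v)))"
    for p q l :: real and a b c :: int and u v :: complex
    by (simp add: scaleR_conv_of_real diff_divide_distrib add_divide_distrib algebra_simps)
  have diff: "lam l1 l2 l3 (?F x) (?F (?F x)) - ?F (lam l1 l2 l3 (?F x) (?F x)) = vector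
    [cnj (\<i> * (((of_int (z2 * z3) * ((l1 - l3 + l2) * of_int (z1 + z2) - (l1 + l3 - l2) * of_int (z1 + z3))) / (2 * l1)) *\<^sub>R (x $ 2 * x $ 3))),
     cnj (\<i> * (((of_int (z3 * z1) * ((l2 - l1 + l3) * of_int (z2 + z3) - (l2 + l1 - l3) * of_int (z2 + z1))) / (2 * l2)) *\<^sub>R (x $ 3 * x $ 1))),
     cnj (\<i> * (((of_int (z1 * z2) * ((l3 - l2 + l1) * of_int (z3 + z1) - (l3 + l2 - l1) * of_int (z3 + z2))) / (2 * l3)) *\<^sub>R (x $ 1 * x $ 2)))]" for x
    unfolding d[symmetric] by (simp add: lam_def f_coord_def vec_eq_iff forall_3)
  have "?L \<longleftrightarrow> (\<forall>x. lam l1 l2 l3 (?F x) (?F (?F x)) - ?F (lam l1 l2 l3 (?F x) (?F x)) = 0)" by simp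
  also have "\<dots> \<longleftrightarrow> ?R"
  proof
    assume *: "\<forall>x. lam l1 l2 l3 (?F x) (?F (?F x)) - ?F (lam l1 l2 l3 (?F x) (?F x)) = 0"
    \<comment> \<open>Each component is a multiple of a single monomial, so the vector with all
      entries 1 tests all three at once.\<close>
    show ?R
      using *[unfolded diff vec_eq_iff forall_3 vector_3, rule_format, of "vector [1, 1, 1]"] l
      unfolding vector_3 by simp
  next
    assume ?R
    then show "\<forall>x. lam l1 l2 l3 (?F x) (?F (?F x)) - ?F (lam l1 l2 l3 (?F x) (?F x)) = 0"
      unfolding diff by (simp only: vec_eq_iff forall_3 vector_3) simp
  qed
  finally show ?thesis .
qed

text \<open>Rank 6: equal zetas force \<open>l1 = l2 = l3\<close>, and the Kaehler equations then
  fail; if one zeta has the opposite sign, its metric coefficient must be the sum of the other two,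
  and then all Kaehler equations hold. Rank 4: opposite signs would make twice the coefficient of
  the inactive summand vanish; equal signs force the two active coefficients to agree, and the
  Kaehler equations fail. Rank 2: the nearly Kaehler equations are void, while the Kaehler ones
  would make a positive coefficient zero.\<close>

lemma strictly_nearly_kahler_iff:
  assumes l: "l1 > 0" "l2 > 0" "l3 > 0" and g: "metric_is g l1 l2 l3"
    and z: "z1 \<in> {-1,0,1}" "z2 \<in> {-1,0,1}" "z3 \<in> {-1,0,1}" and f: "f_is f z1 z2 z3"
  shows "z1 \<noteq> 0 \<Longrightarrow> z2 \<noteq> 0 \<Longrightarrow> z3 \<noteq> 0 \<Longrightarrow>
      strictly_nearly_kahler g f \<longleftrightarrow> z1 = z2 \<and> z2 = z3 \<and> l1 = l2 \<and> l2 = l3"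
    "z1 \<noteq> 0 \<Longrightarrow> z2 \<noteq> 0 \<Longrightarrow> z3 = 0 \<Longrightarrow> strictly_nearly_kahler g f \<longleftrightarrow> z1 = z2 \<and> l1 = l2"
    "z1 \<noteq> 0 \<Longrightarrow> z2 = 0 \<Longrightarrow> z3 \<noteq> 0 \<Longrightarrow> strictly_nearly_kahler g f \<longleftrightarrow> z1 = z3 \<and> l1 = l3"
    "z1 = 0 \<Longrightarrow> z2 \<noteq> 0 \<Longrightarrow> z3 \<noteq> 0 \<Longrightarrow> strictly_nearly_kahler g f \<longleftrightarrow> z2 = z3 \<and> l2 = l3"
    "z1 \<noteq> 0 \<Longrightarrow> z2 = 0 \<Longrightarrow> z3 = 0 \<Longrightarrow> strictly_nearly_kahler g f"
    "z1 = 0 \<Longrightarrow> z2 \<noteq> 0 \<Longrightarrow> z3 = 0 \<Longrightarrow> strictly_nearly_kahler g f"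
    "z1 = 0 \<Longrightarrow> z2 = 0 \<Longrightarrow> z3 \<noteq> 0 \<Longrightarrow> strictly_nearly_kahler g f"
  unfolding strictly_nearly_kahler_def nearly_kahler_iff[OF l g z f] kahler_iff[OF l g z f]
    kahler_algebra[OF l] nearly_kahler_algebra[OF l]
  using z l by (elim insertE emptyE; simp; linarith)+

theorem proposition3:
  shows
    "(\<forall>f g. invariant_f_structure f \<and> has_rank f 6 \<and> invariant_metric g \<and> strictly_nearly_kahler g f
       \<longleftrightarrow> eq_up_to_sign f (inv_f 1 1 1) \<and> homothetic g (inv_metric 1 1 1)) \<and>
     (\<forall>f g. invariant_f_structure f \<and> has_rank f 4 \<and> invariant_metric g \<and> strictly_nearly_kahler g f
       \<longleftrightarrow> (eq_up_to_sign f (inv_f 1 1 0) \<and> (\<exists>s>0. homothetic g (inv_metric 1 1 s))) \<or>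
           (eq_up_to_sign f (inv_f 1 0 1) \<and> (\<exists>t>0. homothetic g (inv_metric 1 t 1))) \<or>
           (eq_up_to_sign f (inv_f 0 1 1) \<and> (\<exists>t>0. homothetic g (inv_metric 1 t t)))) \<and>
     ((\<forall>f. invariant_f_structure f \<and> has_rank f 2
        \<longleftrightarrow> eq_up_to_sign f (inv_f 1 0 0) \<or> eq_up_to_sign f (inv_f 0 1 0) \<or>
            eq_up_to_sign f (inv_f 0 0 1)) \<and>
      (\<forall>g. invariant_metric g \<longleftrightarrow> (\<exists>t>0. \<exists>s>0. homothetic g (inv_metric 1 t s))) \<and>
      (\<forall>f g. invariant_f_structure f \<and> has_rank f 2 \<and> invariant_metric g
        \<longrightarrow> strictly_nearly_kahler g f))"
proof -
  let ?Z = "{-1, 0, 1::int}"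
  \<comment> \<open>Dividing by the first coefficient is the normalisation up to homothety. P
    carries a constraint on the two ratios, so that the list of all metrics and the three families
    of rank 4 are instances.\<close>
  have scale: "(\<exists>t>0. \<exists>s>0. P t s \<and> homothetic g (inv_metric 1 t s)) \<longleftrightarrow>
      (\<exists>l1>0. \<exists>l2>0. \<exists>l3>0. metric_is g l1 l2 l3 \<and> P (l2 / l1) (l3 / l1))" for P g
  proof
    assume "\<exists>t>0. \<exists>s>0. P t s \<and> homothetic g (inv_metric 1 t s)"
    then obtain t s r where "t > 0" "s > 0" "P t s" "r > 0" "metric_is g (r * 1) (r * t) (r * s)"
      unfolding homothetic_iff by blast
    then show "\<exists>l1>0. \<exists>l2>0. \<exists>l3>0. metric_is g l1 l2 l3 \<and> P (l2 / l1) (l3 / l1)"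
      by (intro exI[of _ "r * 1"] exI[of _ "r * t"] exI[of _ "r * s"] conjI) simp_all
  next
    assume "\<exists>l1>0. \<exists>l2>0. \<exists>l3>0. metric_is g l1 l2 l3 \<and> P (l2 / l1) (l3 / l1)"
    then obtain l1 l2 l3 where "l1 > 0" "l2 > 0" "l3 > 0" "metric_is g l1 l2 l3" "P (l2 / l1) (l3 / l1)" by blast
    then show "\<exists>t>0. \<exists>s>0. P t s \<and> homothetic g (inv_metric 1 t s)"
      unfolding homothetic_iff
      by (intro exI[of _ "l2 / l1"] exI[of _ "l3 / l1"] conjI exI[of _ l1]) simp_all
  qed
  have metrics: "invariant_metric g \<longleftrightarrow> (\<exists>t>0. \<exists>s>0. homothetic g (inv_metric 1 t s))" for g
    using scale[of "\<lambda>t s. True"] by (simp add: invariant_metric_iff)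
  \<comment> \<open>The sign ambiguity becomes one common factor e on the triple of zetas.\<close>
  have f_sign: "eq_up_to_sign f (inv_f z1 z2 z3) \<longleftrightarrow>
      (\<exists>e\<in>{-1, 1}. f_is f (e * z1) (e * z2) (e * z3))" for f z1 z2 z3
    by (auto simp: eq_up_to_sign_iff)
  note strict = strictly_nearly_kahler_iff
  have rank6: "invariant_f_structure f \<and> has_rank f 6 \<and> invariant_metric g \<and> strictly_nearly_kahler g f
       \<longleftrightarrow> eq_up_to_sign f (inv_f 1 1 1) \<and> homothetic g (inv_metric 1 1 1)" (is "?L \<longleftrightarrow> ?R") for f g
  proof
    assume L: ?L
    then have "invariant_f_structure f" by blast
      then obtain z1 z2 z3 where z: "z1 \<in> ?Z" "z2 \<in> ?Z" "z3 \<in> ?Z" and f: "f_is f z1 z2 z3"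
        by (rule invariant_f_structure_cases)
    obtain l1 l2 l3 where l: "l1 > 0" "l2 > 0" "l3 > 0" and g: "metric_is g l1 l2 l3"
      using L invariant_metric_iff by blast
    have nz: "z1 \<noteq> 0" "z2 \<noteq> 0" "z3 \<noteq> 0" using L has_rank_iff[OF z f] by (auto split: if_splits)
    then have "z1 = z2" "z2 = z3" "l1 = l2" "l2 = l3" using strict(1)[OF l g z f] L by blast+
    then show ?R
      using nz z f g l by (auto simp: f_sign homothetic_iff)
  next
    assume R: ?R
    then obtain e where e: "e \<in> {-1, 1::int}" "f_is f e e e" unfolding f_sign by auto
    obtain r where r: "r > 0" "metric_is g r r r" using R unfolding homothetic_iff by auto
    have z: "e \<in> ?Z" "e \<noteq> 0" using e by auto
    show ?L
      using strict(1)[OF r(1) r(1) r(1) r(2) z(1) z(1) z(1) e(2)] f_is_invariant[OF z(1) z(1) z(1) e(2)]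
        has_rank_iff[OF z(1) z(1) z(1) e(2)] r invariant_metric_iff z(2) by auto
  qed
  have rank4: "invariant_f_structure f \<and> has_rank f 4 \<and> invariant_metric g \<and> strictly_nearly_kahler g f
       \<longleftrightarrow> (eq_up_to_sign f (inv_f 1 1 0) \<and> (\<exists>s>0. homothetic g (inv_metric 1 1 s))) \<or>
           (eq_up_to_sign f (inv_f 1 0 1) \<and> (\<exists>t>0. homothetic g (inv_metric 1 t 1))) \<or>
           (eq_up_to_sign f (inv_f 0 1 1) \<and> (\<exists>t>0. homothetic g (inv_metric 1 t t)))" (is "?L \<longleftrightarrow> ?R") for f g
  proof -
    \<comment> \<open>In terms of unnormalised coefficients each of the three families says that the
      two coefficients of the active summands agree.\<close>
    have m1: "(\<exists>s>0. homothetic g (inv_metric 1 1 s)) \<longleftrightarrow> (\<exists>l1>0. \<exists>l2>0. \<exists>l3>0. metric_is g l1 l2 l3 \<and> l1 = l2)"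
    proof -
      have "(\<exists>s>0. homothetic g (inv_metric 1 1 s)) \<longleftrightarrow> (\<exists>t>0. \<exists>s>0. t = 1 \<and> homothetic g (inv_metric 1 t s))"
        by (metis zero_less_one)
      also have "\<dots> \<longleftrightarrow> (\<exists>l1>0. \<exists>l2>0. \<exists>l3>0. metric_is g l1 l2 l3 \<and> l1 = l2)"
        unfolding scale by (simp cong: conj_cong)
      finally show ?thesis .
    qed
    have m2: "(\<exists>t>0. homothetic g (inv_metric 1 t 1)) \<longleftrightarrow> (\<exists>l1>0. \<exists>l2>0. \<exists>l3>0. metric_is g l1 l2 l3 \<and> l3 = l1)"
    proof -
      have "(\<exists>t>0. homothetic g (inv_metric 1 t 1)) \<longleftrightarrow> (\<exists>t>0. \<exists>s>0. s = 1 \<and> homothetic g (inv_metric 1 t s))" by auto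
      also have "\<dots> \<longleftrightarrow> (\<exists>l1>0. \<exists>l2>0. \<exists>l3>0. metric_is g l1 l2 l3 \<and> l3 = l1)"
        unfolding scale by (simp cong: conj_cong)
      finally show ?thesis .
    qed
    have m3: "(\<exists>t>0. homothetic g (inv_metric 1 t t)) \<longleftrightarrow> (\<exists>l1>0. \<exists>l2>0. \<exists>l3>0. metric_is g l1 l2 l3 \<and> l3 = l2)"
    proof -
      have "(\<exists>t>0. homothetic g (inv_metric 1 t t)) \<longleftrightarrow> (\<exists>t>0. \<exists>s>0. s = t \<and> homothetic g (inv_metric 1 t s))" by auto
      also have "\<dots> \<longleftrightarrow> (\<exists>l1>0. \<exists>l2>0. \<exists>l3>0. metric_is g l1 l2 l3 \<and> l3 = l2)"
        unfolding scale by (simp cong: conj_cong)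
      finally show ?thesis .
    qed
    note m = m1 m2 m3
    show ?thesis
    proof
      assume L: ?L
      then have "invariant_f_structure f" by blast
        then obtain z1 z2 z3 where z: "z1 \<in> ?Z" "z2 \<in> ?Z" "z3 \<in> ?Z" and f: "f_is f z1 z2 z3"
          by (rule invariant_f_structure_cases)
      obtain l1 l2 l3 where l: "l1 > 0" "l2 > 0" "l3 > 0" and g: "metric_is g l1 l2 l3"
        using L invariant_metric_iff by blast
      consider "z1 \<noteq> 0" "z2 \<noteq> 0" "z3 = 0" | "z1 \<noteq> 0" "z2 = 0" "z3 \<noteq> 0" | "z1 = 0" "z2 \<noteq> 0" "z3 \<noteq> 0"
        using L has_rank_iff[OF z f] by (auto split: if_splits)
      then show ?R
      proof cases
        case 1
        then have "z1 = z2 \<and> l1 = l2" using strict(2)[OF l g z f] L by blast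
        then have "eq_up_to_sign f (inv_f 1 1 0)" "\<exists>s>0. homothetic g (inv_metric 1 1 s)"
          using 1 z f g l unfolding f_sign m by auto
        then show ?thesis by blast
      next
        case 2
        then have "z1 = z3 \<and> l1 = l3" using strict(3)[OF l g z f] L by blast
        then have "eq_up_to_sign f (inv_f 1 0 1)" "\<exists>t>0. homothetic g (inv_metric 1 t 1)"
          using 2 z f g l unfolding f_sign m by auto
        then show ?thesis by blast
      next
        case 3
        then have "z2 = z3 \<and> l2 = l3" using strict(4)[OF l g z f] L by blast
        then have "eq_up_to_sign f (inv_f 0 1 1)" "\<exists>t>0. homothetic g (inv_metric 1 t t)"
          using 3 z f g l unfolding f_sign m by auto
        then show ?thesis by blast
      qed
    next
      assume R: ?R
      \<comment> \<open>The three families share one argument: the nonzero zetas all equal the same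
        sign e, and the matching case of \<open>strict\<close> applies.\<close>
      have *: ?L if "e \<in> {-1, 1::int}" "f_is f z1 z2 z3" "l1 > 0" "l2 > 0" "l3 > 0" "metric_is g l1 l2 l3"
        "z1 = e \<and> z2 = e \<and> z3 = 0 \<and> l1 = l2 \<or> z1 = e \<and> z2 = 0 \<and> z3 = e \<and> l3 = l1 \<or> z1 = 0 \<and> z2 = e \<and> z3 = e \<and> l3 = l2"
        for e z1 z2 z3 l1 l2 l3
      proof -
        have z: "z1 \<in> ?Z" "z2 \<in> ?Z" "z3 \<in> ?Z" "e \<noteq> 0" using that by auto
        note s = strict[OF that(3-6) z(1-3) that(2)]
        have "strictly_nearly_kahler g f" using that(7) s(2-4) z(4) by blast
        moreover have "has_rank f 4" using that(7) has_rank_iff[OF z(1-3) that(2)] z(4) by auto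
        ultimately show ?thesis
          using f_is_invariant[OF z(1-3) that(2)] invariant_metric_iff that(3-6) by blast
      qed
      from R show ?L unfolding f_sign m
      proof (elim disjE conjE bexE exE)
        fix e :: int and l1 l2 l3
        assume "e \<in> {-1, 1}" "f_is f (e * 1) (e * 1) (e * 0)" "l1 > 0" "l2 > 0" "l3 > 0" "metric_is g l1 l2 l3" "l1 = l2"
        then show ?L by (intro *[of e "e * 1" "e * 1" "e * 0" l1 l2 l3]) simp_all
      next
        fix e :: int and l1 l2 l3
        assume "e \<in> {-1, 1}" "f_is f (e * 1) (e * 0) (e * 1)" "l1 > 0" "l2 > 0" "l3 > 0" "metric_is g l1 l2 l3" "l3 = l1"
        then show ?L by (intro *[of e "e * 1" "e * 0" "e * 1" l1 l2 l3]) simp_all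
      next
        fix e :: int and l1 l2 l3
        assume "e \<in> {-1, 1}" "f_is f (e * 0) (e * 1) (e * 1)" "l1 > 0" "l2 > 0" "l3 > 0" "metric_is g l1 l2 l3" "l3 = l2"
        then show ?L by (intro *[of e "e * 0" "e * 1" "e * 1" l1 l2 l3]) simp_all
      qed
    qed
  qed
  have rank2: "invariant_f_structure f \<and> has_rank f 2
        \<longleftrightarrow> eq_up_to_sign f (inv_f 1 0 0) \<or> eq_up_to_sign f (inv_f 0 1 0) \<or> eq_up_to_sign f (inv_f 0 0 1)"
    (is "?L \<longleftrightarrow> ?R") for f
  proof
    assume L: ?L
    then have "invariant_f_structure f" by blast
      then obtain z1 z2 z3 where z: "z1 \<in> ?Z" "z2 \<in> ?Z" "z3 \<in> ?Z" and f: "f_is f z1 z2 z3"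
        by (rule invariant_f_structure_cases)
    then show ?R using L has_rank_iff[OF z f] by (auto simp: f_sign split: if_splits)
  next
    assume R: ?R
    have *: ?L if "e \<in> {-1, 1::int}" "f_is f z1 z2 z3"
      "z1 = e \<and> z2 = 0 \<and> z3 = 0 \<or> z1 = 0 \<and> z2 = e \<and> z3 = 0 \<or> z1 = 0 \<and> z2 = 0 \<and> z3 = e" for e z1 z2 z3
    proof -
      have z: "z1 \<in> ?Z" "z2 \<in> ?Z" "z3 \<in> ?Z" "e \<noteq> 0" using that by auto
      show ?thesis
        using that(3) has_rank_iff[OF z(1-3) that(2)] f_is_invariant[OF z(1-3) that(2)] z(4) by auto
    qed
    from R show ?L unfolding f_sign
    proof (elim disjE bexE)
      fix e :: int
      assume "e \<in> {-1, 1}" "f_is f (e * 1) (e * 0) (e * 0)"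
      then show ?L by (intro *[of e "e * 1" "e * 0" "e * 0"]) simp_all
    next
      fix e :: int
      assume "e \<in> {-1, 1}" "f_is f (e * 0) (e * 1) (e * 0)"
      then show ?L by (intro *[of e "e * 0" "e * 1" "e * 0"]) simp_all
    next
      fix e :: int
      assume "e \<in> {-1, 1}" "f_is f (e * 0) (e * 0) (e * 1)"
      then show ?L by (intro *[of e "e * 0" "e * 0" "e * 1"]) simp_all
    qed
  qed
  have strict2: "strictly_nearly_kahler g f"
    if L: "invariant_f_structure f" "has_rank f 2" "invariant_metric g" for f g
  proof -
    obtain z1 z2 z3 where z: "z1 \<in> ?Z" "z2 \<in> ?Z" "z3 \<in> ?Z" and f: "f_is f z1 z2 z3"
      using L(1) by (rule invariant_f_structure_cases)
    obtain l1 l2 l3 where l: "l1 > 0" "l2 > 0" "l3 > 0" and g: "metric_is g l1 l2 l3"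
      using L invariant_metric_iff by blast
    consider "z1 \<noteq> 0" "z2 = 0" "z3 = 0" | "z1 = 0" "z2 \<noteq> 0" "z3 = 0" | "z1 = 0" "z2 = 0" "z3 \<noteq> 0"
      using L has_rank_iff[OF z f] by (auto split: if_splits)
    then show ?thesis using strict(5-7)[OF l g z f] by cases auto
  qed
  show ?thesis
    by (intro conjI allI impI rank6 rank4 rank2 metrics) (elim conjE, rule strict2)
qed

end
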